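(* Let $\mathbb C$ be a left representable skew multicategory and let $\mathbb C_s$ be the corresponding left representable short skew multicategory (the image of $\mathbb C$ under the forgetful functor). Then there is a bijection between braidings on $\mathbb C$ and short braidings on $\mathbb C_s$. This correspondence restricts to one between symmetries on $\mathbb C$ and short symmetries on $\mathbb C_s$.
   Context: For $x,y\in\{t,l\}$ put $x\circ_iy=t$ if ($x=y=t$ and $i=1$) or ($x=t$ and $i\ne1$), and $x\circ_iy=l$ otherwise. ($t$ = "tight", $l$ = "loose".) **Skew multicategories.** A skew multicategory has objects, sets $\mathbb C^t_n(\bar a;b)$ ($n\ge1$) and $\mathbb C^l_n(\bar a;b)$ ($n\ge0$), functions $j\colon\mathbb C^t_n(\bar a;b)\to\mathbb C^l_n(\bar a;b)$ ($n\ge1$), identities $1_a\in\mathbb C^t_1(a;a)$, and substitutions $\circ_i\colon\mathbb C^x_n(\bar b;c)\times\mathbb C^y_m(\bar a;b_i)\to\mathbb C^{x\circ_iy}_{n+m-1}(\bar b_{<i},\bar a,\bar b_{>i};c)$ for all $n\ge1$, $m\ge 0$, $1\le i\le n$ and all types, satisfying the usual multicategory associativity, commutativity and identity axioms, and compatible with $j$: replacing a tight argument of $g\circ_if$ by its image under $j$ leaves $g\circ_i f$ unchanged if the type of the result does not change, and replaces it by $j(g\circ_if)$ if the type changes from $t$ to $l$. Write $g(f_1,\dots,f_n)$ for the simultaneous substitution obtained by iterating the $\circ_i$; it is tight exactly when $g$ and $f_1$ are. A skew multicategory is left representable if for each $x\in\{t,l\}$ and each $\bar a$ of length $n$ ($n\ge1$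 if $x=t$, $n\ge0$ if $x=l$) there is $\theta^x_{\bar a}\in\mathbb C^x_n(\bar a;m^x\bar a)$ such that $-\circ_1\theta^x_{\bar a}\colon\mathbb C^t_{1+r}(m^x\bar a,\bar y;b)\to\mathbb C^x_{n+r}(\bar a,\bar y;b)$ is bijective for all $r\ge0$, $\bar y$ of length $r$, $b$. **Braidings on skew multicategories.** Let $\mathcal B_n$ be the braid group on $n$ strands, with canonical map to the symmetric group $\mathcal S_n$, and let $\mathcal B^1_n\le\mathcal B_n$ be the subgroup fixing the first variable, i.e. of braids leaving the first strand untouched (the image of $\mathcal B_{n-1}$ acting on the last $n-1$ strands). A braiding on $\mathbb C$ consists of actions $r^*\colon\mathbb C^l_n(a_1,\dots,a_n;b)\to\mathbb C^l_n(a_{r1},\dots,a_{rn};b)$ for $r\in\mathcal B_n$ and $r^*\colon\mathbb C^t_n(a_1,\dots,a_n;b)\to\mathbb C^t_n(a_{r1},\dots,a_{rn};b)$ for $r\in\mathcal B^1_n$ (with $1^*=1$, $(rs)^*=s^*r^*$), commuting with $j$ and compatible with substitution: $g(s_1^*f_1,\dots,s_n^*f_n)=(s_1\oplus\dots\oplus s_n)^*\,g(f_1,\dots,f_n)$ and $(r^*g)(f_{r1},\dots,f_{rn})=\tilde r^*\,g(f_1,\dots,f_n)$, where $\oplus$ is juxtaposition of braids and $\tilde r$ is the block braid obtained from $r$ by replacing the strand of the $k$-th input of $g$ by as many parallel strands as the arity of $f_k$ (whenever the actions involved are defined). It is a symmetry if $r^*=s^*$ whenever $r$ and $s$ have the same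 image in $\mathcal S_n$. **Short skew multicategories.** A short skew multicategory $\mathbb C$ consists of a category $\mathcal C$; functors $\mathbb C^t_n(-;-)\colon(\mathcal C^n)^{op}\times\mathcal C\to\mathrm{Set}$ for $1\le n\le4$ with $\mathbb C^t_1=\mathcal C(-,-)$; functors $\mathbb C^l_n(-;-)\colon(\mathcal C^n)^{op}\times\mathcal C\to\mathrm{Set}$ for $n=0,1,2$; natural transformations $j\colon\mathbb C^t_n\to\mathbb C^l_n$ for $n=1,2$; and substitutions $\circ_i\colon\mathbb C^x_n(\bar b;c)\times\mathbb C^y_m(\bar a;b_i)\to\mathbb C^{x\circ_iy}_{n+m-1}(\bar b_{<i},\bar a,\bar b_{>i};c)$, natural in all variables except dinatural in $b_i$, for: tight binary into tight binary or ternary; tight ternary into tight binary; nullary into tight binary or ternary; nullary into loose unary; loose unary into tight binary; tight binary into loose unary. Axioms (for $f$ tight binary, $g$ $n$-ary, $h$ $p$-ary, all tight except nullary ones): $f\circ_i(g\circ_jh)=(f\circ_ig)\circ_{j+i-1}h$ for $(n,p)\in\{(2,2),(2,0)\}$, $1\le i\le2$, $1\le j\le n$; $(f\circ_1g)\circ_{n+1}h=(f\circ_2h)\circ_1g$ for $(n,p)\in\{(2,2),(2,0),(0,2),(0,0)\}$; and, for $g$ tight binary, $p,q$ tight unary, $v$ nullary, $g\circ_2jp=g\circ_2p$, $g\circ_1jp=j(g\circ_1p)$, $q\circ jp=j(q\circ p)$, $jp\circ g=j(p\circ g)$, $jp\circ v=p\circ v$. The short skew multicategory $\mathbb C_s$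 underlying a skew multicategory $\mathbb C$ has $\mathcal C$ = the category of tight unary maps, and keeps the tight $n$-ary maps for $1\le n\le4$, the loose $n$-ary maps for $0\le n\le2$, and the operations just listed. **Short braidings.** A short braiding on a short skew multicategory consists of natural isomorphisms $\beta^3_2\colon\mathbb C^t_3(a_1,a_2,a_3;b)\to\mathbb C^t_3(a_1,a_3,a_2;b)$, $\beta^4_2\colon\mathbb C^t_4(a_1,a_2,a_3,a_4;b)\to\mathbb C^t_4(a_1,a_3,a_2,a_4;b)$, $\beta^4_3\colon\mathbb C^t_4(a_1,a_2,a_3,a_4;b)\to\mathbb C^t_4(a_1,a_2,a_4,a_3;b)$ such that: $\beta^4_2\beta^4_3\beta^4_2(h)=\beta^4_3\beta^4_2\beta^4_3(h)$ for $h$ tight 4-ary; $g\circ_1\beta^3_2(f)=\beta^4_2(g\circ_1f)$ and $g\circ_2\beta^3_2(f)=\beta^4_3(g\circ_2f)$ for $g$ tight binary, $f$ tight ternary; $\beta^4_3(g\circ_1f)=\beta^3_2(g)\circ_1f$, $\beta^4_2\beta^4_3(g\circ_2f)=\beta^3_2(g)\circ_3f$, $\beta^4_3\beta^4_2(g\circ_3f)=\beta^3_2(g)\circ_2f$ for $g$ tight ternary, $f$ tight binary. It is a short symmetry if moreover $\beta^3_2\beta^3_2=1$. *)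

theory Defs
  imports "HOL-Combinatorics.Permutations" "HOL-Algebra.Group"
begin

section \<open>Braid groups\<close>

text \<open>
  Positions are numbered from 0.  \<open>(i, True)\<close> is the Artin generator crossing the strands in
  positions \<open>i\<close> and \<open>i + 1\<close>, and \<open>(i, False)\<close> is its inverse.
\<close>

type_synonym braid_word = "(nat \<times> bool) list"

definition braid_words :: "nat \<Rightarrow> braid_word set" where
  "braid_words n = lists ({i. Suc i < n} \<times> UNIV)"

inductive braid_eq :: "nat \<Rightarrow> braid_word \<Rightarrow> braid_word \<Rightarrow> bool" for n where
  refl: "w \<in> braid_words n \<Longrightarrow> braid_eq n w w"
| sym: "braid_eq n u v \<Longrightarrow> braid_eq n v u"
| trans [trans]: "braid_eq n u v \<Longrightarrow> braid_eq n v w \<Longrightarrow> braid_eq n u w"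
| append: "braid_eq n u u' \<Longrightarrow> braid_eq n v v' \<Longrightarrow> braid_eq n (u @ v) (u' @ v')"
| cancel: "Suc i < n \<Longrightarrow> braid_eq n [(i, e), (i, \<not> e)] []"
| far: "Suc i < k \<Longrightarrow> Suc k < n \<Longrightarrow>
    braid_eq n [(i, True), (k, True)] [(k, True), (i, True)]"
| braid: "Suc (Suc i) < n \<Longrightarrow>
    braid_eq n [(i, True), (Suc i, True), (i, True)] [(Suc i, True), (i, True), (Suc i, True)]"

definition braid_class :: "nat \<Rightarrow> braid_word \<Rightarrow> braid_word set" where
  "braid_class n w = {v. braid_eq n w v}"

text \<open>The operations on braids below are defined by means of representing words; the lemmas
  \<open>braid_mult_class\<close>, \<open>braid_perm_class\<close>, \<open>braid_juxtapose_class\<close> and \<open>braid_block_class\<close> show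
  that they do not depend on the choice.\<close>

definition braid_rep :: "braid_word set \<Rightarrow> braid_word" where
  "braid_rep r = (SOME w. w \<in> r)"

definition braid_group :: "nat \<Rightarrow> braid_word set monoid" where
  "braid_group n =
    \<lparr>carrier = braid_class n ` braid_words n,
     monoid.mult = (\<lambda>r s. braid_class n (braid_rep r @ braid_rep s)),
     one = braid_class n []\<rparr>"

definition braid_gen :: "nat \<Rightarrow> nat \<Rightarrow> braid_word set" where
  "braid_gen n i = braid_class n [(i, True)]"

definition braid_shift :: "nat \<Rightarrow> braid_word \<Rightarrow> braid_word" where
  "braid_shift k w = map (\<lambda>(i, e). (i + k, e)) w"

text \<open>The image of the braid group on \<open>n - 1\<close> strands acting on the last \<open>n - 1\<close> strands.\<close>

definition braids_fixing_first :: "nat \<Rightarrow> braid_word set set" where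
  "braids_fixing_first n = (\<lambda>w. braid_class n (braid_shift 1 w)) ` braid_words (n - 1)"

definition word_perm :: "braid_word \<Rightarrow> nat \<Rightarrow> nat" where
  "word_perm w = foldr (\<lambda>(i, e) p. transpose i (Suc i) \<circ> p) w id"

definition braid_perm :: "braid_word set \<Rightarrow> nat \<Rightarrow> nat" where
  "braid_perm r = word_perm (braid_rep r)"

fun juxtapose_words :: "nat list \<Rightarrow> braid_word list \<Rightarrow> braid_word" where
  "juxtapose_words (k # ks) (w # ws) = w @ braid_shift k (juxtapose_words ks ws)"
| "juxtapose_words _ _ = []"

text \<open>\<open>ks ! i\<close> is the number of strands of the braid \<open>rs ! i\<close>.\<close>

definition braid_juxtapose :: "nat list \<Rightarrow> braid_word set list \<Rightarrow> braid_word set" where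
  "braid_juxtapose ks rs = braid_class (sum_list ks) (juxtapose_words ks (map braid_rep rs))"

definition inverse_word :: "braid_word \<Rightarrow> braid_word" where
  "inverse_word w = rev (map (\<lambda>(i, e). (i, \<not> e)) w)"

definition cross_one :: "nat \<Rightarrow> nat \<Rightarrow> braid_word" where
  "cross_one k p = map (\<lambda>i. (i, True)) [k..<k + p]"

text \<open>
  The positive crossing of the block of \<open>m\<close> strands starting in position \<open>k\<close> with the adjacent
  block of \<open>p\<close> strands starting in position \<open>k + m\<close>; the strands of the first block are moved
  across the second block one at a time, the rightmost one first.
\<close>

fun cross_blocks :: "nat \<Rightarrow> nat \<Rightarrow> nat \<Rightarrow> braid_word" where
  "cross_blocks k 0 p = []"
| "cross_blocks k (Suc m) p = cross_one (k + m) p @ cross_blocks k m p"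

definition block_letter :: "nat list \<Rightarrow> nat \<times> bool \<Rightarrow> braid_word" where
  "block_letter ks = (\<lambda>(i, e).
    let k = sum_list (take i ks); m = ks ! i; p = ks ! Suc i
    in if e then cross_blocks k m p else inverse_word (cross_blocks k p m))"

fun block_word :: "nat list \<Rightarrow> braid_word \<Rightarrow> braid_word" where
  "block_word ks [] = []"
| "block_word ks (l # w) =
    block_letter ks l @ block_word (permute_list (transpose (fst l) (Suc (fst l))) ks) w"

text \<open>The block braid in which the strand starting in position \<open>i\<close> is replaced by \<open>ks ! i\<close> strands.\<close>

definition braid_block :: "nat list \<Rightarrow> braid_word set \<Rightarrow> braid_word set" where
  "braid_block ks r = braid_class (sum_list ks) (block_word ks (braid_rep r))"

subsection \<open>Independence of representatives\<close>

lemma braid_words_simps [simp]: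
  "[] \<in> braid_words n"
  "l # w \<in> braid_words n \<longleftrightarrow> Suc (fst l) < n \<and> w \<in> braid_words n"
  "u @ v \<in> braid_words n \<longleftrightarrow> u \<in> braid_words n \<and> v \<in> braid_words n"
  by (cases l; auto simp: braid_words_def)+

lemma braid_eq_words: "braid_eq n u v \<Longrightarrow> u \<in> braid_words n \<and> v \<in> braid_words n"
  by (induction rule: braid_eq.induct) auto

lemma braid_class_eqI: "braid_eq n u v \<Longrightarrow> braid_class n u = braid_class n v"
  unfolding braid_class_def by (blast intro: braid_eq.sym braid_eq.trans)

lemma braid_class_eq_iff:
  "u \<in> braid_words n \<Longrightarrow> braid_class n u = braid_class n v \<longleftrightarrow> braid_eq n u v"
  unfolding braid_class_def by (blast intro: braid_eq.refl braid_eq.sym braid_eq.trans)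

lemma braid_rep_class: "w \<in> braid_words n \<Longrightarrow> braid_eq n w (braid_rep (braid_class n w))"
  unfolding braid_rep_def braid_class_def mem_Collect_eq
  by (rule someI[where x = w]) (rule braid_eq.refl)

lemma braid_rep_words: "r \<in> carrier (braid_group n) \<Longrightarrow> braid_rep r \<in> braid_words n"
  using braid_rep_class braid_eq_words by (fastforce simp: braid_group_def)

lemma braid_class_rep: "r \<in> carrier (braid_group n) \<Longrightarrow> braid_class n (braid_rep r) = r"
  using braid_rep_class braid_class_eqI by (fastforce simp: braid_group_def)

lemma braid_mult_class:
  assumes "u \<in> braid_words n" "v \<in> braid_words n"
  shows "braid_class n u \<otimes>\<^bsub>braid_group n\<^esub> braid_class n v = braid_class n (u @ v)"
  using braid_class_eqI[OF braid_eq.append[OF assms[THEN braid_rep_class]]]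
  by (simp add: braid_group_def)

lemma inverse_word_simps [simp]:
  "inverse_word [] = []"
  "inverse_word (l # w) = inverse_word w @ [(fst l, \<not> snd l)]"
  "inverse_word (u @ v) = inverse_word v @ inverse_word u"
  by (auto simp: inverse_word_def split: prod.splits)

lemma inverse_word_in [simp]: "inverse_word w \<in> braid_words n \<longleftrightarrow> w \<in> braid_words n"
  by (induction w) auto

lemma inverse_inverse_word [simp]: "inverse_word (inverse_word w) = w"
  by (induction w) auto

lemma inverse_word_cancel:
  assumes "w \<in> braid_words n"
  shows "braid_eq n (inverse_word w @ w) []"
  using assms
proof (induction w)
  case Nil
  then show ?case by (simp add: braid_eq.refl)
next
  case (Cons l w)
  have "braid_eq n [(fst l, \<not> snd l), l] []"
    using braid_eq.cancel[of "fst l" n "\<not> snd l"] Cons.prems by simp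
  then have "braid_eq n (inverse_word w @ [(fst l, \<not> snd l), l] @ w) (inverse_word w @ [] @ w)"
    using Cons.prems by (intro braid_eq.append) (auto intro: braid_eq.refl)
  also have "braid_eq n (inverse_word w @ [] @ w) []" using Cons by simp
  finally show ?case by simp
qed

lemma inverse_word_cancel':
  "w \<in> braid_words n \<Longrightarrow> braid_eq n (w @ inverse_word w) []"
  using inverse_word_cancel[of "inverse_word w" n] by simp

lemma group_braid_group: "group (braid_group n)"
proof (rule groupI)
  have c: "carrier (braid_group n) = braid_class n ` braid_words n"
    "\<one>\<^bsub>braid_group n\<^esub> = braid_class n []"
    by (auto simp: braid_group_def)
  show "\<one>\<^bsub>braid_group n\<^esub> \<in> carrier (braid_group n)" by (auto simp: c)
  fix x assume "x \<in> carrier (braid_group n)"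
  then obtain u where u: "u \<in> braid_words n" "x = braid_class n u" by (auto simp: c)
  show "\<one>\<^bsub>braid_group n\<^esub> \<otimes>\<^bsub>braid_group n\<^esub> x = x"
    using u by (simp add: c braid_mult_class)
  show "\<exists>y\<in>carrier (braid_group n). y \<otimes>\<^bsub>braid_group n\<^esub> x = \<one>\<^bsub>braid_group n\<^esub>"
    using u inverse_word_cancel[of u n]
    by (intro bexI[of _ "braid_class n (inverse_word u)"])
      (auto simp: c braid_mult_class braid_class_eqI)
  fix y assume "y \<in> carrier (braid_group n)"
  then obtain v where v: "v \<in> braid_words n" "y = braid_class n v" by (auto simp: c)
  show "x \<otimes>\<^bsub>braid_group n\<^esub> y \<in> carrier (braid_group n)"
    using u v by (auto simp: c braid_mult_class)
  fix z assume "z \<in> carrier (braid_group n)"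
  then obtain w where w: "w \<in> braid_words n" "z = braid_class n w" by (auto simp: c)
  show "x \<otimes>\<^bsub>braid_group n\<^esub> y \<otimes>\<^bsub>braid_group n\<^esub> z =
      x \<otimes>\<^bsub>braid_group n\<^esub> (y \<otimes>\<^bsub>braid_group n\<^esub> z)"
    using u v w by (simp add: braid_mult_class)
qed

lemma word_perm_simps [simp]:
  "word_perm [] = id"
  "word_perm (l # w) = transpose (fst l) (Suc (fst l)) \<circ> word_perm w"
  "word_perm (u @ v) = word_perm u \<circ> word_perm v"
proof -
  show 1: "word_perm [] = id"
    "word_perm (l # w) = transpose (fst l) (Suc (fst l)) \<circ> word_perm w" for l w
    by (auto simp: word_perm_def split: prod.splits)
  show "word_perm (u @ v) = word_perm u \<circ> word_perm v"
    by (induction u) (auto simp: 1 comp_assoc)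
qed

lemma word_perm_permutes: "w \<in> braid_words n \<Longrightarrow> word_perm w permutes {..<n}"
proof (induction w)
  case (Cons l w)
  have "transpose (fst l) (Suc (fst l)) permutes {..<n}"
    using Cons.prems by (auto intro: permutes_swap_id)
  with Cons show ?case unfolding word_perm_simps by (intro permutes_compose) auto
qed (simp add: permutes_id)

lemma word_perm_cong: "braid_eq n u v \<Longrightarrow> word_perm u = word_perm v"
  by (induction rule: braid_eq.induct) (auto simp: fun_eq_iff transpose_def)

lemma braid_perm_class: "w \<in> braid_words n \<Longrightarrow> braid_perm (braid_class n w) = word_perm w"
  unfolding braid_perm_def using braid_rep_class word_perm_cong by fastforce

lemma braid_shift_simps [simp]:
  "braid_shift k [] = []"
  "braid_shift k (l # w) = (fst l + k, snd l) # braid_shift k w"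
  "braid_shift k (u @ v) = braid_shift k u @ braid_shift k v"
  by (auto simp: braid_shift_def split: prod.splits)

lemma braid_shift_words: "w \<in> braid_words n \<Longrightarrow> n + k \<le> N \<Longrightarrow> braid_shift k w \<in> braid_words N"
  by (induction w) auto

lemma braid_eq_shift:
  "braid_eq n u v \<Longrightarrow> n + k \<le> N \<Longrightarrow> braid_eq N (braid_shift k u) (braid_shift k v)"
proof (induction rule: braid_eq.induct)
  case (refl w)
  then show ?case by (auto intro: braid_eq.refl braid_shift_words)
next
  case (trans u v w)
  then show ?case by (meson braid_eq.trans)
next
  case (sym u v)
  then show ?case by (meson braid_eq.sym)
next
  case (append u u' v v')
  then show ?case by (simp add: braid_eq.append)
qed (auto intro!: braid_eq.cancel braid_eq.far braid_eq.braid)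

lemma braid_words_mono: "w \<in> braid_words n \<Longrightarrow> n \<le> N \<Longrightarrow> w \<in> braid_words N"
  by (induction w) auto

lemma braid_eq_mono: "braid_eq n u v \<Longrightarrow> n \<le> N \<Longrightarrow> braid_eq N u v"
proof (induction rule: braid_eq.induct)
  case (refl w)
  then show ?case by (auto intro: braid_eq.refl braid_words_mono)
next
  case (trans u v w)
  then show ?case by (meson braid_eq.trans)
next
  case (sym u v)
  then show ?case by (meson braid_eq.sym)
next
  case (append u u' v v')
  then show ?case by (simp add: braid_eq.append)
qed (auto intro!: braid_eq.cancel braid_eq.far braid_eq.braid)

lemma juxtapose_words_cong:
  assumes "length us = length ks" "length vs = length ks"
    and "\<And>i. i < length ks \<Longrightarrow> braid_eq (ks ! i) (us ! i) (vs ! i)"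
  shows "braid_eq (sum_list ks) (juxtapose_words ks us) (juxtapose_words ks vs)"
  using assms
proof (induction ks arbitrary: us vs)
  case Nil
  then show ?case by (simp add: braid_eq.refl)
next
  case (Cons k ks)
  obtain u us' v vs' where eq: "us = u # us'" "vs = v # vs'"
    using Cons.prems by (cases us; cases vs) auto
  have "braid_eq (sum_list ks) (juxtapose_words ks us') (juxtapose_words ks vs')"
    using Cons.prems(1,2) Cons.prems(3)[of "Suc _"] by (intro Cons.IH) (auto simp: eq)
  moreover have "braid_eq k u v" using Cons.prems(3)[of 0] by (simp add: eq)
  ultimately show ?case
    using braid_eq.append[OF braid_eq_mono braid_eq_shift] by (simp add: eq)
qed

lemma braid_juxtapose_class:
  assumes "length ws = length ks" "\<And>i. i < length ks \<Longrightarrow> ws ! i \<in> braid_words (ks ! i)"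
  shows "braid_juxtapose ks (map2 braid_class ks ws) = braid_class (sum_list ks) (juxtapose_words ks ws)"
  unfolding braid_juxtapose_def
  using assms braid_eq.sym[OF braid_rep_class]
  by (intro braid_class_eqI juxtapose_words_cong) auto

subsection \<open>Block braids are well defined\<close>

definition far_apart :: "braid_word \<Rightarrow> braid_word \<Rightarrow> bool" where
  "far_apart u v \<longleftrightarrow> (\<forall>(i, e)\<in>set u. \<forall>(k, d)\<in>set v. Suc i < k)"

lemma far_letters_commute:
  assumes "Suc i < k" "Suc k < n"
  shows "braid_eq n [(i, e), (k, d)] [(k, d), (i, e)]"
proof -
  have conj: "braid_eq n [y, (x, \<not> b)] [(x, \<not> b), y]"
    if "braid_eq n [(x, b), y] [y, (x, b)]" "Suc x < n" "Suc (fst y) < n" for x b y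
  proof -
    have r: "braid_eq n [(x, \<not> b)] [(x, \<not> b)]" "braid_eq n [y] [y]"
      using that by (auto intro!: braid_eq.refl)
    have c: "braid_eq n [(x, \<not> b), (x, b)] []" "braid_eq n [(x, b), (x, \<not> b)] []"
      using braid_eq.cancel[of x n "\<not> b"] braid_eq.cancel[of x n b] that by auto
    have "braid_eq n [y, (x, \<not> b)] [(x, \<not> b), (x, b), y, (x, \<not> b)]"
      using braid_eq.append[OF braid_eq.sym[OF c(1)] braid_eq.append[OF r(2,1)]] by simp
    also have "braid_eq n \<dots> [(x, \<not> b), y, (x, b), (x, \<not> b)]"
      using braid_eq.append[OF r(1) braid_eq.append[OF that(1) r(1)]] by simp
    also have "braid_eq n \<dots> [(x, \<not> b), y]"
      using braid_eq.append[OF r(1) braid_eq.append[OF r(2) c(2)]] by simp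
    finally show ?thesis .
  qed
  have 1: "braid_eq n [(i, True), (k, True)] [(k, True), (i, True)]"
    using assms by (intro braid_eq.far)
  have 2: "braid_eq n [(i, e), (k, True)] [(k, True), (i, e)]"
    using 1 braid_eq.sym[OF conj[OF 1]] assms conj[OF 1] by (cases e) auto
  show ?thesis
    using 2 conj[OF braid_eq.sym[OF 2]] assms by (cases d) auto
qed

lemma far_letter_commutes:
  assumes "v \<in> braid_words n" "Suc i < n" "\<forall>(k, d)\<in>set v. Suc i < k"
  shows "braid_eq n ([(i, e)] @ v) (v @ [(i, e)])"
  using assms
proof (induction v)
  case Nil
  then show ?case by (auto intro: braid_eq.refl)
next
  case (Cons l v)
  obtain k d where l: "l = (k, d)" by (cases l)
  have v: "braid_eq n v v" "braid_eq n [(k, d)] [(k, d)]"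
    using Cons.prems by (auto simp: l intro!: braid_eq.refl)
  have 1: "braid_eq n [(i, e), (k, d)] [(k, d), (i, e)]"
    using Cons.prems by (intro far_letters_commute) (auto simp: l)
  have 2: "braid_eq n ([(i, e)] @ v) (v @ [(i, e)])"
    using Cons by simp
  have "braid_eq n ((i, e) # (k, d) # v) ((k, d) # (i, e) # v)"
    using braid_eq.append[OF 1 v(1)] by simp
  also have "braid_eq n \<dots> ((k, d) # v @ [(i, e)])"
    using braid_eq.append[OF v(2) 2] by simp
  finally show ?case by (simp add: l)
qed

lemma far_commutes:
  assumes "u \<in> braid_words n" "v \<in> braid_words n" "far_apart u v"
  shows "braid_eq n (u @ v) (v @ u)"
  using assms
proof (induction u)
  case Nil
  then show ?case by (auto intro: braid_eq.refl)
next
  case (Cons l u)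
  obtain i e where l: "l = (i, e)" by (cases l)
  have r: "braid_eq n u u" "braid_eq n [(i, e)] [(i, e)]"
    using Cons.prems by (auto simp: l intro!: braid_eq.refl)
  have 1: "braid_eq n ([(i, e)] @ v) (v @ [(i, e)])"
    using Cons.prems by (intro far_letter_commutes) (auto simp: l far_apart_def)
  have 2: "braid_eq n (u @ v) (v @ u)"
    using Cons by (simp add: far_apart_def)
  have "braid_eq n ((i, e) # u @ v) ((i, e) # v @ u)"
    using braid_eq.append[OF r(2) 2] by simp
  also have "braid_eq n \<dots> (v @ (i, e) # u)"
    using braid_eq.append[OF 1 r(1)] by simp
  finally show ?case by (simp add: l)
qed

lemma cross_one_words: "k + p < n \<or> p = 0 \<Longrightarrow> cross_one k p \<in> braid_words n"
  by (auto simp: cross_one_def braid_words_def in_lists_conv_set)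

lemma cross_blocks_set:
  "(i, e) \<in> set (cross_blocks k m p) \<Longrightarrow> k \<le> i \<and> Suc i < k + m + p"
  by (induction m) (auto simp: cross_one_def)

lemma cross_blocks_words: "k + m + p \<le> n \<Longrightarrow> cross_blocks k m p \<in> braid_words n"
  by (auto simp: braid_words_def in_lists_conv_set dest!: cross_blocks_set)

lemma cross_one_add: "cross_one k (p + q) = cross_one k p @ cross_one (k + p) q"
  using upt_add_eq_append[of k "k + p" q] by (simp add: cross_one_def add.assoc)

lemma cross_blocks_add:
  assumes "k + m + p + q \<le> n"
  shows "braid_eq n (cross_blocks k m (p + q)) (cross_blocks k m p @ cross_blocks (k + p) m q)"
  using assms
proof (induction m)
  case 0
  then show ?case by (auto intro: braid_eq.refl)
next
  case (Suc m)
  let ?a = "cross_one (k + m) p" and ?b = "cross_one (k + m + p) q"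
    and ?c = "cross_blocks k m p" and ?d = "cross_blocks (k + p) m q"
  have w: "?a \<in> braid_words n" "?b \<in> braid_words n" "?c \<in> braid_words n" "?d \<in> braid_words n"
    using Suc.prems by (auto intro!: cross_one_words cross_blocks_words)
  have "far_apart ?c ?b"
    by (auto simp: far_apart_def cross_one_def dest!: cross_blocks_set)
  then have "braid_eq n (?c @ ?b) (?b @ ?c)" using w by (intro far_commutes)
  from braid_eq.sym[OF this] have 1: "braid_eq n (?b @ ?c) (?c @ ?b)" .
  have r: "braid_eq n (?a @ ?b) (?a @ ?b)" "braid_eq n ?a ?a" "braid_eq n ?d ?d"
    using w by (auto intro!: braid_eq.refl)
  have IH: "braid_eq n (cross_blocks k m (p + q)) (?c @ ?d)"
    using Suc by simp
  have "braid_eq n (?a @ ?b @ cross_blocks k m (p + q)) (?a @ ?b @ ?c @ ?d)"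
    using braid_eq.append[OF r(1) IH] by simp
  also have "braid_eq n (?a @ ?b @ ?c @ ?d) (?a @ ?c @ ?b @ ?d)"
    using braid_eq.append[OF r(2) braid_eq.append[OF 1 r(3)]] by simp
  finally have "braid_eq n (?a @ ?b @ cross_blocks k m (p + q)) (?a @ ?c @ ?b @ ?d)" .
  moreover have "k + p + m = k + m + p" by simp
  ultimately show ?case
    by (simp only: cross_blocks.simps cross_one_add append_assoc)
qed

lemma cross_one_slide:
  assumes "Suc j < p" "k + p < n"
  shows "braid_eq n ([(k + Suc j, True)] @ cross_one k p) (cross_one k p @ [(k + j, True)])"
proof -
  define a where "a = cross_one k j"
  define b where "b = cross_one (Suc (Suc (k + j))) (p - Suc (Suc j))"
  let ?s = "(k + j, True)" and ?t = "(Suc (k + j), True)"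
  have "[k..<k + p] = [k..<k + j] @ [k + j..<k + p]"
    using assms upt_add_eq_append[of k "k + j" "p - j"] by simp
  moreover have "[k + j..<k + p] = [k + j, Suc (k + j)] @ [Suc (Suc (k + j))..<k + p]"
    using assms by (simp add: upt_conv_Cons)
  moreover have e: "Suc (Suc (k + j)) + (p - Suc (Suc j)) = k + p" using assms by simp
  have "b = map (\<lambda>i. (i, True)) [Suc (Suc (k + j))..<k + p]"
    unfolding b_def cross_one_def e ..
  ultimately have eq: "cross_one k p = a @ [?s, ?t] @ b"
    by (simp add: cross_one_def a_def)
  have w: "a \<in> braid_words n" "b \<in> braid_words n"
    using assms by (auto simp: a_def b_def intro!: cross_one_words)
  have w2: "[?s] \<in> braid_words n" "[?t] \<in> braid_words n" using assms by auto
  have 1: "braid_eq n ([?t] @ a) (a @ [?t])"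
    using w w2 by (intro braid_eq.sym[OF far_commutes]) (auto simp: far_apart_def a_def cross_one_def)
  have 2: "braid_eq n ([?s] @ b) (b @ [?s])"
    using w w2 by (intro far_commutes) (auto simp: far_apart_def b_def cross_one_def)
  have 3: "braid_eq n [?t, ?s, ?t] [?s, ?t, ?s]"
    using assms by (intro braid_eq.sym[OF braid_eq.braid]) auto
  have r: "braid_eq n a a" "braid_eq n b b" "braid_eq n [?s, ?t] [?s, ?t]"
    using w w2 by (auto intro!: braid_eq.refl)
  have "braid_eq n (?t # a @ ?s # ?t # b) (a @ ?t # ?s # ?t # b)"
    using braid_eq.append[OF 1 braid_eq.append[OF r(3,2)]] by simp
  also have "braid_eq n \<dots> (a @ ?s # ?t # ?s # b)"
    using braid_eq.append[OF r(1) braid_eq.append[OF 3 r(2)]] by simp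
  also have "braid_eq n \<dots> (a @ ?s # ?t # b @ [?s])"
    using braid_eq.append[OF r(1) braid_eq.append[OF r(3) 2]] by simp
  finally show ?thesis by (simp add: eq)
qed

lemma cross_blocks_slide_letter:
  assumes "Suc j < p" "k + m + p \<le> n"
  shows "braid_eq n ([(k + m + j, True)] @ cross_blocks k m p) (cross_blocks k m p @ [(k + j, True)])"
  using assms
proof (induction m)
  case 0
  then show ?case by (auto intro!: braid_eq.refl)
next
  case (Suc m)
  let ?a = "cross_one (k + m) p" and ?c = "cross_blocks k m p"
  have w: "?a \<in> braid_words n" "?c \<in> braid_words n"
    using Suc.prems by (auto intro!: cross_one_words cross_blocks_words)
  have r: "braid_eq n ?a ?a" "braid_eq n ?c ?c"
    using w by (auto intro!: braid_eq.refl)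
  have 1: "braid_eq n ([(k + m + Suc j, True)] @ ?a) (?a @ [(k + m + j, True)])"
    using Suc.prems by (intro cross_one_slide) auto
  have 2: "braid_eq n ([(k + m + j, True)] @ ?c) (?c @ [(k + j, True)])"
    using Suc by simp
  have "braid_eq n ((k + m + Suc j, True) # ?a @ ?c) (?a @ (k + m + j, True) # ?c)"
    using braid_eq.append[OF 1 r(2)] by simp
  also have "braid_eq n (?a @ (k + m + j, True) # ?c) (?a @ ?c @ [(k + j, True)])"
    using braid_eq.append[OF r(1) 2] by simp
  finally show ?case by simp
qed

lemma cross_blocks_slide:
  assumes "w \<in> braid_words p" "snd ` set w \<subseteq> {True}" "k + m + p \<le> n"
  shows "braid_eq n (braid_shift (k + m) w @ cross_blocks k m p) (cross_blocks k m p @ braid_shift k w)"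
  using assms(1,2)
proof (induction w)
  case Nil
  show ?case using cross_blocks_words[OF assms(3)] by (auto intro: braid_eq.refl)
next
  case (Cons l w)
  let ?c = "cross_blocks k m p"
  obtain j where l: "l = (j, True)" using Cons.prems by (cases l) auto
  have w: "?c \<in> braid_words n" "braid_shift k w \<in> braid_words n"
    using Cons.prems assms(3) by (auto intro: cross_blocks_words braid_shift_words)
  have r: "braid_eq n (braid_shift k w) (braid_shift k w)"
    "braid_eq n [(k + m + j, True)] [(k + m + j, True)]"
    using w Cons.prems assms(3) by (auto simp: l intro!: braid_eq.refl)
  have 1: "braid_eq n ([(k + m + j, True)] @ ?c) (?c @ [(k + j, True)])"
    using Cons.prems assms(3) by (intro cross_blocks_slide_letter) (auto simp: l)
  have 2: "braid_eq n (braid_shift (k + m) w @ ?c) (?c @ braid_shift k w)"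
    using Cons by simp
  have "braid_eq n ((k + m + j, True) # braid_shift (k + m) w @ ?c)
      ((k + m + j, True) # ?c @ braid_shift k w)"
    using braid_eq.append[OF r(2) 2] by simp
  also have "braid_eq n ((k + m + j, True) # ?c @ braid_shift k w)
      (?c @ (k + j, True) # braid_shift k w)"
    using braid_eq.append[OF 1 r(1)] by simp
  finally show ?case by (simp add: l add.commute[of j])
qed

lemma braid_shift_cross_blocks: "braid_shift j (cross_blocks k m p) = cross_blocks (k + j) m p"
proof -
  have 1: "braid_shift j (cross_one k p) = cross_one (k + j) p" for k
    by (auto simp: cross_one_def braid_shift_def intro!: nth_equalityI)
  show ?thesis
    by (induction m) (auto simp: 1 ac_simps)
qed

lemma cross_blocks_braid:
  assumes "k + m + p + q \<le> n"
  shows "braid_eq n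
    (cross_blocks k m p @ cross_blocks (k + p) m q @ cross_blocks k p q)
    (cross_blocks (k + m) p q @ cross_blocks k m q @ cross_blocks (k + q) m p)"
proof -
  have pos: "snd ` set (cross_blocks 0 p q) \<subseteq> {True}"
    by (induction p) (auto simp: cross_one_def)
  have w: "cross_blocks 0 p q \<in> braid_words (p + q)"
    by (intro cross_blocks_words) simp
  have r: "braid_eq n (cross_blocks k p q) (cross_blocks k p q)"
    "braid_eq n (cross_blocks (k + m) p q) (cross_blocks (k + m) p q)"
    using assms by (auto intro!: braid_eq.refl cross_blocks_words)
  have 1: "braid_eq n (cross_blocks k m (p + q)) (cross_blocks k m p @ cross_blocks (k + p) m q)"
    using assms by (rule cross_blocks_add)
  have 2: "braid_eq n (cross_blocks (k + m) p q @ cross_blocks k m (p + q))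
      (cross_blocks k m (p + q) @ cross_blocks k p q)"
    using cross_blocks_slide[OF w pos, of k m n] assms
    by (simp add: braid_shift_cross_blocks add.assoc)
  have 3: "braid_eq n (cross_blocks k m (p + q)) (cross_blocks k m q @ cross_blocks (k + q) m p)"
    using cross_blocks_add[of k m q p n] assms by (simp add: add.commute[of q p])
  have "braid_eq n ((cross_blocks k m p @ cross_blocks (k + p) m q) @ cross_blocks k p q)
      (cross_blocks k m (p + q) @ cross_blocks k p q)"
    by (rule braid_eq.append[OF braid_eq.sym[OF 1] r(1)])
  also have "braid_eq n (cross_blocks k m (p + q) @ cross_blocks k p q)
      (cross_blocks (k + m) p q @ cross_blocks k m (p + q))"
    by (rule braid_eq.sym[OF 2])
  also have "braid_eq n (cross_blocks (k + m) p q @ cross_blocks k m (p + q))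
      (cross_blocks (k + m) p q @ cross_blocks k m q @ cross_blocks (k + q) m p)"
    by (rule braid_eq.append[OF r(2) 3])
  finally show ?thesis by simp
qed

lemma block_word_append:
  assumes "u \<in> braid_words (length ks)"
  shows "block_word ks (u @ v) = block_word ks u @ block_word (permute_list (word_perm u) ks) v"
  using assms
proof (induction u arbitrary: ks)
  case (Cons l u)
  let ?s = "transpose (fst l) (Suc (fst l))"
  have p: "word_perm u permutes {..<length ks}"
    using Cons.prems by (auto intro: word_perm_permutes)
  show ?case
    using Cons.prems Cons.IH[of "permute_list ?s ks"]
    unfolding word_perm_simps permute_list_compose[OF p] by simp
qed simp

lemma sum_list_permute_list:
  "f permutes {..<length ks} \<Longrightarrow> sum_list (permute_list f ks) = sum_list (ks :: nat list)"
  by (metis mset_permute_list sum_mset_sum_list)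

lemma sum_list_split:
  "Suc i < length ks \<Longrightarrow> sum_list (take i ks) + ks ! i + ks ! Suc i \<le> sum_list (ks :: nat list)"
  "Suc (Suc i) < length ks \<Longrightarrow>
    sum_list (take i ks) + ks ! i + ks ! Suc i + ks ! Suc (Suc i) \<le> sum_list (ks :: nat list)"
proof -
  have *: "take i ks @ drop i ks = ks" for i by simp
  show "sum_list (take i ks) + ks ! i + ks ! Suc i \<le> sum_list ks" if "Suc i < length ks"
    using arg_cong[OF *[of i], of sum_list] that by (simp add: Cons_nth_drop_Suc[symmetric])
  show "sum_list (take i ks) + ks ! i + ks ! Suc i + ks ! Suc (Suc i) \<le> sum_list ks"
    if "Suc (Suc i) < length ks"
    using arg_cong[OF *[of i], of sum_list] that by (simp add: Cons_nth_drop_Suc[symmetric])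
qed

lemma block_letter_words:
  assumes "Suc (fst l) < length ks"
  shows "block_letter ks l \<in> braid_words (sum_list ks)"
  using sum_list_split(1)[OF assms]
  by (cases l) (auto simp: block_letter_def Let_def intro!: cross_blocks_words)

lemma block_word_words:
  "w \<in> braid_words (length ks) \<Longrightarrow> block_word ks w \<in> braid_words (sum_list ks)"
proof (induction w arbitrary: ks)
  case (Cons l w)
  let ?s = "transpose (fst l) (Suc (fst l))"
  have "?s permutes {..<length ks}" using Cons.prems by (auto intro: permutes_swap_id)
  then show ?case
    using Cons.prems Cons.IH[of "permute_list ?s ks"] block_letter_words[of l ks]
    by (simp add: sum_list_permute_list)
qed simp

lemma permute_list_transpose_nth:
  assumes "Suc i < length ks" "j < length ks"
  shows "permute_list (transpose i (Suc i)) ks ! j =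
    (if j = i then ks ! Suc i else if j = Suc i then ks ! i else ks ! j)"
  using assms by (auto simp: permute_list_def transpose_def)

lemma take_permute_list_transpose:
  assumes "Suc i < length ks" "j \<le> i"
  shows "take j (permute_list (transpose i (Suc i)) ks) = take j ks"
  using assms by (intro nth_equalityI) (auto simp: permute_list_transpose_nth)

lemma sum_take_permute_list_transpose:
  assumes "Suc i < length ks" "Suc i < j"
  shows "sum_list (take j (permute_list (transpose i (Suc i)) ks)) = sum_list (take j (ks :: nat list))"
proof (cases "j \<le> length ks")
  case True
  then have "take j (permute_list (transpose i (Suc i)) ks) = permute_list (transpose i (Suc i)) (take j ks)"
    using assms by (intro nth_equalityI) (auto simp: permute_list_transpose_nth)
  moreover have "transpose i (Suc i) permutes {..<length (take j ks)}"
    using assms by (auto intro: permutes_swap_id)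
  ultimately show ?thesis by (simp add: sum_list_permute_list)
next
  case False
  moreover have "transpose i (Suc i) permutes {..<length ks}"
    using assms by (auto intro: permutes_swap_id)
  ultimately show ?thesis by (simp add: sum_list_permute_list)
qed

lemma sum_take_Suc: "i < length ks \<Longrightarrow> sum_list (take (Suc i) ks) = sum_list (take i ks) + (ks ! i :: nat)"
  by (simp add: take_Suc_conv_app_nth)

lemma block_word_cong:
  assumes "braid_eq n u v" "length ks = n"
  shows "braid_eq (sum_list ks) (block_word ks u) (block_word ks v)"
  using assms
proof (induction arbitrary: ks rule: braid_eq.induct)
  case (refl w)
  then show ?case by (auto intro: braid_eq.refl block_word_words)
next
  case (append u u' v v')
  have w: "u \<in> braid_words (length ks)" "u' \<in> braid_words (length ks)"
    using append braid_eq_words by auto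
  have p: "word_perm u permutes {..<length ks}" using w by (intro word_perm_permutes)
  have "braid_eq (sum_list ks) (block_word (permute_list (word_perm u) ks) v)
      (block_word (permute_list (word_perm u) ks) v')"
    using append.IH(2)[of "permute_list (word_perm u) ks"] append.prems p
    by (simp add: sum_list_permute_list)
  then show ?case
    using append.IH(1)[of ks] append.prems w word_perm_cong[OF append.hyps(1)]
    by (simp add: block_word_append braid_eq.append)
next
  case (cancel i e)
  let ?k = "sum_list (take i ks)"
  have "?k + ks ! i + ks ! Suc i \<le> sum_list ks"
    using cancel sum_list_split(1) by simp
  then have w: "cross_blocks ?k (ks ! i) (ks ! Suc i) \<in> braid_words (sum_list ks)"
    "cross_blocks ?k (ks ! Suc i) (ks ! i) \<in> braid_words (sum_list ks)"
    by (auto intro!: cross_blocks_words)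
  show ?case
    using cancel inverse_word_cancel inverse_word_cancel' w
    by (cases e) (auto simp: block_letter_def Let_def permute_list_transpose_nth take_permute_list_transpose)
next
  case (far i k)
  let ?a = "cross_blocks (sum_list (take i ks)) (ks ! i) (ks ! Suc i)"
    and ?b = "cross_blocks (sum_list (take k ks)) (ks ! k) (ks ! Suc k)"
  have 1: "sum_list (take i ks) + ks ! i + ks ! Suc i \<le> sum_list (take k ks)"
    using sum_list_split(1)[of i "take k ks"] far by simp
  have 2: "sum_list (take k ks) + ks ! k + ks ! Suc k \<le> sum_list ks"
    using sum_list_split(1)[of k ks] far by simp
  have "far_apart ?a ?b"
    using 1 by (auto simp: far_apart_def dest!: cross_blocks_set)
  then have "braid_eq (sum_list ks) (?a @ ?b) (?b @ ?a)"
    using 1 2 by (intro far_commutes cross_blocks_words) auto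
  then show ?case
    using far
    by (simp add: block_letter_def Let_def permute_list_transpose_nth take_permute_list_transpose
        sum_take_permute_list_transpose)
next
  case (braid i)
  let ?k = "sum_list (take i ks)"
  have "?k + ks ! i + ks ! Suc i + ks ! Suc (Suc i) \<le> sum_list ks"
    using sum_list_split(2)[of i ks] braid by simp
  from cross_blocks_braid[OF this] show ?case
    using braid
    by (simp add: block_letter_def Let_def permute_list_transpose_nth take_permute_list_transpose
        sum_take_Suc)
next
  case (sym u v)
  show ?case by (rule braid_eq.sym, rule sym.IH, rule sym.prems)
next
  case (trans u v w)
  show ?case by (rule braid_eq.trans[OF trans.IH(1)[OF trans.prems] trans.IH(2)[OF trans.prems]])
qed

lemma braid_block_class:
  "w \<in> braid_words (length ks) \<Longrightarrow>
    braid_block ks (braid_class (length ks) w) = braid_class (sum_list ks) (block_word ks w)"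
  unfolding braid_block_def
  using braid_eq.sym[OF braid_rep_class]
  by (intro braid_class_eqI block_word_cong[where n = "length ks"]) auto

section \<open>Skew multicategories\<close>

datatype tightness = Tight | Loose

text \<open>
  The multimaps of a family \<open>H\<close> of sets indexed by type, source and target are the elements of
  these sets tagged with their indices; so the members of the family need not be disjoint.
\<close>

datatype ('o, 'm) mmap = MMap (kind: tightness) (ins: "'o list") (out: 'o) (elt: 'm)

type_synonym ('o, 'm) hom_family = "tightness \<Rightarrow> 'o list \<Rightarrow> 'o \<Rightarrow> 'm set"

definition mmaps :: "('o, 'm) hom_family \<Rightarrow> tightness \<Rightarrow> 'o list \<Rightarrow> 'o \<Rightarrow> ('o, 'm) mmap set" where
  "mmaps H k as b = MMap k as b ` H k as b"

definition all_mmaps :: "('o, 'm) hom_family \<Rightarrow> ('o, 'm) mmap set" where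
  "all_mmaps H = (\<Union>k as b. mmaps H k as b)"

abbreviation arity :: "('o, 'm) mmap \<Rightarrow> nat" where
  "arity f \<equiv> length (ins f)"

definition shape :: "('o, 'm) mmap \<Rightarrow> tightness \<times> nat" where
  "shape f = (kind f, arity f)"

definition composable :: "nat \<Rightarrow> ('o, 'm) mmap \<Rightarrow> ('o, 'm) mmap \<Rightarrow> bool" where
  "composable i g f \<longleftrightarrow> i < arity g \<and> out f = ins g ! i"

text \<open>Positions are numbered from 0, so \<open>subst C i g f\<close> is the substitution of \<open>f\<close> into the
  input \<open>i + 1\<close> of \<open>g\<close> in the usual numbering.\<close>

definition subst_kind :: "tightness \<Rightarrow> nat \<Rightarrow> tightness \<Rightarrow> tightness" where
  "subst_kind x i y =
    (if x = Tight \<and> y = Tight \<and> i = 0 \<or> x = Tight \<and> i \<noteq> 0 then Tight else Loose)"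

definition splice_at :: "nat \<Rightarrow> 'a list \<Rightarrow> 'a list \<Rightarrow> 'a list" where
  "splice_at i xs ys = take i xs @ ys @ drop (Suc i) xs"

record ('o, 'm) skew_multicat =
  objs :: "'o set"
  homs :: "('o, 'm) hom_family"
  loosen :: "('o, 'm) mmap \<Rightarrow> ('o, 'm) mmap"
  ident :: "'o \<Rightarrow> ('o, 'm) mmap"
  subst :: "nat \<Rightarrow> ('o, 'm) mmap \<Rightarrow> ('o, 'm) mmap \<Rightarrow> ('o, 'm) mmap"

definition loosen_to :: "('o, 'm) skew_multicat \<Rightarrow> tightness \<Rightarrow> ('o, 'm) mmap \<Rightarrow> ('o, 'm) mmap" where
  "loosen_to C k f = (if kind f = Tight \<and> k = Loose then loosen C f else f)"

locale skew_multicategory =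
  fixes C :: "('o, 'm) skew_multicat"
  assumes homs_objs: "f \<in> all_mmaps (homs C) \<Longrightarrow> set (ins f) \<subseteq> objs C \<and> out f \<in> objs C"
    and tight_nonnullary: "homs C Tight [] b = {}"
    and loosen_mmap: "f \<in> mmaps (homs C) Tight as b \<Longrightarrow> loosen C f \<in> mmaps (homs C) Loose as b"
    and ident_mmap: "a \<in> objs C \<Longrightarrow> ident C a \<in> mmaps (homs C) Tight [a] a"
    and subst_mmap: "\<lbrakk>g \<in> all_mmaps (homs C); f \<in> all_mmaps (homs C); composable i g f\<rbrakk> \<Longrightarrow>
      subst C i g f \<in>
        mmaps (homs C) (subst_kind (kind g) i (kind f)) (splice_at i (ins g) (ins f)) (out g)"
    and subst_assoc: "\<lbrakk>h \<in> all_mmaps (homs C); g \<in> all_mmaps (homs C); f \<in> all_mmaps (homs C);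
        composable i h g; composable k g f\<rbrakk> \<Longrightarrow>
      subst C (i + k) (subst C i h g) f = subst C i h (subst C k g f)"
    and subst_commute: "\<lbrakk>h \<in> all_mmaps (homs C); g \<in> all_mmaps (homs C); f \<in> all_mmaps (homs C);
        composable i h g; composable k h f; i < k\<rbrakk> \<Longrightarrow>
      subst C (k + arity g - 1) (subst C i h g) f = subst C i (subst C k h f) g"
    and subst_ident: "\<lbrakk>g \<in> all_mmaps (homs C); i < arity g\<rbrakk> \<Longrightarrow>
      subst C i g (ident C (ins g ! i)) = g"
    and ident_subst: "f \<in> all_mmaps (homs C) \<Longrightarrow> subst C 0 (ident C (out f)) f = f"
    and loosen_subst: "\<lbrakk>g \<in> all_mmaps (homs C); f \<in> all_mmaps (homs C); composable i g f;
        kind g = Tight\<rbrakk> \<Longrightarrow>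
      subst C i (loosen C g) f = loosen_to C (subst_kind Loose i (kind f)) (subst C i g f)"
    and subst_loosen: "\<lbrakk>g \<in> all_mmaps (homs C); f \<in> all_mmaps (homs C); composable i g f;
        kind f = Tight\<rbrakk> \<Longrightarrow>
      subst C i g (loosen C f) = loosen_to C (subst_kind (kind g) i Loose) (subst C i g f)"

text \<open>
  \<open>subst_from C k g fs\<close> substitutes the members of \<open>fs\<close> into consecutive inputs of \<open>g\<close> beginning
  with input \<open>k\<close>.  The rightmost one is substituted first, so that the numbering of the other
  inputs involved does not change.
\<close>

primrec subst_from ::
  "('o, 'm) skew_multicat \<Rightarrow> nat \<Rightarrow> ('o, 'm) mmap \<Rightarrow> ('o, 'm) mmap list \<Rightarrow> ('o, 'm) mmap" where
  "subst_from C k g [] = g"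
| "subst_from C k g (f # fs) = subst C k (subst_from C (Suc k) g fs) f"

definition multisubst :: "('o, 'm) skew_multicat \<Rightarrow> ('o, 'm) mmap \<Rightarrow> ('o, 'm) mmap list \<Rightarrow> ('o, 'm) mmap"
  where "multisubst C g fs = subst_from C 0 g fs"

definition left_representable :: "('o, 'm) skew_multicat \<Rightarrow> bool" where
  "left_representable C \<longleftrightarrow>
    (\<forall>k as. set as \<subseteq> objs C \<and> (k = Tight \<longrightarrow> as \<noteq> []) \<longrightarrow>
      (\<exists>m\<in>objs C. \<exists>\<theta>\<in>mmaps (homs C) k as m.
        \<forall>ys b. set ys \<subseteq> objs C \<and> b \<in> objs C \<longrightarrow>
          bij_betw (\<lambda>g. subst C 0 g \<theta>)
            (mmaps (homs C) Tight (m # ys) b) (mmaps (homs C) k (as @ ys) b)))"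

section \<open>Braidings on skew multicategories\<close>

definition acting_braids :: "tightness \<Rightarrow> nat \<Rightarrow> braid_word set set" where
  "acting_braids k n = (case k of Tight \<Rightarrow> braids_fixing_first n | Loose \<Rightarrow> carrier (braid_group n))"

text \<open>
  A braiding is an action of braids on multimaps, \<open>act r f\<close> being what is usually written
  \<open>r\<^sup>* f\<close>.  It is undefined outside its proper domain, so that braidings are equal if and
  only if all their actions are.
\<close>

locale braiding = skew_multicategory C
  for C :: "('o, 'm) skew_multicat" +
  fixes act :: "braid_word set \<Rightarrow> ('o, 'm) mmap \<Rightarrow> ('o, 'm) mmap"
  assumes act_undefined:
      "f \<notin> all_mmaps (homs C) \<or> r \<notin> acting_braids (kind f) (arity f) \<Longrightarrow> act r f = undefined"
    and act_mmap: "\<lbrakk>f \<in> all_mmaps (homs C); r \<in> acting_braids (kind f) (arity f)\<rbrakk> \<Longrightarrow>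
      act r f \<in> mmaps (homs C) (kind f) (permute_list (braid_perm r) (ins f)) (out f)"
    and act_one: "f \<in> all_mmaps (homs C) \<Longrightarrow> act \<one>\<^bsub>braid_group (arity f)\<^esub> f = f"
    and act_mult: "\<lbrakk>f \<in> all_mmaps (homs C); r \<in> acting_braids (kind f) (arity f);
        s \<in> acting_braids (kind f) (arity f)\<rbrakk> \<Longrightarrow>
      act (r \<otimes>\<^bsub>braid_group (arity f)\<^esub> s) f = act s (act r f)"
    and act_loosen: "\<lbrakk>f \<in> all_mmaps (homs C); kind f = Tight;
        r \<in> acting_braids Tight (arity f)\<rbrakk> \<Longrightarrow>
      act r (loosen C f) = loosen C (act r f)"
    and multisubst_act: "\<lbrakk>g \<in> all_mmaps (homs C); set fs \<subseteq> all_mmaps (homs C); map out fs = ins g;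
        list_all2 (\<lambda>s f. s \<in> acting_braids (kind f) (arity f)) ss fs\<rbrakk> \<Longrightarrow>
      multisubst C g (map2 act ss fs) = act (braid_juxtapose (map arity fs) ss) (multisubst C g fs)"
    and act_multisubst: "\<lbrakk>g \<in> all_mmaps (homs C); set fs \<subseteq> all_mmaps (homs C); map out fs = ins g;
        r \<in> acting_braids (kind g) (arity g)\<rbrakk> \<Longrightarrow>
      multisubst C (act r g) (permute_list (braid_perm r) fs) =
        act (braid_block (map arity fs) r) (multisubst C g fs)"

locale symmetry = braiding C act
  for C :: "('o, 'm) skew_multicat" and act :: "braid_word set \<Rightarrow> ('o, 'm) mmap \<Rightarrow> ('o, 'm) mmap" +
  assumes act_cong: "\<lbrakk>f \<in> all_mmaps (homs C); r \<in> acting_braids (kind f) (arity f);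
      s \<in> acting_braids (kind f) (arity f); braid_perm r = braid_perm s\<rbrakk> \<Longrightarrow>
    act r f = act s f"

section \<open>Short skew multicategories\<close>

text \<open>
  The category \<open>\<C>\<close> is given by the tight unary multimaps with \<open>sident\<close> and \<open>scomp\<close>, and
  \<open>saction S q ps f\<close> is the result of applying the functor of which \<open>f\<close> is an element to the
  morphism \<open>(ps, q)\<close>, i.e. of precomposing with \<open>ps\<close> and postcomposing with \<open>q\<close>.
\<close>

record ('o, 'm) short_skew_multicat =
  sobjs :: "'o set"
  shoms :: "('o, 'm) hom_family"
  sident :: "'o \<Rightarrow> ('o, 'm) mmap"
  scomp :: "('o, 'm) mmap \<Rightarrow> ('o, 'm) mmap \<Rightarrow> ('o, 'm) mmap"
  saction :: "('o, 'm) mmap \<Rightarrow> ('o, 'm) mmap list \<Rightarrow> ('o, 'm) mmap \<Rightarrow> ('o, 'm) mmap"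
  sloosen :: "('o, 'm) mmap \<Rightarrow> ('o, 'm) mmap"
  ssubst :: "nat \<Rightarrow> ('o, 'm) mmap \<Rightarrow> ('o, 'm) mmap \<Rightarrow> ('o, 'm) mmap"

definition short_shapes :: "(tightness \<times> nat) set" where
  "short_shapes = {Tight} \<times> {1, 2, 3, 4} \<union> {Loose} \<times> {0, 1, 2}"

definition short_substitutable :: "('o, 'm) mmap \<Rightarrow> ('o, 'm) mmap \<Rightarrow> bool" where
  "short_substitutable g f \<longleftrightarrow> (shape f, shape g) \<in>
    {((Tight, 2), (Tight, 2)), ((Tight, 2), (Tight, 3)), ((Tight, 3), (Tight, 2)),
     ((Loose, 0), (Tight, 2)), ((Loose, 0), (Tight, 3)), ((Loose, 0), (Loose, 1)),
     ((Loose, 1), (Tight, 2)), ((Tight, 2), (Loose, 1))}"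

definition unary_morphisms :: "('o, 'm) hom_family \<Rightarrow> ('o, 'm) mmap set" where
  "unary_morphisms H = {p \<in> all_mmaps H. shape p = (Tight, 1)}"

definition acts_on ::
  "('o, 'm) hom_family \<Rightarrow> ('o, 'm) mmap \<Rightarrow> ('o, 'm) mmap list \<Rightarrow> ('o, 'm) mmap \<Rightarrow> bool" where
  "acts_on H q ps f \<longleftrightarrow> q \<in> unary_morphisms H \<and> ins q = [out f] \<and>
    set ps \<subseteq> unary_morphisms H \<and> map out ps = ins f"

text \<open>Substitution extended to the case where one of the multimaps is tight unary: it is then
  given by functoriality.\<close>

definition short_subst ::
  "('o, 'm) short_skew_multicat \<Rightarrow> nat \<Rightarrow> ('o, 'm) mmap \<Rightarrow> ('o, 'm) mmap \<Rightarrow> ('o, 'm) mmap" where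
  "short_subst S i g f =
    (if shape f = (Tight, 1) then saction S (sident S (out g)) ((map (sident S) (ins g))[i := f]) g
     else if shape g = (Tight, 1) then saction S g (map (sident S) (ins f)) f
     else ssubst S i g f)"

locale short_skew_multicategory =
  fixes S :: "('o, 'm) short_skew_multicat"
  assumes shoms_objs: "f \<in> all_mmaps (shoms S) \<Longrightarrow> set (ins f) \<subseteq> sobjs S \<and> out f \<in> sobjs S"
    and shoms_shape: "f \<in> all_mmaps (shoms S) \<Longrightarrow> shape f \<in> short_shapes"
    and sident_mmap: "a \<in> sobjs S \<Longrightarrow> sident S a \<in> mmaps (shoms S) Tight [a] a"
    and scomp_mmap: "\<lbrakk>q \<in> mmaps (shoms S) Tight [b] c; p \<in> mmaps (shoms S) Tight [a] b\<rbrakk> \<Longrightarrow>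
      scomp S q p \<in> mmaps (shoms S) Tight [a] c"
    and scomp_assoc: "\<lbrakk>r \<in> mmaps (shoms S) Tight [c] d; q \<in> mmaps (shoms S) Tight [b] c;
        p \<in> mmaps (shoms S) Tight [a] b\<rbrakk> \<Longrightarrow>
      scomp S (scomp S r q) p = scomp S r (scomp S q p)"
    and scomp_sident: "p \<in> mmaps (shoms S) Tight [a] b \<Longrightarrow> scomp S p (sident S a) = p"
    and sident_scomp: "p \<in> mmaps (shoms S) Tight [a] b \<Longrightarrow> scomp S (sident S b) p = p"
    and saction_mmap: "\<lbrakk>f \<in> all_mmaps (shoms S); acts_on (shoms S) q ps f\<rbrakk> \<Longrightarrow>
      saction S q ps f \<in> mmaps (shoms S) (kind f) (concat (map ins ps)) (out q)"
    and saction_sident: "f \<in> all_mmaps (shoms S) \<Longrightarrow>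
      saction S (sident S (out f)) (map (sident S) (ins f)) f = f"
    and saction_scomp: "\<lbrakk>f \<in> all_mmaps (shoms S); acts_on (shoms S) q ps f;
        acts_on (shoms S) q' ps' (saction S q ps f)\<rbrakk> \<Longrightarrow>
      saction S (scomp S q' q) (map2 (scomp S) ps ps') f = saction S q' ps' (saction S q ps f)"
    and saction_unary: "\<lbrakk>f \<in> unary_morphisms (shoms S); acts_on (shoms S) q [p] f\<rbrakk> \<Longrightarrow>
      saction S q [p] f = scomp S (scomp S q f) p"
    and sloosen_mmap: "\<lbrakk>f \<in> all_mmaps (shoms S); shape f \<in> {(Tight, 1), (Tight, 2)}\<rbrakk> \<Longrightarrow>
      sloosen S f \<in> mmaps (shoms S) Loose (ins f) (out f)"
    and sloosen_natural: "\<lbrakk>f \<in> all_mmaps (shoms S); shape f \<in> {(Tight, 1), (Tight, 2)};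
        acts_on (shoms S) q ps f\<rbrakk> \<Longrightarrow>
      sloosen S (saction S q ps f) = saction S q ps (sloosen S f)"
    and ssubst_mmap: "\<lbrakk>g \<in> all_mmaps (shoms S); f \<in> all_mmaps (shoms S);
        short_substitutable g f; composable i g f\<rbrakk> \<Longrightarrow>
      ssubst S i g f \<in>
        mmaps (shoms S) (subst_kind (kind g) i (kind f)) (splice_at i (ins g) (ins f)) (out g)"
    and ssubst_natural: "\<lbrakk>g \<in> all_mmaps (shoms S); f \<in> all_mmaps (shoms S);
        short_substitutable g f; composable i g f;
        acts_on (shoms S) q ps g; acts_on (shoms S) (sident S (out f)) rs f\<rbrakk> \<Longrightarrow>
      saction S q (splice_at i ps rs) (ssubst S i g f) =
        ssubst S i (saction S q (ps[i := sident S (ins g ! i)]) g)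
          (saction S (sident S (out f)) rs f)"
    and ssubst_dinatural: "\<lbrakk>g \<in> all_mmaps (shoms S); f \<in> all_mmaps (shoms S);
        short_substitutable g f; p \<in> unary_morphisms (shoms S); ins p = [out f];
        composable i g p\<rbrakk> \<Longrightarrow>
      ssubst S i (saction S (sident S (out g)) ((map (sident S) (ins g))[i := p]) g) f =
        ssubst S i g (saction S p (map (sident S) (ins f)) f)"
    and short_subst_assoc: "\<lbrakk>f \<in> all_mmaps (shoms S); g \<in> all_mmaps (shoms S);
        h \<in> all_mmaps (shoms S); shape f = (Tight, 2); shape g = (Tight, 2);
        shape h \<in> {(Tight, 2), (Loose, 0)}; composable i f g; composable k g h\<rbrakk> \<Longrightarrow>
      short_subst S i f (short_subst S k g h) = short_subst S (i + k) (short_subst S i f g) h"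
    and short_subst_commute: "\<lbrakk>f \<in> all_mmaps (shoms S); g \<in> all_mmaps (shoms S);
        h \<in> all_mmaps (shoms S); shape f = (Tight, 2); shape g \<in> {(Tight, 2), (Loose, 0)};
        shape h \<in> {(Tight, 2), (Loose, 0)}; composable 0 f g; composable 1 f h\<rbrakk> \<Longrightarrow>
      short_subst S (arity g) (short_subst S 0 f g) h = short_subst S 0 (short_subst S 1 f h) g"
    and short_subst_sloosen_1: "\<lbrakk>g \<in> all_mmaps (shoms S); shape g = (Tight, 2);
        p \<in> unary_morphisms (shoms S); composable 1 g p\<rbrakk> \<Longrightarrow>
      short_subst S 1 g (sloosen S p) = short_subst S 1 g p"
    and short_subst_sloosen_0: "\<lbrakk>g \<in> all_mmaps (shoms S); shape g = (Tight, 2);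
        p \<in> unary_morphisms (shoms S); composable 0 g p\<rbrakk> \<Longrightarrow>
      short_subst S 0 g (sloosen S p) = sloosen S (short_subst S 0 g p)"
    and unary_short_subst_sloosen: "\<lbrakk>q \<in> unary_morphisms (shoms S);
        p \<in> unary_morphisms (shoms S); composable 0 q p\<rbrakk> \<Longrightarrow>
      short_subst S 0 q (sloosen S p) = sloosen S (short_subst S 0 q p)"
    and sloosen_short_subst_binary: "\<lbrakk>p \<in> unary_morphisms (shoms S); g \<in> all_mmaps (shoms S);
        shape g = (Tight, 2); composable 0 p g\<rbrakk> \<Longrightarrow>
      short_subst S 0 (sloosen S p) g = sloosen S (short_subst S 0 p g)"
    and sloosen_short_subst_nullary: "\<lbrakk>p \<in> unary_morphisms (shoms S); v \<in> all_mmaps (shoms S);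
        shape v = (Loose, 0); composable 0 p v\<rbrakk> \<Longrightarrow>
      short_subst S 0 (sloosen S p) v = short_subst S 0 p v"

text \<open>The values of \<open>ssubst\<close> and \<open>sloosen\<close> at arguments other than those mentioned in the axioms
  above are irrelevant.\<close>

definition underlying_short :: "('o, 'm) skew_multicat \<Rightarrow> ('o, 'm) short_skew_multicat" where
  "underlying_short C =
    \<lparr>sobjs = objs C,
     shoms = (\<lambda>k as b. if (k, length as) \<in> short_shapes then homs C k as b else {}),
     sident = ident C,
     scomp = subst C 0,
     saction = (\<lambda>q ps f. subst C 0 q (multisubst C f ps)),
     sloosen = loosen C,
     ssubst = subst C\<rparr>"

section \<open>Short braidings\<close>

definition tight_mmaps :: "('o, 'm) hom_family \<Rightarrow> nat \<Rightarrow> ('o, 'm) mmap set" where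
  "tight_mmaps H n = {f \<in> all_mmaps H. shape f = (Tight, n)}"

locale short_braiding = short_skew_multicategory S
  for S :: "('o, 'm) short_skew_multicat" +
  fixes \<beta>32 \<beta>42 \<beta>43 :: "('o, 'm) mmap \<Rightarrow> ('o, 'm) mmap"
  assumes \<beta>_extensional: "\<beta>32 \<in> extensional (tight_mmaps (shoms S) 3)"
      "\<beta>42 \<in> extensional (tight_mmaps (shoms S) 4)"
      "\<beta>43 \<in> extensional (tight_mmaps (shoms S) 4)"
    and \<beta>32_bij: "bij_betw \<beta>32 (mmaps (shoms S) Tight [a, b, c] y) (mmaps (shoms S) Tight [a, c, b] y)"
    and \<beta>42_bij: "bij_betw \<beta>42
      (mmaps (shoms S) Tight [a, b, c, d] y) (mmaps (shoms S) Tight [a, c, b, d] y)"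
    and \<beta>43_bij: "bij_betw \<beta>43
      (mmaps (shoms S) Tight [a, b, c, d] y) (mmaps (shoms S) Tight [a, b, d, c] y)"
    and \<beta>32_natural: "\<lbrakk>f \<in> tight_mmaps (shoms S) 3; acts_on (shoms S) q [p1, p2, p3] f\<rbrakk> \<Longrightarrow>
      \<beta>32 (saction S q [p1, p2, p3] f) = saction S q [p1, p3, p2] (\<beta>32 f)"
    and \<beta>42_natural: "\<lbrakk>f \<in> tight_mmaps (shoms S) 4; acts_on (shoms S) q [p1, p2, p3, p4] f\<rbrakk> \<Longrightarrow>
      \<beta>42 (saction S q [p1, p2, p3, p4] f) = saction S q [p1, p3, p2, p4] (\<beta>42 f)"
    and \<beta>43_natural: "\<lbrakk>f \<in> tight_mmaps (shoms S) 4; acts_on (shoms S) q [p1, p2, p3, p4] f\<rbrakk> \<Longrightarrow>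
      \<beta>43 (saction S q [p1, p2, p3, p4] f) = saction S q [p1, p2, p4, p3] (\<beta>43 f)"
    and \<beta>4_braid: "h \<in> tight_mmaps (shoms S) 4 \<Longrightarrow> \<beta>42 (\<beta>43 (\<beta>42 h)) = \<beta>43 (\<beta>42 (\<beta>43 h))"
    and ssubst_0_\<beta>32: "\<lbrakk>g \<in> tight_mmaps (shoms S) 2; f \<in> tight_mmaps (shoms S) 3;
        composable 0 g f\<rbrakk> \<Longrightarrow> ssubst S 0 g (\<beta>32 f) = \<beta>42 (ssubst S 0 g f)"
    and ssubst_1_\<beta>32: "\<lbrakk>g \<in> tight_mmaps (shoms S) 2; f \<in> tight_mmaps (shoms S) 3;
        composable 1 g f\<rbrakk> \<Longrightarrow> ssubst S 1 g (\<beta>32 f) = \<beta>43 (ssubst S 1 g f)"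
    and \<beta>43_ssubst_0: "\<lbrakk>g \<in> tight_mmaps (shoms S) 3; f \<in> tight_mmaps (shoms S) 2;
        composable 0 g f\<rbrakk> \<Longrightarrow> \<beta>43 (ssubst S 0 g f) = ssubst S 0 (\<beta>32 g) f"
    and \<beta>42_\<beta>43_ssubst_1: "\<lbrakk>g \<in> tight_mmaps (shoms S) 3; f \<in> tight_mmaps (shoms S) 2;
        composable 1 g f\<rbrakk> \<Longrightarrow> \<beta>42 (\<beta>43 (ssubst S 1 g f)) = ssubst S 2 (\<beta>32 g) f"
    and \<beta>43_\<beta>42_ssubst_2: "\<lbrakk>g \<in> tight_mmaps (shoms S) 3; f \<in> tight_mmaps (shoms S) 2;
        composable 2 g f\<rbrakk> \<Longrightarrow> \<beta>43 (\<beta>42 (ssubst S 2 g f)) = ssubst S 1 (\<beta>32 g) f"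

locale short_symmetry = short_braiding S \<beta>32 \<beta>42 \<beta>43
  for S :: "('o, 'm) short_skew_multicat" and \<beta>32 \<beta>42 \<beta>43 :: "('o, 'm) mmap \<Rightarrow> ('o, 'm) mmap" +
  assumes \<beta>32_involutive: "f \<in> tight_mmaps (shoms S) 3 \<Longrightarrow> \<beta>32 (\<beta>32 f) = f"

definition underlying_short_braiding ::
  "('o, 'm) skew_multicat \<Rightarrow> (braid_word set \<Rightarrow> ('o, 'm) mmap \<Rightarrow> ('o, 'm) mmap) \<Rightarrow>
    (('o, 'm) mmap \<Rightarrow> ('o, 'm) mmap) \<times> (('o, 'm) mmap \<Rightarrow> ('o, 'm) mmap) \<times>
    (('o, 'm) mmap \<Rightarrow> ('o, 'm) mmap)" where
  "underlying_short_braiding C act =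
    (restrict (act (braid_gen 3 1)) (tight_mmaps (homs C) 3),
     restrict (act (braid_gen 4 1)) (tight_mmaps (homs C) 4),
     restrict (act (braid_gen 4 2)) (tight_mmaps (homs C) 4))"

section \<open>The underlying short skew multicategory is one\<close>

lemma mmaps_iff: "f \<in> mmaps H k as b \<longleftrightarrow> f \<in> all_mmaps H \<and> kind f = k \<and> ins f = as \<and> out f = b"
  by (cases f) (auto simp: mmaps_def all_mmaps_def)

context skew_multicategory
begin

abbreviation "arrows \<equiv> all_mmaps (homs C)"
abbreviation "unaries \<equiv> unary_morphisms (homs C)"

lemma unaries_iff: "p \<in> unaries \<longleftrightarrow> p \<in> arrows \<and> kind p = Tight \<and> arity p = 1"
  by (auto simp: unary_morphisms_def shape_def)

lemma subst_simps:
  assumes "g \<in> arrows" "f \<in> arrows" "composable i g f"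
  shows "subst C i g f \<in> arrows" "kind (subst C i g f) = subst_kind (kind g) i (kind f)"
    "ins (subst C i g f) = splice_at i (ins g) (ins f)" "out (subst C i g f) = out g"
  using subst_mmap[OF assms] by (auto simp: mmaps_iff)

lemma subst_unary:
  assumes "g \<in> arrows" "p \<in> unaries" "composable k g p"
  shows "subst C k g p \<in> arrows" "kind (subst C k g p) = kind g" "out (subst C k g p) = out g"
    "arity (subst C k g p) = arity g"
    "\<And>j. j < arity g \<Longrightarrow> j \<noteq> k \<Longrightarrow> ins (subst C k g p) ! j = ins g ! j"
proof -
  have p: "p \<in> arrows" "kind p = Tight" "arity p = 1" using assms(2) by (auto simp: unaries_iff)
  note s = subst_simps[OF assms(1) p(1) assms(3)]
  have k: "k < arity g" using assms(3) by (simp add: composable_def)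
  show "subst C k g p \<in> arrows" "out (subst C k g p) = out g" by (simp_all add: s)
  show "kind (subst C k g p) = kind g"
    by (cases "kind g") (auto simp: s p subst_kind_def)
  show "arity (subst C k g p) = arity g" using k p by (auto simp: s splice_at_def)
  show "ins (subst C k g p) ! j = ins g ! j" if "j < arity g" "j \<noteq> k" for j
    using that k p by (auto simp: s splice_at_def nth_append)
qed

lemma ident_simps:
  assumes "a \<in> objs C"
  shows "ident C a \<in> unaries" "ident C a \<in> arrows" "ins (ident C a) = [a]" "out (ident C a) = a"
  using ident_mmap[OF assms] by (auto simp: mmaps_iff unaries_iff)

lemma ins_objs: "f \<in> arrows \<Longrightarrow> i < arity f \<Longrightarrow> ins f ! i \<in> objs C"
  using homs_objs nth_mem by blast

lemma out_objs: "f \<in> arrows \<Longrightarrow> out f \<in> objs C"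
  using homs_objs by blast

definition fits :: "nat \<Rightarrow> ('o, 'm) mmap \<Rightarrow> ('o, 'm) mmap list \<Rightarrow> bool" where
  "fits k g ps \<longleftrightarrow> set ps \<subseteq> unaries \<and> k + length ps \<le> arity g \<and>
    (\<forall>j<length ps. out (ps ! j) = ins g ! (k + j))"

lemma fits_Cons: "fits k g (p # ps) \<longleftrightarrow> p \<in> unaries \<and> composable k g p \<and> fits (Suc k) g ps"
  by (auto simp: fits_def composable_def All_less_Suc2)

lemma subst_from_simps:
  assumes "g \<in> arrows" "fits k g ps"
  shows "subst_from C k g ps \<in> arrows \<and> kind (subst_from C k g ps) = kind g \<and>
    out (subst_from C k g ps) = out g \<and> arity (subst_from C k g ps) = arity g \<and>
    (\<forall>j<arity g. j < k \<or> k + length ps \<le> j \<longrightarrow> ins (subst_from C k g ps) ! j = ins g ! j)"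
  using assms(2)
proof (induction ps arbitrary: k)
  case (Cons p ps)
  let ?h = "subst_from C (Suc k) g ps"
  have f: "fits (Suc k) g ps" "p \<in> unaries" "composable k g p"
    using Cons.prems by (auto simp: fits_Cons)
  note IH = Cons.IH[OF f(1)]
  have c: "composable k ?h p" using f(3) IH by (auto simp: composable_def)
  show ?case using IH subst_unary[OF _ f(2) c] by auto
qed (use assms in auto)

lemma subst_from_composable:
  assumes "g \<in> arrows" "fits k g ps" "i < k \<or> k + length ps \<le> i"
  shows "composable i (subst_from C k g ps) f \<longleftrightarrow> composable i g f"
  using subst_from_simps[OF assms(1,2)] assms(3) by (auto simp: composable_def)

lemma ins_subst_from:
  assumes "g \<in> arrows" "fits k g ps"
  shows "ins (subst_from C k g ps) =
    take k (ins g) @ concat (map ins ps) @ drop (k + length ps) (ins g)"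
  using assms(2)
proof (induction ps arbitrary: k)
  case (Cons p ps)
  let ?h = "subst_from C (Suc k) g ps"
  have f: "fits (Suc k) g ps" "p \<in> unaries" "composable k g p"
    using Cons.prems by (auto simp: fits_Cons)
  note R = subst_from_simps[OF assms(1) f(1)]
  have "composable k ?h p" using f assms by (simp add: subst_from_composable)
  then have "ins (subst C k ?h p) = splice_at k (ins ?h) (ins p)"
    using R f(2) by (intro subst_simps) (auto simp: unaries_iff)
  moreover have "k < arity g" using f(3) by (simp add: composable_def)
  ultimately show ?case
    by (simp add: Cons.IH[OF f(1)] splice_at_def min_def)
qed auto

lemma subst_from_append:
  "subst_from C k g (ps @ qs) = subst_from C k (subst_from C (k + length ps) g qs) ps"
  by (induction ps arbitrary: k) auto

lemma subst_from_subst_after: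
  assumes "g \<in> arrows" "f \<in> arrows" "composable i g f" "fits k g ps" "i < k"
  shows "subst_from C (k + arity f - 1) (subst C i g f) ps = subst C i (subst_from C k g ps) f"
  using assms(4,5)
proof (induction ps arbitrary: k)
  case (Cons p ps)
  let ?h = "subst_from C (Suc k) g ps"
  have f: "fits (Suc k) g ps" "p \<in> unaries" "composable k g p"
    using Cons.prems by (auto simp: fits_Cons)
  have IH: "subst_from C (Suc (k + arity f - 1)) (subst C i g f) ps = subst C i ?h f"
    using Cons.IH[OF f(1)] Cons.prems(2) by (simp add: Suc_diff_le)
  have "subst C (k + arity f - 1) (subst C i ?h f) p = subst C i (subst C k ?h p) f"
    using subst_from_simps[OF assms(1) f(1)] assms f Cons.prems(2)
    by (intro subst_commute) (auto simp: subst_from_composable unaries_iff)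
  then show ?case unfolding subst_from.simps IH .
qed simp

lemma subst_from_subst_within:
  assumes "g \<in> arrows" "f \<in> arrows" "composable i g f" "fits k f ps"
  shows "subst_from C (i + k) (subst C i g f) ps = subst C i g (subst_from C k f ps)"
  using assms(4)
proof (induction ps arbitrary: k)
  case (Cons p ps)
  let ?h = "subst_from C (Suc k) f ps"
  have f: "fits (Suc k) f ps" "p \<in> unaries" "composable k f p"
    using Cons.prems by (auto simp: fits_Cons)
  note R = subst_from_simps[OF assms(2) f(1)]
  have "subst C (i + k) (subst C i g ?h) p = subst C i g (subst C k ?h p)"
    using R assms f by (intro subst_assoc) (auto simp: subst_from_composable unaries_iff composable_def)
  then show ?case using Cons.IH[OF f(1)] by simp
qed simp

lemma subst_from_subst_before:
  assumes "g \<in> arrows" "f \<in> arrows" "composable i g f" "fits k g ps" "k + length ps \<le> i"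
  shows "subst_from C k (subst C i g f) ps = subst C i (subst_from C k g ps) f"
  using assms(4,5)
proof (induction ps arbitrary: k)
  case (Cons p ps)
  let ?h = "subst_from C (Suc k) g ps"
  have f: "fits (Suc k) g ps" "p \<in> unaries" "composable k g p"
    using Cons.prems by (auto simp: fits_Cons)
  have p: "p \<in> arrows" "arity p = 1" using f by (auto simp: unaries_iff)
  have "subst C (i + arity p - 1) (subst C k ?h p) f = subst C k (subst C i ?h f) p"
    using subst_from_simps[OF assms(1) f(1)] assms f p Cons.prems(2)
    by (intro subst_commute) (auto simp: subst_from_composable)
  then show ?case using Cons.IH[OF f(1)] Cons.prems(2) p by simp
qed simp

lemma subst_from_comp:
  assumes "f \<in> arrows" "fits k f ps" "fits k (subst_from C k f ps) ps'" "length ps' = length ps"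
  shows "subst_from C k f (map2 (subst C 0) ps ps') = subst_from C k (subst_from C k f ps) ps'"
  using assms(4,2,3)
proof (induction ps' ps arbitrary: k rule: list_induct2)
  case (Cons p' ps' p ps)
  let ?h = "subst_from C (Suc k) f ps"
  have f: "fits (Suc k) f ps" "p \<in> unaries" "composable k f p"
    using Cons.prems by (auto simp: fits_Cons)
  note R = subst_from_simps[OF assms(1) f(1)]
  have c: "composable k ?h p" using f assms by (simp add: subst_from_composable)
  note u = subst_unary[OF conjunct1[OF R] f(2) c]
  have f': "fits (Suc k) (subst C k ?h p) ps'" "p' \<in> unaries" "composable k (subst C k ?h p) p'"
    using Cons.prems by (auto simp: fits_Cons)
  then have f'': "fits (Suc k) ?h ps'" using u by (auto simp: fits_def)
  have p: "p \<in> arrows" "p' \<in> arrows" "arity p = 1" using f(2) f'(2) by (auto simp: unaries_iff)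
  have k: "k < arity ?h" using c by (simp add: composable_def)
  have "ins (subst C k ?h p) ! k = ins p ! 0"
    using subst_simps[OF conjunct1[OF R] p(1) c] k p by (simp add: splice_at_def nth_append)
  then have c': "composable 0 p p'" using f'(3) p by (simp add: composable_def)
  note R2 = subst_from_simps[OF conjunct1[OF R] f'']
  have "subst_from C (Suc k + arity p - 1) (subst C k ?h p) ps' = subst C k (subst_from C (Suc k) ?h ps') p"
    using R p c f'' by (intro subst_from_subst_after) auto
  moreover have "subst C (k + 0) (subst C k (subst_from C (Suc k) ?h ps') p) p' =
      subst C k (subst_from C (Suc k) ?h ps') (subst C 0 p p')"
    using R R2 p c c' f'' by (intro subst_assoc) (auto simp: subst_from_composable)
  ultimately show ?case using Cons.IH[OF f(1) f''] p by simp
qed simp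

lemma subst_from_loosen:
  assumes "f \<in> arrows" "kind f = Tight" "fits k f ps"
  shows "subst_from C k (loosen C f) ps = loosen C (subst_from C k f ps)"
  using assms(3)
proof (induction ps arbitrary: k)
  case (Cons p ps)
  let ?h = "subst_from C (Suc k) f ps"
  have f: "fits (Suc k) f ps" "p \<in> unaries" "composable k f p"
    using Cons.prems by (auto simp: fits_Cons)
  note R = subst_from_simps[OF assms(1) f(1)]
  have c: "composable k ?h p" using f assms by (simp add: subst_from_composable)
  have "subst C k (loosen C ?h) p = loosen_to C (subst_kind Loose k (kind p)) (subst C k ?h p)"
    using R c f assms by (intro loosen_subst) (auto simp: unaries_iff)
  also have "\<dots> = loosen C (subst C k ?h p)"
    using subst_unary[OF conjunct1[OF R] f(2) c] R assms(2)
    by (simp add: loosen_to_def subst_kind_def)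
  finally show ?case using Cons.IH[OF f(1)] by simp
qed simp

lemma subst_from_ident:
  assumes "f \<in> arrows" "k + length ps \<le> arity f"
    "\<And>j. j < length ps \<Longrightarrow> ps ! j = ident C (ins f ! (k + j))"
  shows "subst_from C k f ps = f"
  using assms(2,3)
proof (induction ps arbitrary: k)
  case (Cons p ps)
  have "subst_from C (Suc k) f ps = f"
    using Cons.prems(1) Cons.prems(2)[of "Suc _"] by (intro Cons.IH) auto
  then show ?case using Cons.prems(1) Cons.prems(2)[of 0] assms(1) by (simp add: subst_ident)
qed simp

lemma fits_iff_acts: "fits 0 f ps \<and> length ps = arity f \<longleftrightarrow> set ps \<subseteq> unaries \<and> map out ps = ins f"
  by (auto simp: fits_def list_eq_iff_nth_eq)

lemma concat_unaries_nth:
  "set ps \<subseteq> unaries \<Longrightarrow> i < length ps \<Longrightarrow> concat (map ins ps) ! i = ins (ps ! i) ! 0"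
  by (induction ps arbitrary: i) (auto simp: unaries_iff nth_Cons nth_append split: nat.split)

lemma multisubst_ident:
  assumes "f \<in> arrows"
  shows "multisubst C f (map (ident C) (ins f)) = f"
  unfolding multisubst_def using assms by (intro subst_from_ident) auto

lemma multisubst_ident_update:
  assumes "g \<in> arrows" "p \<in> arrows" "composable i g p"
  shows "multisubst C g ((map (ident C) (ins g))[i := p]) = subst C i g p"
proof -
  let ?I = "map (ident C) (ins g)"
  have i: "i < arity g" using assms by (simp add: composable_def)
  have "subst_from C 0 g (take i ?I @ p # drop (Suc i) ?I) =
      subst_from C 0 (subst C i (subst_from C (Suc i) g (drop (Suc i) ?I)) p) (take i ?I)"
    using i by (simp add: subst_from_append)
  also have "subst_from C (Suc i) g (drop (Suc i) ?I) = g"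
    using assms i by (intro subst_from_ident) auto
  also have "subst_from C 0 (subst C i g p) (take i ?I) = subst C i g p"
    using subst_simps[OF assms] i
    by (intro subst_from_ident) (auto simp: splice_at_def nth_append)
  finally show ?thesis using i by (simp add: multisubst_def upd_conv_take_nth_drop)
qed

lemma multisubst_splice_at:
  assumes "g \<in> arrows" "f \<in> arrows" "composable i g f" "set ps \<subseteq> unaries" "map out ps = ins g"
    "set rs \<subseteq> unaries" "map out rs = ins f"
  shows "multisubst C (subst C i g f) (splice_at i ps rs) =
    subst C i (multisubst C g (ps[i := ident C (ins g ! i)])) (multisubst C f rs)"
proof -
  have i: "i < arity g" using assms by (simp add: composable_def)
  have len: "length ps = arity g" "length rs = arity f"
    using assms(5,7) by (metis length_map)+
  have out: "out (ps ! j) = ins g ! j" if "j < arity g" for j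
    using assms(5) that len by (metis nth_map)
  define ps1 ps2 where "ps1 = take i ps" and "ps2 = drop (Suc i) ps"
  define h where "h = subst_from C (Suc i) g ps2"
  have 2: "fits (Suc i) g ps2"
    using assms(4) len i out by (auto simp: fits_def ps2_def dest: in_set_dropD)
  have 1: "fits 0 g ps1"
    using assms(4) len i out by (auto simp: fits_def ps1_def dest: in_set_takeD)
  have rs: "fits 0 f rs" using assms(6,7) fits_iff_acts by blast
  note H = subst_from_simps[OF assms(1) 2, folded h_def]
  have fits_h: "fits 0 h ps1"
    using 1 H i len by (auto simp: fits_def ps1_def)
  have c: "composable i h f"
    using assms 2 by (simp add: h_def subst_from_composable)
  note F = subst_from_simps[OF assms(2) rs]
  have l1: "length ps1 = i" using len i by (simp add: ps1_def)
  have "subst_from C (i + arity f) (subst C i g f) ps2 = subst C i h f"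
    using subst_from_subst_after[OF assms(1-3) 2] by (simp add: h_def)
  moreover have "subst_from C (i + 0) (subst C i h f) rs = subst C i h (subst_from C 0 f rs)"
    using H c rs assms(2) by (intro subst_from_subst_within) auto
  moreover have "subst_from C 0 (subst C i h (subst_from C 0 f rs)) ps1 =
      subst C i (subst_from C 0 h ps1) (subst_from C 0 f rs)"
    using H F c fits_h l1 by (intro subst_from_subst_before) (auto simp: composable_def)
  ultimately have "multisubst C (subst C i g f) (splice_at i ps rs) =
      subst C i (subst_from C 0 h ps1) (subst_from C 0 f rs)"
    using l1 len
    by (simp add: multisubst_def splice_at_def subst_from_append ps1_def[symmetric] ps2_def[symmetric])
  moreover have "ps[i := ident C (ins g ! i)] = ps1 @ ident C (ins g ! i) # ps2"
    using i len by (simp add: ps1_def ps2_def upd_conv_take_nth_drop)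
  moreover have "subst C i h (ident C (ins g ! i)) = h"
    using subst_ident[of h i] H i by simp
  ultimately show ?thesis
    using l1 by (simp add: multisubst_def subst_from_append h_def[symmetric])
qed

lemma short_skew_multicategory_underlying: "short_skew_multicategory (underlying_short C)"
proof -
  let ?S = "underlying_short C"
  let ?H = "shoms ?S"
  have sel [simp]: "sobjs ?S = objs C" "sident ?S = ident C" "scomp ?S = subst C 0"
    "saction ?S = (\<lambda>q ps f. subst C 0 q (multisubst C f ps))" "sloosen ?S = loosen C"
    "ssubst ?S = subst C"
    by (simp_all add: underlying_short_def)
  have all [simp]: "f \<in> all_mmaps ?H \<longleftrightarrow> f \<in> arrows \<and> shape f \<in> short_shapes" for f
    by (cases f) (auto simp: all_mmaps_def mmaps_def underlying_short_def shape_def split: if_splits)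
  have unaries [simp]: "unary_morphisms ?H = unaries"
    by (auto simp: unary_morphisms_def short_shapes_def)
  have acts [simp]: "acts_on ?H q ps f \<longleftrightarrow> q \<in> unaries \<and> ins q = [out f] \<and> set ps \<subseteq> unaries \<and>
      map out ps = ins f" for q ps f
    by (simp add: acts_on_def)
  have shape: "shape f = (k, n) \<longleftrightarrow> kind f = k \<and> arity f = n" for f :: "('o, 'm) mmap" and k n
    by (simp add: shape_def)
  have short_subst [simp]: "short_subst ?S i g f = subst C i g f"
    if "g \<in> arrows" "f \<in> arrows" "composable i g f" for i g f
    using that subst_simps[OF that] ident_subst[of "subst C i g f"]
    by (auto simp: short_subst_def shape multisubst_ident multisubst_ident_update composable_def)
  have action: "subst C 0 q (multisubst C f ps) \<in> arrows"
    "kind (subst C 0 q (multisubst C f ps)) = kind f"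
    "ins (subst C 0 q (multisubst C f ps)) = concat (map ins ps)"
    "ins (multisubst C f ps) = concat (map ins ps)"
    "out (subst C 0 q (multisubst C f ps)) = out q"
    "arity (subst C 0 q (multisubst C f ps)) = arity f"
    "arity (multisubst C f ps) = arity f"
    "out (multisubst C f ps) = out f"
    "kind (multisubst C f ps) = kind f"
    "multisubst C f ps \<in> arrows" "composable 0 q (multisubst C f ps)" "fits 0 f ps"
    if "f \<in> arrows" "q \<in> unaries" "ins q = [out f]" "set ps \<subseteq> unaries" "map out ps = ins f"
    for f q ps
  proof -
    have fits: "fits 0 f ps" "length ps = arity f" using that fits_iff_acts by blast+
    note R = subst_from_simps[OF that(1) fits(1), folded multisubst_def]
    have ins: "ins (multisubst C f ps) = concat (map ins ps)"
      using ins_subst_from[OF that(1) fits(1)] fits(2) by (simp add: multisubst_def)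
    have c: "composable 0 q (multisubst C f ps)" using that R by (simp add: composable_def)
    have q: "q \<in> arrows" "kind q = Tight" using that by (auto simp: unaries_iff)
    note s = subst_simps[OF q(1) conjunct1[OF R] c]
    have ins': "ins (subst C 0 q (multisubst C f ps)) = concat (map ins ps)"
      using that by (simp add: s ins splice_at_def)
    show "subst C 0 q (multisubst C f ps) \<in> arrows"
      "out (subst C 0 q (multisubst C f ps)) = out q" by (simp_all add: s)
    show "kind (subst C 0 q (multisubst C f ps)) = kind f"
      using q R by (cases "kind f") (auto simp: s subst_kind_def)
    show "ins (subst C 0 q (multisubst C f ps)) = concat (map ins ps)"
      "ins (multisubst C f ps) = concat (map ins ps)" by fact+
    show "arity (subst C 0 q (multisubst C f ps)) = arity f"
      "arity (multisubst C f ps) = arity f" "out (multisubst C f ps) = out f"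
      "kind (multisubst C f ps) = kind f" "multisubst C f ps \<in> arrows"
      using R ins ins' by auto
    show "composable 0 q (multisubst C f ps)" "fits 0 f ps" by fact+
  qed
  have loosen: "loosen C f \<in> arrows" "kind (loosen C f) = Loose" "ins (loosen C f) = ins f"
      "out (loosen C f) = out f" if "f \<in> arrows" "kind f = Tight" for f
    using loosen_mmap[of f "ins f" "out f"] that by (auto simp: mmaps_iff)
  show ?thesis
  proof
    fix f assume "f \<in> all_mmaps ?H"
    then show "set (ins f) \<subseteq> sobjs ?S \<and> out f \<in> sobjs ?S" using homs_objs by simp
  next
    fix f assume "f \<in> all_mmaps ?H"
    then show "shape f \<in> short_shapes" by simp
  next
    fix a assume "a \<in> sobjs ?S"
    then show "sident ?S a \<in> mmaps ?H Tight [a] a"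
      using ident_mmap[of a] by (auto simp: mmaps_iff shape_def short_shapes_def)
  next
    fix q b c p a
    assume "q \<in> mmaps ?H Tight [b] c" "p \<in> mmaps ?H Tight [a] b"
    then show "scomp ?S q p \<in> mmaps ?H Tight [a] c"
      using subst_mmap[of q p 0]
      by (auto simp: mmaps_iff composable_def subst_kind_def splice_at_def shape_def)
  next
    fix r c d q b p a
    assume "r \<in> mmaps ?H Tight [c] d" "q \<in> mmaps ?H Tight [b] c" "p \<in> mmaps ?H Tight [a] b"
    then show "scomp ?S (scomp ?S r q) p = scomp ?S r (scomp ?S q p)"
      using subst_assoc[of r q p 0 0] by (auto simp: mmaps_iff composable_def)
  next
    fix p a b
    assume "p \<in> mmaps ?H Tight [a] b"
    then show "scomp ?S p (sident ?S a) = p" "scomp ?S (sident ?S b) p = p"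
      using subst_ident[of p 0] ident_subst[of p] by (auto simp: mmaps_iff)
  next
    fix f q ps
    assume "f \<in> all_mmaps ?H" "acts_on ?H q ps f"
    then show "saction ?S q ps f \<in> mmaps ?H (kind f) (concat (map ins ps)) (out q)"
      using action[of f q ps] by (auto simp: mmaps_iff shape_def)
  next
    fix f assume "f \<in> all_mmaps ?H"
    then show "saction ?S (sident ?S (out f)) (map (sident ?S) (ins f)) f = f"
      by (simp add: multisubst_ident ident_subst)
  next
    fix f q ps q' ps'
    assume f: "f \<in> all_mmaps ?H" and a: "acts_on ?H q ps f"
      and a': "acts_on ?H q' ps' (saction ?S q ps f)"
    let ?F = "multisubst C f ps"
    have x: "f \<in> arrows" "q \<in> unaries" "ins q = [out f]" "set ps \<subseteq> unaries" "map out ps = ins f"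
      using f a by auto
    note A = action[OF x]
    have y: "?F \<in> arrows" "q \<in> unaries" "ins q = [out ?F]" "set ps' \<subseteq> unaries" "map out ps' = ins ?F"
      using a' x A by auto
    note A' = action[OF y]
    have q: "q \<in> arrows" "q' \<in> arrows" using x a' by (auto simp: unaries_iff)
    have len: "length ps' = length ps"
      using x(5) y(5) A(7) by (metis length_map)
    have 1: "multisubst C f (map2 (subst C 0) ps ps') = multisubst C ?F ps'"
      unfolding multisubst_def
      using A(12) A'(12) x(1) len by (intro subst_from_comp) (auto simp: multisubst_def)
    have 2: "multisubst C (subst C 0 q ?F) ps' = subst C 0 q (multisubst C ?F ps')"
      using subst_from_subst_within[OF q(1) A(10,11) A'(12)] by (simp add: multisubst_def)
    have c: "composable 0 q' q" using a' A by (simp add: composable_def)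
    have "subst C (0 + 0) (subst C 0 q' q) (multisubst C ?F ps') =
        subst C 0 q' (subst C 0 q (multisubst C ?F ps'))"
      using q A' c by (intro subst_assoc) auto
    then show "saction ?S (scomp ?S q' q) (map2 (scomp ?S) ps ps') f =
        saction ?S q' ps' (saction ?S q ps f)"
      by (simp add: 1 2)
  next
    fix f q p
    assume f: "f \<in> unary_morphisms ?H" and a: "acts_on ?H q [p] f"
    from a have a: "q \<in> unaries \<and> ins q = [out f] \<and> set [p] \<subseteq> unaries \<and> map out [p] = ins f"
      by (rule acts[THEN iffD1])
    from a have i: "ins q = [out f]" by blast
    from a have i': "ins f = map out [p]" by metis
    have m: "q \<in> unaries" "p \<in> unaries"
      using a by (blast, metis list.set_intros(1) subsetD)
    have c: "composable 0 q f" unfolding composable_def i by simp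
    have c': "composable 0 f p" unfolding composable_def i' by simp
    have "f \<in> arrows" "q \<in> arrows" "p \<in> arrows" using f m by (auto simp: unaries_iff)
    from subst_assoc[OF this(2,1,3) c c'] show "saction ?S q [p] f = scomp ?S (scomp ?S q f) p"
      by (simp add: multisubst_def)
  next
    fix f assume "f \<in> all_mmaps ?H" "shape f \<in> {(Tight, 1), (Tight, 2)}"
    then have f: "f \<in> arrows" "kind f = Tight" "arity f = 1 \<or> arity f = 2"
      by (auto simp: shape)
    have "loosen C f \<in> all_mmaps ?H"
      unfolding all shape_def short_shapes_def loosen(2,3)[OF f(1,2)] using loosen(1)[OF f(1,2)] f(3) by auto
    then show "sloosen ?S f \<in> mmaps ?H Loose (ins f) (out f)"
      unfolding mmaps_iff sel using loosen(2-4)[OF f(1,2)] by blast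
  next
    fix f q ps
    assume f: "f \<in> all_mmaps ?H" "shape f \<in> {(Tight, 1), (Tight, 2)}" and a: "acts_on ?H q ps f"
    have x: "f \<in> arrows" "q \<in> unaries" "ins q = [out f]" "set ps \<subseteq> unaries" "map out ps = ins f"
      using f a by auto
    note A = action[OF x]
    have k: "kind f = Tight" "q \<in> arrows" using f x by (auto simp: shape_def unaries_iff)
    have l: "multisubst C (loosen C f) ps = loosen C (multisubst C f ps)"
      unfolding multisubst_def by (rule subst_from_loosen[OF x(1) k(1) A(12)])
    have "subst C 0 q (loosen C (multisubst C f ps)) =
        loosen_to C (subst_kind (kind q) 0 Loose) (subst C 0 q (multisubst C f ps))"
      using k A(9-11) by (intro subst_loosen) simp_all
    also have "\<dots> = loosen C (subst C 0 q (multisubst C f ps))"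
      using A(2) k(1) by (simp add: loosen_to_def subst_kind_def)
    finally show "sloosen ?S (saction ?S q ps f) = saction ?S q ps (sloosen ?S f)"
      by (simp add: l)
  next
    fix g f i
    assume "g \<in> all_mmaps ?H" "f \<in> all_mmaps ?H" and sub: "short_substitutable g f"
      and c: "composable i g f"
    then have x: "g \<in> arrows" "f \<in> arrows" by simp_all
    note s = subst_simps[OF x c]
    have ar: "arity (subst C i g f) = arity g + arity f - 1"
      using c by (simp add: s composable_def splice_at_def)
    have "(subst_kind (kind g) i (kind f), arity g + arity f - 1) \<in> short_shapes"
      using sub by (auto simp: short_substitutable_def shape_def short_shapes_def subst_kind_def)
    then have "subst C i g f \<in> all_mmaps ?H"
      unfolding all shape_def ar s(2) using s(1) by blast
    then show "ssubst ?S i g f \<in> mmaps ?H (subst_kind (kind g) i (kind f)) (splice_at i (ins g) (ins f)) (out g)"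
      unfolding mmaps_iff sel using s(2-4) by blast
  next
    fix g f i q ps rs
    assume g: "g \<in> all_mmaps ?H" and f: "f \<in> all_mmaps ?H" and c: "composable i g f"
      and a: "acts_on ?H q ps g" and b: "acts_on ?H (sident ?S (out f)) rs f"
    let ?ps = "ps[i := ident C (ins g ! i)]"
    have i: "i < arity g" using c by (simp add: composable_def)
    have o: "ins g ! i \<in> objs C" "out f \<in> objs C" using f g i by (auto intro: ins_objs out_objs)
    have "map out ?ps = ins g"
      using a i o by (metis acts ident_simps(4) list_update_id map_update)
    moreover have "set ?ps \<subseteq> unaries"
      using a o set_update_subset_insert[of ps i "ident C (ins g ! i)"] by (auto simp: ident_simps)
    ultimately have x: "g \<in> arrows" "q \<in> unaries" "ins q = [out g]" "set ?ps \<subseteq> unaries" "map out ?ps = ins g"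
      using g a by auto
    note A = action[OF x]
    have y: "f \<in> arrows" "ident C (out f) \<in> unaries" "ins (ident C (out f)) = [out f]"
      "set rs \<subseteq> unaries" "map out rs = ins f"
      using f b by auto
    note B = action[OF y]
    have len: "length ?ps = arity g" using x(5) by (metis length_map)
    have "ins (multisubst C g ?ps) ! i = ins g ! i"
      using A(4) concat_unaries_nth[OF x(4), of i] len i o by (simp add: ident_simps)
    then have c': "composable i (multisubst C g ?ps) (multisubst C f rs)"
      using A B c by (simp add: composable_def)
    have q: "q \<in> arrows" using x by (auto simp: unaries_iff)
    have "subst C (0 + i) (subst C 0 q (multisubst C g ?ps)) (multisubst C f rs) =
        subst C 0 q (subst C i (multisubst C g ?ps) (multisubst C f rs))"
      using q A B c' by (intro subst_assoc) auto
    moreover have "multisubst C (subst C i g f) (splice_at i ps rs) =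
        subst C i (multisubst C g ?ps) (multisubst C f rs)"
      using f g c a b by (intro multisubst_splice_at) auto
    moreover have "subst C 0 (ident C (out f)) (multisubst C f rs) = multisubst C f rs"
      using ident_subst[of "multisubst C f rs"] B by simp
    ultimately show "saction ?S q (splice_at i ps rs) (ssubst ?S i g f) =
        ssubst ?S i (saction ?S q (ps[i := sident ?S (ins g ! i)]) g)
          (saction ?S (sident ?S (out f)) rs f)"
      by simp
  next
    fix g f i p
    assume g: "g \<in> all_mmaps ?H" and f: "f \<in> all_mmaps ?H" and p: "p \<in> unary_morphisms ?H"
      "ins p = [out f]" and c: "composable i g p"
    have x: "g \<in> arrows" "p \<in> arrows" "f \<in> arrows" "composable 0 p f"
      using g f p by (auto simp: unaries_iff composable_def)
    have "subst C 0 (ident C (out g)) (subst C i g p) = subst C i g p"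
      using subst_simps[OF x(1,2) c] ident_subst[of "subst C i g p"] by simp
    moreover have "subst C (i + 0) (subst C i g p) f = subst C i g (subst C 0 p f)"
      using x c by (intro subst_assoc) auto
    ultimately show "ssubst ?S i (saction ?S (sident ?S (out g)) ((map (sident ?S) (ins g))[i := p]) g) f =
        ssubst ?S i g (saction ?S p (map (sident ?S) (ins f)) f)"
      using x c by (simp add: multisubst_ident multisubst_ident_update)
  next
    fix f g h i k
    assume "f \<in> all_mmaps ?H" "g \<in> all_mmaps ?H" "h \<in> all_mmaps ?H"
      and c: "composable i f g" "composable k g h"
    then have x: "f \<in> arrows" "g \<in> arrows" "h \<in> arrows" by auto
    note s = subst_simps[OF x(1,2) c(1)] subst_simps[OF x(2,3) c(2)]
    have c': "composable i f (subst C k g h)" "composable (i + k) (subst C i f g) h"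
      using c by (auto simp: s composable_def splice_at_def nth_append)
    show "short_subst ?S i f (short_subst ?S k g h) = short_subst ?S (i + k) (short_subst ?S i f g) h"
      using x c c' s subst_assoc[OF x c] by simp
  next
    fix f g h
    assume "f \<in> all_mmaps ?H" "g \<in> all_mmaps ?H" "h \<in> all_mmaps ?H"
      and c: "composable 0 f g" "composable 1 f h"
    then have x: "f \<in> arrows" "g \<in> arrows" "h \<in> arrows" by auto
    note s = subst_simps[OF x(1,2) c(1)] subst_simps[OF x(1,3) c(2)]
    have c': "composable (arity g) (subst C 0 f g) h" "composable 0 (subst C 1 f h) g"
      using c by (auto simp: s[simplified] composable_def splice_at_def nth_append)
    show "short_subst ?S (arity g) (short_subst ?S 0 f g) h = short_subst ?S 0 (short_subst ?S 1 f h) g"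
      using x c c' s subst_commute[OF x c] by simp
  next
    fix g p
    assume "g \<in> all_mmaps ?H" "shape g = (Tight, 2)" "p \<in> unary_morphisms ?H" and c: "composable 1 g p"
    then have x: "g \<in> arrows" "p \<in> arrows" "kind g = Tight" "kind p = Tight"
      by (auto simp: unaries_iff shape)
    have "composable 1 g (loosen C p)" using c loosen x by (simp add: composable_def)
    then show "short_subst ?S 1 g (sloosen ?S p) = short_subst ?S 1 g p"
      using subst_loosen[OF x(1,2) c x(4)] x c loosen subst_simps[OF x(1,2) c]
      by (simp add: loosen_to_def subst_kind_def)
  next
    fix g p
    assume "g \<in> all_mmaps ?H" "shape g = (Tight, 2)" "p \<in> unary_morphisms ?H" and c: "composable 0 g p"
    then have x: "g \<in> arrows" "p \<in> arrows" "kind g = Tight" "kind p = Tight"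
      by (auto simp: unaries_iff shape)
    have "composable 0 g (loosen C p)" using c loosen x by (simp add: composable_def)
    then show "short_subst ?S 0 g (sloosen ?S p) = sloosen ?S (short_subst ?S 0 g p)"
      using subst_loosen[OF x(1,2) c x(4)] x c loosen subst_simps[OF x(1,2) c]
      by (simp add: loosen_to_def subst_kind_def)
  next
    fix g p
    assume "g \<in> unary_morphisms ?H" "p \<in> unary_morphisms ?H" and c: "composable 0 g p"
    then have x: "g \<in> arrows" "p \<in> arrows" "kind g = Tight" "kind p = Tight"
      by (auto simp: unaries_iff)
    have "composable 0 g (loosen C p)" using c loosen x by (simp add: composable_def)
    then show "short_subst ?S 0 g (sloosen ?S p) = sloosen ?S (short_subst ?S 0 g p)"
      using subst_loosen[OF x(1,2) c x(4)] x c loosen subst_simps[OF x(1,2) c]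
      by (simp add: loosen_to_def subst_kind_def)
  next
    fix p g
    assume "p \<in> unary_morphisms ?H" "g \<in> all_mmaps ?H" "shape g = (Tight, 2)" and c: "composable 0 p g"
    then have x: "p \<in> arrows" "g \<in> arrows" "kind p = Tight" "kind g = Tight"
      by (auto simp: unaries_iff shape)
    have "composable 0 (loosen C p) g" using c loosen x by (simp add: composable_def)
    then show "short_subst ?S 0 (sloosen ?S p) g = sloosen ?S (short_subst ?S 0 p g)"
      using loosen_subst[OF x(1,2) c x(3)] x c loosen subst_simps[OF x(1,2) c]
      by (simp add: loosen_to_def subst_kind_def)
  next
    fix p v
    assume "p \<in> unary_morphisms ?H" "v \<in> all_mmaps ?H" "shape v = (Loose, 0)" and c: "composable 0 p v"
    then have x: "p \<in> arrows" "v \<in> arrows" "kind p = Tight" "kind v = Loose"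
      by (auto simp: unaries_iff shape)
    have "composable 0 (loosen C p) v" using c loosen x by (simp add: composable_def)
    then show "short_subst ?S 0 (sloosen ?S p) v = short_subst ?S 0 p v"
      using loosen_subst[OF x(1,2) c x(3)] x c loosen subst_simps[OF x(1,2) c]
      by (simp add: loosen_to_def subst_kind_def)
  qed
qed

end

end

theory Submission
  imports Defs
begin

text \<open>
  Left representability lets one split a multimap after any initial segment of its inputs:
  \<open>f = g \<circ>[0] q\<close> with \<open>g\<close> tight and \<open>q\<close> of the same type as \<open>f\<close> (\<open>left_factor\<close>).  Splitting
  twice gives \<open>f = g \<circ>[0] (h \<circ>[0] q)\<close> with \<open>h\<close> tight ternary, where the last two inputs of \<open>h\<close>
  are two adjacent inputs of \<open>f\<close>; if \<open>f\<close> is tight, its first input cannot be one of them.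
  In a braiding the generator that crosses these inputs has to act as \<open>\<beta>32\<close> on \<open>h\<close>.  Since the
  generators generate, a braiding is determined by \<open>\<beta>32\<close> (\<open>act_eq_braid_action\<close>).

  Conversely the same formula defines an operation \<open>cross k\<close> from any natural \<open>\<beta>32\<close>, because two
  splittings of \<open>f\<close> differ by unary multimaps (\<open>crossing_unique\<close>).  Naturality is also all that
  it takes for \<open>cross k\<close> to commute with a substitution into an input that is not crossed, and with
  crossings far away: one splits at the right place.  The other laws of a braiding reduce by
  splitting to statements about tight multimaps of arity 3 and 4, which the axioms of a short
  braiding supply, with two exceptions.

  The first exception is the substitution of a nullary multimap into a crossed input, about which
  a short braiding says nothing.  The law follows from the hexagon, applied to a binary multimap
  that becomes a loose identity when the unit is substituted into its first input
  (\<open>swap_nullary\<close>).  As every multimap is a composite of binary, tight unary and nullary ones,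
  this yields the law for substituting an arbitrary multimap into the first of two crossed inputs
  (\<open>cross_subst_first\<close>).  The inverse of the swap satisfies the same hypotheses, which gives the
  law for the second crossed input.

  The second exception is that on tight multimaps only the braids fixing the first strand act, and
  these form a subgroup of the braid group on all strands.  So two words without the first
  generator must act alike if they are equal as braids on \<open>n\<close> strands, although a derivation of
  their equality may use the first generator.  Deleting the first strand turns it into a
  derivation in the braid group on the remaining strands (\<open>braid_eq_shift_inject\<close>).

  If \<open>\<beta>32\<close> is an involution, then so are all crossings, and words with the same permutation act
  alike by the Coxeter presentation of the symmetric group (\<open>word_perm_eq_imp_sym_eq\<close>).
\<close>

section \<open>Substitution and left universal multimaps\<close>

lemma subst_kind_simps [simp]:
  "subst_kind Loose i y = Loose"
  "subst_kind Tight 0 y = y"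
  "0 < i \<Longrightarrow> subst_kind Tight i y = Tight"
  using tightness.exhaust[of y] by (auto simp: subst_kind_def)

context skew_multicategory
begin

abbreviation plug (\<open>_ \<circ>[_] _\<close> [66, 0, 65] 65) where
  "g \<circ>[i] f \<equiv> subst C i g f"

abbreviation tights :: "nat \<Rightarrow> ('o, 'm) mmap set" where
  "tights n \<equiv> tight_mmaps (homs C) n"

abbreviation tight :: "('o, 'm) mmap \<Rightarrow> bool" where
  "tight f \<equiv> kind f = Tight"

definition pluggable :: "nat \<Rightarrow> ('o, 'm) mmap \<Rightarrow> ('o, 'm) mmap \<Rightarrow> bool" where
  "pluggable i g f \<longleftrightarrow> g \<in> arrows \<and> f \<in> arrows \<and> composable i g f"

lemma pluggableD:
  assumes "pluggable i g f"
  shows "g \<in> arrows" "f \<in> arrows" "i < arity g" "out f = ins g ! i"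
  using assms by (auto simp: pluggable_def composable_def)

lemma tight_arity: "f \<in> arrows \<Longrightarrow> tight f \<Longrightarrow> 0 < arity f"
  using tight_nonnullary mmaps_iff[of f "homs C" Tight "[]" "out f"] by (auto simp: mmaps_def)

lemma subst_facts [simp]:
  assumes "pluggable i g f"
  shows "g \<circ>[i] f \<in> arrows" "out (g \<circ>[i] f) = out g"
    "kind (g \<circ>[i] f) = subst_kind (kind g) i (kind f)"
    "arity (g \<circ>[i] f) = arity g + arity f - 1"
  using assms subst_simps[of g f i]
  by (auto simp: pluggable_def composable_def splice_at_def)

lemma ins_subst_nth:
  assumes "pluggable i g f" "j < arity g + arity f - 1"
  shows "ins (g \<circ>[i] f) ! j = (if j < i then ins g ! j
    else if j < i + arity f then ins f ! (j - i) else ins g ! (j + 1 - arity f))"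
  using assms subst_simps[of g f i]
  by (auto simp: pluggable_def composable_def splice_at_def nth_append less_diff_conv Suc_diff_le)

lemma pluggable_inner [simp]:
  assumes "pluggable k g f"
  shows "pluggable i h (g \<circ>[k] f) \<longleftrightarrow> pluggable i h g"
  unfolding pluggable_def composable_def subst_facts(2)[OF assms]
  using subst_facts(1)[OF assms] pluggableD(1)[OF assms] by blast

lemma pluggable_outer:
  assumes "pluggable i h g"
  shows "pluggable j (h \<circ>[i] g) f \<longleftrightarrow> (if j < i then pluggable j h f
    else if j < i + arity g then pluggable (j - i) g f
    else pluggable (j + 1 - arity g) h f)"
proof -
  note h = pluggableD[OF assms]
  have "composable j (h \<circ>[i] g) f \<longleftrightarrow> (if j < i then composable j h f
      else if j < i + arity g then composable (j - i) g f else composable (j + 1 - arity g) h f)"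
  proof -
    consider "j < i" | "i \<le> j" "j < i + arity g" | "i + arity g \<le> j" by linarith
    then show ?thesis
    proof cases
      case 1
      then have "j < arity h + arity g - 1" "j < arity h" using h(3) by auto
      then show ?thesis
        using 1 ins_subst_nth[OF assms, of j] by (simp add: composable_def subst_facts(4)[OF assms])
    next
      case 2
      then have "j < arity h + arity g - 1" "j - i < arity g" "\<not> j < i" using h(3) by auto
      then show ?thesis
        using 2 ins_subst_nth[OF assms, of j] by (simp add: composable_def subst_facts(4)[OF assms])
    next
      case 3
      then have *: "\<not> j < i" "\<not> j < i + arity g" by auto
      have "j < arity h + arity g - 1 \<longleftrightarrow> j + 1 - arity g < arity h" using 3 h(3) by arith
      then show ?thesis
        using * ins_subst_nth[OF assms, of j] by (auto simp: composable_def subst_facts(4)[OF assms])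
    qed
  qed
  then show ?thesis
    using h(1,2) subst_facts(1)[OF assms] unfolding pluggable_def
    by (cases "j < i"; cases "j < i + arity g"; simp)
qed

lemma pluggable_after:
  assumes "pluggable i h g" "i < k" "j = k + arity g - 1"
  shows "pluggable j (h \<circ>[i] g) f \<longleftrightarrow> pluggable k h f"
proof -
  have "\<not> j < i + arity g" "\<not> j < i" "j + 1 - arity g = k" using assms(2,3) by auto
  then show ?thesis using pluggable_outer[OF assms(1), of j f] by simp
qed

lemma plug_plug:
  assumes "pluggable i h g" "pluggable k g f"
  shows "(h \<circ>[i] g) \<circ>[i + k] f = h \<circ>[i] (g \<circ>[k] f)"
  using assms by (intro subst_assoc) (auto simp: pluggable_def)

lemma plug_plug_0:
  assumes "pluggable 0 h g" "pluggable k g f"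
  shows "(h \<circ>[0] g) \<circ>[k] f = h \<circ>[0] (g \<circ>[k] f)"
  using plug_plug[OF assms] by simp

lemma plug_0_plug:
  assumes "pluggable i h g" "pluggable 0 g f"
  shows "(h \<circ>[i] g) \<circ>[i] f = h \<circ>[i] (g \<circ>[0] f)"
  using plug_plug[OF assms] by simp

lemma plug_swap:
  assumes "pluggable i h g" "pluggable k h f" "i < k" "j = k + arity g - 1"
  shows "(h \<circ>[i] g) \<circ>[j] f = (h \<circ>[k] f) \<circ>[i] g"
  unfolding assms(4) using assms(1-3) by (intro subst_commute) (auto simp: pluggable_def)

lemma loosen_facts [simp]:
  assumes "f \<in> arrows" "tight f"
  shows "loosen C f \<in> arrows" "kind (loosen C f) = Loose" "ins (loosen C f) = ins f"
    "out (loosen C f) = out f"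
  using loosen_mmap[of f "ins f" "out f"] assms by (auto simp: mmaps_iff)

end

locale left_representable_multicategory = skew_multicategory C
  for C :: "('o, 'm) skew_multicat" +
  assumes left_representable: "left_representable C"
begin

text \<open>The property required of \<open>\<theta>\<close> in the definition of left representability; the remaining inputs
  and the target are read off from \<open>f\<close>.\<close>

definition left_universal :: "('o, 'm) mmap \<Rightarrow> bool" where
  "left_universal \<theta> \<longleftrightarrow> \<theta> \<in> arrows \<and>
    (\<forall>f\<in>arrows. kind f = kind \<theta> \<and> take (arity \<theta>) (ins f) = ins \<theta> \<longrightarrow>
      (\<exists>!g. pluggable 0 g \<theta> \<and> tight g \<and> g \<circ>[0] \<theta> = f))"

lemma take_ins_subst:
  "pluggable 0 g q \<Longrightarrow> take (arity q) (ins (g \<circ>[0] q)) = ins q"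
  using subst_simps(3)[of g q 0] by (auto simp: pluggable_def splice_at_def)

lemma left_universal_exists:
  assumes "set as \<subseteq> objs C" "k = Tight \<Longrightarrow> as \<noteq> []"
  obtains \<theta> where "left_universal \<theta>" "kind \<theta> = k" "ins \<theta> = as"
proof -
  have "\<exists>m\<in>objs C. \<exists>\<theta>\<in>mmaps (homs C) k as m. \<forall>ys b. set ys \<subseteq> objs C \<and> b \<in> objs C \<longrightarrow>
      bij_betw (\<lambda>g. subst C 0 g \<theta>) (mmaps (homs C) Tight (m # ys) b) (mmaps (homs C) k (as @ ys) b)"
    using left_representable assms unfolding left_representable_def by meson
  then obtain m \<theta> where m: "m \<in> objs C" and \<theta>: "\<theta> \<in> mmaps (homs C) k as m"
    and bij: "\<forall>ys b. set ys \<subseteq> objs C \<and> b \<in> objs C \<longrightarrow> bij_betw (\<lambda>g. subst C 0 g \<theta>)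
      (mmaps (homs C) Tight (m # ys) b) (mmaps (homs C) k (as @ ys) b)"
    by (elim bexE)
  have \<theta>': "\<theta> \<in> arrows" "kind \<theta> = k" "ins \<theta> = as" "out \<theta> = m"
    using \<theta> by (auto simp: mmaps_iff)
  have "\<exists>!g. pluggable 0 g \<theta> \<and> tight g \<and> g \<circ>[0] \<theta> = f"
    if f: "f \<in> arrows" "kind f = k" "take (length as) (ins f) = as" for f
  proof -
    let ?ys = "drop (length as) (ins f)"
    have ys: "ins f = as @ ?ys" using f(3) by (metis append_take_drop_id)
    have "set ?ys \<subseteq> objs C" using homs_objs[OF f(1)] by (auto dest: in_set_dropD)
    then have b: "bij_betw (\<lambda>g. subst C 0 g \<theta>)
        (mmaps (homs C) Tight (m # ?ys) (out f)) (mmaps (homs C) k (as @ ?ys) (out f))"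
      using homs_objs[OF f(1)] by (intro bij[rule_format]) auto
    have mem: "g \<in> mmaps (homs C) Tight (m # ?ys) (out f)"
      if g: "pluggable 0 g \<theta>" "tight g" "g \<circ>[0] \<theta> = f" for g
    proof -
      obtain a xs where ins: "ins g = a # xs"
        using pluggableD(3)[OF g(1)] by (cases "ins g") auto
      moreover have "ins f = as @ xs"
        using g(1,3) subst_simps(3)[of g \<theta> 0] ins \<theta>'
        by (auto simp: pluggable_def splice_at_def)
      ultimately show ?thesis
        using pluggableD[OF g(1)] g \<theta>' by (auto simp: mmaps_iff)
    qed
    have "f \<in> mmaps (homs C) k (as @ ?ys) (out f)" using f ys by (simp add: mmaps_iff)
    then obtain g where g: "g \<in> mmaps (homs C) Tight (m # ?ys) (out f)" "g \<circ>[0] \<theta> = f"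
      using bij_betw_imp_surj_on[OF b] by (metis imageE)
    show ?thesis
    proof (rule ex1I[of _ g])
      show "pluggable 0 g \<theta> \<and> tight g \<and> g \<circ>[0] \<theta> = f"
        using g \<theta>' by (auto simp: pluggable_def composable_def mmaps_iff)
      fix g' assume "pluggable 0 g' \<theta> \<and> tight g' \<and> g' \<circ>[0] \<theta> = f"
      then show "g' = g"
        using mem g inj_onD[OF bij_betw_imp_inj_on[OF b]] by blast
    qed
  qed
  then show ?thesis using \<theta>' that unfolding left_universal_def by blast
qed

lemma left_universal_factor:
  assumes "left_universal \<theta>" "f \<in> arrows" "kind f = kind \<theta>" "take (arity \<theta>) (ins f) = ins \<theta>"
  obtains g where "pluggable 0 g \<theta>" "tight g" "f = g \<circ>[0] \<theta>"
  using assms unfolding left_universal_def by blast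

lemma left_universal_cancel:
  assumes "left_universal \<theta>" "pluggable 0 g \<theta>" "pluggable 0 g' \<theta>" "tight g" "tight g'"
    "g \<circ>[0] \<theta> = g' \<circ>[0] \<theta>"
  shows "g = g'"
proof -
  have "\<exists>!x. pluggable 0 x \<theta> \<and> tight x \<and> x \<circ>[0] \<theta> = g \<circ>[0] \<theta>"
    using assms(1,2,4) take_ins_subst[OF assms(2)] unfolding left_universal_def by simp
  then show ?thesis using assms by metis
qed

text \<open>The tight case needs \<open>0 < k\<close>: there is no tight nullary multimap to split off.\<close>

lemma left_factor:
  assumes "f \<in> arrows" "k \<le> arity f" "tight f \<Longrightarrow> 0 < k"
  obtains g q where "pluggable 0 g q" "tight g" "kind q = kind f" "arity q = k"
    "f = g \<circ>[0] q" "arity f = arity g + k - 1"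
proof -
  have "set (take k (ins f)) \<subseteq> objs C"
    using homs_objs[OF assms(1)] by (auto dest: in_set_takeD)
  moreover have "take k (ins f) \<noteq> []" if "kind f = Tight"
    using assms tight_arity[OF assms(1)] that by auto
  ultimately obtain \<theta> where \<theta>: "left_universal \<theta>" "kind \<theta> = kind f" "ins \<theta> = take k (ins f)"
    by (rule left_universal_exists)
  have a: "arity \<theta> = k" using \<theta>(3) assms(2) by simp
  obtain g where g: "pluggable 0 g \<theta>" "tight g" "f = g \<circ>[0] \<theta>"
    using left_universal_factor[OF \<theta>(1) assms(1)] \<theta>(2,3) a by metis
  have "arity f = arity g + k - 1" using subst_facts(4)[OF g(1)] g(3) a by simp
  then show ?thesis by (rule that[OF g(1,2) \<theta>(2) a g(3)])
qed

text \<open>The unit \<open>u\<close> is the universal nullary multimap.  The multimap \<open>l\<close> corresponds to the loose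
  identity of the unit object under the universal property of \<open>u\<close>.\<close>

lemma unit_exists:
  obtains u l where "left_universal u" "kind u = Loose" "arity u = 0"
    "pluggable 0 l u" "tight l" "arity l = 2" "pluggable 1 l u" "out l = out u"
    "l \<circ>[0] u = loosen C (ident C (out u))"
proof -
  have "set ([] :: 'o list) \<subseteq> objs C" "[] \<noteq> ([] :: 'o list)" if "Loose = Tight" using that by simp_all
  then obtain u where u: "left_universal u" "kind u = Loose" "ins u = []"
    using left_universal_exists[of "[]" Loose] by auto
  have u': "u \<in> arrows" using u(1) by (simp add: left_universal_def)
  note i = ident_simps[OF out_objs[OF u']]
  have it: "tight (ident C (out u))" using i by (simp add: unaries_iff)
  let ?j = "loosen C (ident C (out u))"
  have j: "?j \<in> arrows" "kind ?j = kind u" "ins ?j = [out u]" "out ?j = out u" using i it u(2) by simp_all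
  have "take (arity u) (ins ?j) = ins u" using u(3) by simp
  from left_universal_factor[OF u(1) j(1,2) this]
  obtain l where l: "pluggable 0 l u" "tight l" "?j = l \<circ>[0] u" .
  have a: "arity ?j = 1" using j by simp
  have al: "arity l = 2"
    using subst_facts(4)[OF l(1), folded l(3)] a u(3) pluggableD(3)[OF l(1)] by simp
  have "ins ?j ! 0 = ins l ! 1"
    using ins_subst_nth[OF l(1), of 0, folded l(3)] u(3) al by simp
  then have "pluggable 1 l u"
    using l(1) al j by (simp add: pluggable_def composable_def)
  moreover have "out l = out u" using subst_facts(2)[OF l(1), folded l(3)] j by simp
  ultimately show ?thesis using that[OF u(1,2) _ l(1,2) al] u(3) l(3) by simp
qed

text \<open>Substitution into an input of a tight multimap other than the first does not see whether the
  argument is tight or loose.\<close>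

lemma subst_loosen_ident:
  assumes "g \<in> arrows" "i < arity g" "tight g" "0 < i"
  shows "g \<circ>[i] loosen C (ident C (ins g ! i)) = g"
proof -
  note I = ident_simps[OF ins_objs[OF assms(1,2)]]
  have "g \<circ>[i] loosen C (ident C (ins g ! i)) =
      loosen_to C (subst_kind (kind g) i Loose) (g \<circ>[i] ident C (ins g ! i))"
    using assms I by (intro subst_loosen) (auto simp: composable_def unaries_iff)
  then show ?thesis using assms subst_ident[OF assms(1,2)] by (simp add: loosen_to_def)
qed

text \<open>The step of an induction on arities that starts from nullary and from tight unary multimaps.\<close>

lemma binary_factor:
  assumes "f \<in> arrows" "arity f \<noteq> 0" "\<not> (tight f \<and> arity f = 1)"
  obtains b e where "pluggable 0 b e" "tight b" "arity b = 2" "f = b \<circ>[0] e" "arity f = Suc (arity e)"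
proof -
  have pos: "0 < arity f - 1" if "tight f" using assms that by linarith
  have le: "arity f - 1 \<le> arity f" by simp
  obtain b e where d: "pluggable 0 b e" "tight b" "kind e = kind f" "arity e = arity f - 1"
    "f = b \<circ>[0] e" "arity f = arity b + (arity f - 1) - 1"
    by (rule left_factor[OF assms(1) le pos])
  have 1: "arity f = Suc (arity e)" using d(4) assms(2) by simp
  have "arity b = 2" using d(6) assms(2) by linarith
  then show ?thesis by (rule that[OF d(1,2) _ d(5) 1])
qed

end

section \<open>Crossing two adjacent inputs\<close>

text \<open>The two naturality laws are the ones that relate the ternary parts of different splittings of a
  multimap.\<close>

locale natural_swap = left_representable_multicategory C
  for C :: "('o, 'm) skew_multicat" +
  fixes \<beta> :: "('o, 'm) mmap \<Rightarrow> ('o, 'm) mmap"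
  assumes swap_mmap: "\<lbrakk>h \<in> arrows; tight h; arity h = 3\<rbrakk> \<Longrightarrow>
      \<beta> h \<in> mmaps (homs C) Tight (permute_list (transpose 1 2) (ins h)) (out h)"
    and swap_post: "\<lbrakk>pluggable 0 p h; tight p; arity p = 1; tight h; arity h = 3\<rbrakk> \<Longrightarrow>
      \<beta> (p \<circ>[0] h) = p \<circ>[0] \<beta> h"
    and swap_pre: "\<lbrakk>pluggable 0 h p; tight p; arity p = 1; tight h; arity h = 3\<rbrakk> \<Longrightarrow>
      \<beta> (h \<circ>[0] p) = \<beta> h \<circ>[0] p"
begin

text \<open>The choice is immaterial by \<open>crossing_unique\<close>.\<close>

definition cross :: "nat \<Rightarrow> ('o, 'm) mmap \<Rightarrow> ('o, 'm) mmap" where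
  "cross k f = (SOME f'. \<exists>g h q. pluggable 0 g h \<and> pluggable 0 h q \<and> tight g \<and> tight h \<and>
    arity h = 3 \<and> arity q = k \<and> f = g \<circ>[0] (h \<circ>[0] q) \<and> f' = g \<circ>[0] (\<beta> h \<circ>[0] q))"

text \<open>On tight multimaps the first strand stays untouched.\<close>

definition crossable :: "nat \<Rightarrow> ('o, 'm) mmap \<Rightarrow> bool" where
  "crossable k f \<longleftrightarrow> f \<in> arrows \<and> Suc k < arity f \<and> (tight f \<longrightarrow> 0 < k)"

lemma swap_simps:
  assumes "h \<in> arrows" "tight h" "arity h = 3"
  shows "\<beta> h \<in> arrows" "tight (\<beta> h)" "arity (\<beta> h) = 3" "out (\<beta> h) = out h"
    "ins (\<beta> h) ! 0 = ins h ! 0" "ins (\<beta> h) ! 1 = ins h ! 2" "ins (\<beta> h) ! 2 = ins h ! 1"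
    "ins (\<beta> h) = permute_list (transpose 1 2) (ins h)"
  using swap_mmap[OF assms] assms permute_list_transpose_nth[of 1 "ins h", simplified]
  by (auto simp: mmaps_iff numeral_2_eq_2)

lemma pluggable_swap:
  assumes "h \<in> arrows" "tight h" "arity h = 3"
  shows "pluggable 0 (\<beta> h) f \<longleftrightarrow> pluggable 0 h f"
    "pluggable 1 (\<beta> h) f \<longleftrightarrow> pluggable 2 h f"
    "pluggable 2 (\<beta> h) f \<longleftrightarrow> pluggable 1 h f"
    "pluggable i g (\<beta> h) \<longleftrightarrow> pluggable i g h"
  using swap_simps[OF assms] assms by (auto simp: pluggable_def composable_def)

text \<open>Let \<open>\<theta>\<close> be universal for the inputs of \<open>q\<close> and \<open>\<phi>\<close> universal for the inputs of \<open>h\<close> once those of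
  \<open>q\<close> have been merged.  Then \<open>q\<close> is \<open>\<theta>\<close> followed by some unary \<open>p\<close>, and \<open>h \<circ>[0] p\<close> is \<open>\<phi>\<close> followed by
  some unary \<open>r\<close>.  As \<open>\<beta>\<close> commutes with \<open>p\<close> and \<open>r\<close>, both sides equal what the splitting into \<open>\<phi>\<close>
  and \<open>\<theta>\<close> gives.\<close>

lemma crossing_unique:
  assumes "pluggable 0 g h" "pluggable 0 h q" "tight g" "tight h" "arity h = 3"
    and "pluggable 0 g' h'" "pluggable 0 h' q'" "tight g'" "tight h'" "arity h' = 3"
    and "g \<circ>[0] (h \<circ>[0] q) = g' \<circ>[0] (h' \<circ>[0] q')" "arity q = arity q'"
  shows "g \<circ>[0] (\<beta> h \<circ>[0] q) = g' \<circ>[0] (\<beta> h' \<circ>[0] q')"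
proof -
  define f where "f = g \<circ>[0] (h \<circ>[0] q)"
  have f: "f \<in> arrows" "kind q = kind f" using assms(1-3,4) by (auto simp: f_def)
  have q: "q \<in> arrows" using pluggableD assms(2) by blast
  let ?as = "take (arity q) (ins f)"
  have "set ?as \<subseteq> objs C" using homs_objs[OF f(1)] by (auto dest: in_set_takeD)
  moreover have "?as \<noteq> []" if "kind f = Tight"
    using that f tight_arity[OF q] tight_arity[OF f(1)] by auto
  ultimately obtain \<theta> where \<theta>: "left_universal \<theta>" "kind \<theta> = kind f" "ins \<theta> = ?as"
    by (rule left_universal_exists)
  have \<theta>': "\<theta> \<in> arrows" using \<theta>(1) by (simp add: left_universal_def)
  define l where "l = [out \<theta>, ins f ! arity q, ins f ! Suc (arity q)]"
  have ins_f: "ins q' = ?as" "[out \<theta>, ins h ! 1, ins h ! 2] = l"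
    if a: "pluggable 0 g h" "pluggable 0 h q'" "tight g" "tight h" "arity h = 3"
      and i: "f = g \<circ>[0] (h \<circ>[0] q')" "arity q' = arity q" for g h q'
  proof -
    note D = pluggableD[OF a(1)] pluggableD[OF a(2)]
    have s: "pluggable 0 g (h \<circ>[0] q')" using a by simp
    have "take (arity q') (ins f) = take (arity q') (take (arity (h \<circ>[0] q')) (ins f))"
      using a by (simp add: min_def)
    also have "\<dots> = ins q'" using take_ins_subst[OF s] take_ins_subst[OF a(2)] i(1) by simp
    finally show "ins q' = ?as" using i by simp
    have "ins f ! arity q = ins h ! 1" "ins f ! Suc (arity q) = ins h ! 2"
      using ins_subst_nth[OF s] ins_subst_nth[OF a(2)] a D(3) i by (auto simp: numeral_2_eq_2)
    then show "[out \<theta>, ins h ! 1, ins h ! 2] = l" by (simp add: l_def)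
  qed
  have "arity h = 3" "h \<in> arrows" using assms pluggableD by blast+
  then have "set l \<subseteq> objs C"
    using ins_f(2)[OF assms(1-5) f_def HOL.refl] out_objs[OF \<theta>'] ins_objs[of h 1] ins_objs[of h 2] by auto
  moreover have "l \<noteq> []" by (simp add: l_def)
  ultimately obtain \<phi> where \<phi>: "left_universal \<phi>" "tight \<phi>" "ins \<phi> = l"
    using left_universal_exists[of l Tight] by blast
  have \<phi>': "\<phi> \<in> arrows" "arity \<phi> = 3" using \<phi> by (auto simp: left_universal_def l_def)
  have \<phi>\<theta>: "pluggable 0 \<phi> \<theta>"
    using \<phi>' \<theta>' \<phi>(3) by (simp add: pluggable_def composable_def l_def)
  have factor: "\<exists>G. pluggable 0 G \<phi> \<and> tight G \<and> f = (G \<circ>[0] \<phi>) \<circ>[0] \<theta> \<and>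
      g \<circ>[0] (\<beta> h \<circ>[0] q') = (G \<circ>[0] \<beta> \<phi>) \<circ>[0] \<theta>"
    if a: "pluggable 0 g h" "pluggable 0 h q'" "tight g" "tight h" "arity h = 3"
      and i: "f = g \<circ>[0] (h \<circ>[0] q')" "arity q' = arity q" for g h q'
  proof -
    note h = pluggableD(1)[OF a(2)] a(4,5)
    have ins_q': "ins q' = ins \<theta>" using ins_f(1)[OF a i] \<theta>(3) by (simp only:)
    have "kind f = kind q'" using a by (simp add: i(1))
    then have q': "q' \<in> arrows" "kind q' = kind \<theta>" "take (arity \<theta>) (ins q') = ins \<theta>"
      using pluggableD(2)[OF a(2)] \<theta>(2) ins_q' by auto
    obtain p where p: "pluggable 0 p \<theta>" "tight p" "q' = p \<circ>[0] \<theta>"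
      by (rule left_universal_factor[OF \<theta>(1) q'])
    have p1: "arity p = 1"
      using subst_facts(4)[OF p(1), folded p(3), unfolded ins_q'] pluggableD(3)[OF p(1)] by linarith
    have hp: "pluggable 0 h p" using a(2) p by simp
    let ?h = "h \<circ>[0] p"
    have h': "?h \<in> arrows" "kind ?h = kind \<phi>" "arity ?h = 3" using hp h p p1 \<phi> by auto
    have "ins ?h ! 0 = ins p ! 0" "ins ?h ! 1 = ins h ! 1" "ins ?h ! 2 = ins h ! 2"
      using ins_subst_nth[OF hp] h p1 by auto
    then have "ins ?h = [out \<theta>, ins h ! 1, ins h ! 2]"
      using h'(3) pluggableD(4)[OF p(1)]
      by (intro nth_equalityI) (auto simp: less_Suc_eq numeral_3_eq_3 numeral_2_eq_2)
    then have "ins ?h = ins \<phi>" using ins_f(2)[OF a i] \<phi>(3) by simp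
    then have "take (arity \<phi>) (ins ?h) = ins \<phi>" by simp
    from left_universal_factor[OF \<phi>(1) h'(1,2) this]
    obtain r where r: "pluggable 0 r \<phi>" "tight r" "?h = r \<circ>[0] \<phi>" .
    have r1: "arity r = 1"
      using subst_facts(4)[OF r(1), folded r(3)] pluggableD(3)[OF r(1)] h'(3) \<phi>'(2) by linarith
    have gr: "pluggable 0 g r"
      using a(1) pluggable_inner[OF r(1), of 0 g] pluggable_inner[OF hp, of 0 g] r(3) by simp
    have \<beta>h: "\<beta> ?h = \<beta> h \<circ>[0] p" "\<beta> ?h = r \<circ>[0] \<beta> \<phi>"
      using swap_pre[OF hp p(2) p1 h(2,3)] swap_post[OF r(1,2) r1 \<phi>(2) \<phi>'(2)] r(3) by simp_all
    have s\<beta>: "pluggable 0 (\<beta> h) p" "pluggable 0 r (\<beta> \<phi>)" "pluggable 0 (\<beta> \<phi>) \<theta>"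
      using hp r(1) \<phi>\<theta> h \<phi>' \<phi>(2) by (simp_all add: pluggable_swap)
    have "f = g \<circ>[0] (?h \<circ>[0] \<theta>)"
      using i(1) p(1,3) hp by (simp add: plug_plug_0)
    also have "\<dots> = ((g \<circ>[0] r) \<circ>[0] \<phi>) \<circ>[0] \<theta>"
      using r(1,3) gr \<phi>\<theta> \<phi>'(2) by (simp add: plug_plug_0 pluggable_outer)
    finally have 1: "f = ((g \<circ>[0] r) \<circ>[0] \<phi>) \<circ>[0] \<theta>" .
    have "g \<circ>[0] (\<beta> h \<circ>[0] q') = g \<circ>[0] ((\<beta> h \<circ>[0] p) \<circ>[0] \<theta>)"
      using p(1,3) s\<beta>(1) by (simp add: plug_plug_0)
    also have "\<beta> h \<circ>[0] p = r \<circ>[0] \<beta> \<phi>" using \<beta>h by simp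
    also have "g \<circ>[0] ((r \<circ>[0] \<beta> \<phi>) \<circ>[0] \<theta>) = ((g \<circ>[0] r) \<circ>[0] \<beta> \<phi>) \<circ>[0] \<theta>"
      using s\<beta> gr swap_simps(3)[OF \<phi>'(1) \<phi>(2) \<phi>'(2)]
      by (simp add: plug_plug_0 pluggable_outer)
    finally have 2: "g \<circ>[0] (\<beta> h \<circ>[0] q') = ((g \<circ>[0] r) \<circ>[0] \<beta> \<phi>) \<circ>[0] \<theta>" .
    have "pluggable 0 (g \<circ>[0] r) \<phi>"
      using gr r1 r(1) by (simp add: pluggable_outer)
    moreover have "tight (g \<circ>[0] r)" using gr a(3) r(2) by simp
    ultimately show ?thesis using 1 2 by blast
  qed
  obtain G where G: "pluggable 0 G \<phi>" "tight G" "f = (G \<circ>[0] \<phi>) \<circ>[0] \<theta>"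
    "g \<circ>[0] (\<beta> h \<circ>[0] q) = (G \<circ>[0] \<beta> \<phi>) \<circ>[0] \<theta>"
    using factor[OF assms(1-5) f_def HOL.refl] by (elim exE conjE)
  have f': "f = g' \<circ>[0] (h' \<circ>[0] q')" using assms(11) by (simp add: f_def)
  obtain G' where G': "pluggable 0 G' \<phi>" "tight G'" "f = (G' \<circ>[0] \<phi>) \<circ>[0] \<theta>"
    "g' \<circ>[0] (\<beta> h' \<circ>[0] q') = (G' \<circ>[0] \<beta> \<phi>) \<circ>[0] \<theta>"
    using factor[OF assms(6-10) f' assms(12)[symmetric]] by (elim exE conjE)
  have "G \<circ>[0] \<phi> = G' \<circ>[0] \<phi>"
  proof (rule left_universal_cancel[OF \<theta>(1)])
    show "(G \<circ>[0] \<phi>) \<circ>[0] \<theta> = (G' \<circ>[0] \<phi>) \<circ>[0] \<theta>"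
      using G(3) G'(3) by (rule HOL.trans[OF HOL.sym])
  qed (use G(1,2) G'(1,2) \<phi>(2) \<phi>\<theta> \<phi>' in \<open>simp_all add: pluggable_outer\<close>)
  then have "G = G'" by (rule left_universal_cancel[OF \<phi>(1) G(1) G'(1) G(2) G'(2)])
  then show ?thesis using G(4) G'(4) by simp
qed

lemma cross_sandwich:
  assumes "pluggable 0 g h" "pluggable 0 h q" "tight g" "tight h" "arity h = 3"
  shows "cross (arity q) (g \<circ>[0] (h \<circ>[0] q)) = g \<circ>[0] (\<beta> h \<circ>[0] q)"
  unfolding cross_def
proof (rule some_equality)
  show "\<exists>g' h' q'. pluggable 0 g' h' \<and> pluggable 0 h' q' \<and> tight g' \<and> tight h' \<and>
    arity h' = 3 \<and> arity q' = arity q \<and> g \<circ>[0] (h \<circ>[0] q) = g' \<circ>[0] (h' \<circ>[0] q') \<and>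
    g \<circ>[0] (\<beta> h \<circ>[0] q) = g' \<circ>[0] (\<beta> h' \<circ>[0] q')"
    using assms by blast
next
  fix f' assume "\<exists>g' h' q'. pluggable 0 g' h' \<and> pluggable 0 h' q' \<and> tight g' \<and> tight h' \<and>
    arity h' = 3 \<and> arity q' = arity q \<and> g \<circ>[0] (h \<circ>[0] q) = g' \<circ>[0] (h' \<circ>[0] q') \<and>
    f' = g' \<circ>[0] (\<beta> h' \<circ>[0] q')"
  then obtain g' h' q' where *: "pluggable 0 g' h'" "pluggable 0 h' q'" "tight g'" "tight h'"
    "arity h' = 3" "arity q' = arity q" "g \<circ>[0] (h \<circ>[0] q) = g' \<circ>[0] (h' \<circ>[0] q')"
    "f' = g' \<circ>[0] (\<beta> h' \<circ>[0] q')"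
    by (elim exE conjE)
  then show "f' = g \<circ>[0] (\<beta> h \<circ>[0] q)"
    using crossing_unique[OF assms *(1-5,7) *(6)[symmetric]] by simp
qed

lemma sandwich_decomposition:
  assumes "f \<in> arrows" "k + m \<le> arity f" "tight f \<Longrightarrow> 0 < k"
  obtains g h q where "pluggable 0 g h" "pluggable 0 h q" "tight g" "tight h" "kind q = kind f"
    "arity h = Suc m" "arity q = k" "f = g \<circ>[0] (h \<circ>[0] q)" "arity f = arity g + (k + m) - 1"
proof -
  have pos: "0 < k + m" if "tight f" using assms(3) that by simp
  obtain g x where g: "pluggable 0 g x" "tight g" "kind x = kind f" "arity x = k + m"
    "f = g \<circ>[0] x" "arity f = arity g + (k + m) - 1"
    by (rule left_factor[OF assms(1,2) pos])
  have x: "x \<in> arrows" "k \<le> arity x" using pluggableD(2)[OF g(1)] g(4) by simp_all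
  have pos: "0 < k" if "tight x" using assms(3) that g(3) by simp
  obtain h q where h: "pluggable 0 h q" "tight h" "kind q = kind x" "arity q = k"
    "x = h \<circ>[0] q" "arity x = arity h + k - 1"
    by (rule left_factor[OF x pos])
  have "arity h = Suc m" using h(6) g(4) pluggableD(3)[OF h(1)] by linarith
  moreover have "pluggable 0 g h" using g(1) h(1) unfolding h(5) by simp
  ultimately show ?thesis
    using that[of g h q] g(2,6) h(1-4) HOL.trans[OF h(3) g(3)] g(5)[unfolded h(5)] by blast
qed

text \<open>A splitting of \<open>f\<close> that isolates the inputs \<open>k\<close> and \<open>k + 1\<close> as the last two inputs of \<open>h\<close>.\<close>

definition crossing :: "nat \<Rightarrow> ('o, 'm) mmap \<Rightarrow> ('o, 'm) mmap \<Rightarrow> ('o, 'm) mmap \<Rightarrow> ('o, 'm) mmap \<Rightarrow> bool" where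
  "crossing k f g h q \<longleftrightarrow> pluggable 0 g h \<and> pluggable 0 h q \<and> tight g \<and> tight h \<and>
    kind q = kind f \<and> arity h = 3 \<and> arity q = k \<and> f = g \<circ>[0] (h \<circ>[0] q)"

lemma crossingD:
  assumes "crossing k f g h q"
  shows "pluggable 0 g h" "pluggable 0 h q" "tight g" "tight h" "kind q = kind f"
    "arity h = 3" "arity q = k" "f = g \<circ>[0] (h \<circ>[0] q)" "cross k f = g \<circ>[0] (\<beta> h \<circ>[0] q)"
  using assms cross_sandwich[of g h q] unfolding crossing_def by blast+

lemma crossable_decomposition:
  assumes "crossable k f"
  obtains g h q where "crossing k f g h q"
proof -
  have f: "f \<in> arrows" "k + 2 \<le> arity f" using assms by (auto simp: crossable_def)
  have pos: "0 < k" if "tight f" using assms that by (auto simp: crossable_def)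
  obtain g h q where *: "pluggable 0 g h" "pluggable 0 h q" "tight g" "tight h" "kind q = kind f"
    "arity h = Suc 2" "arity q = k" "f = g \<circ>[0] (h \<circ>[0] q)" "arity f = arity g + (k + 2) - 1"
    by (rule sandwich_decomposition[OF f pos])
  have "arity h = 3" using *(6) by simp
  with * show ?thesis by (intro that) (unfold crossing_def, blast)
qed

lemma cross_ternary:
  assumes "h \<in> arrows" "tight h" "arity h = 3"
  shows "cross 1 h = \<beta> h"
proof -
  have o: "out h \<in> objs C" "ins h ! 0 \<in> objs C" using assms ins_objs[of h 0] out_objs by auto
  note i = ident_simps[OF o(1)] ident_simps[OF o(2)]
  have s: "pluggable 0 (ident C (out h)) h" "pluggable 0 h (ident C (ins h ! 0))"
    using assms i by (auto simp: pluggable_def composable_def)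
  have t: "tight (ident C (out h))" "arity (ident C (ins h ! 0)) = 1" using i by (auto simp: unaries_iff)
  have "ident C (out h) \<circ>[0] h \<circ>[0] ident C (ins h ! 0) = h"
    using assms subst_ident[of h 0] ident_subst[of h] by simp
  moreover have "ident C (out h) \<circ>[0] \<beta> h \<circ>[0] ident C (ins h ! 0) = \<beta> h"
    using swap_simps[OF assms] subst_ident[of "\<beta> h" 0] ident_subst[of "\<beta> h"] by simp
  ultimately show ?thesis
    using cross_sandwich[OF s t(1) assms(2,3)] t(2) by simp
qed

lemma cross_simps:
  assumes "crossable k f"
  shows "cross k f \<in> arrows" "kind (cross k f) = kind f" "out (cross k f) = out f"
    "ins (cross k f) = permute_list (transpose k (Suc k)) (ins f)"
    "arity (cross k f) = arity f"
proof -
  obtain g h q where "crossing k f g h q"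
    by (rule crossable_decomposition[OF assms])
  note d = crossingD[OF this]
  have h: "h \<in> arrows" using pluggableD d by blast
  note \<beta> = swap_simps[OF h d(4,6)]
  have s: "pluggable 0 g (\<beta> h)" "pluggable 0 (\<beta> h) q"
    using d(1,2,4,6) h by (simp_all add: pluggable_swap)
  have s': "pluggable 0 g (h \<circ>[0] q)" "pluggable 0 g (\<beta> h \<circ>[0] q)" using d(1,2) s by simp_all
  have len: "arity (h \<circ>[0] q) = k + 2" "arity (\<beta> h \<circ>[0] q) = k + 2" using d(2,6,7) s \<beta> by simp_all
  have arf: "arity f = arity g + (k + 2) - 1" unfolding d(8) using s'(1) len by simp
  show ar: "arity (cross k f) = arity f" unfolding arf d(9) using s'(2) len by simp
  show "cross k f \<in> arrows" unfolding d(9) using s'(2) by simp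
  show "kind (cross k f) = kind f" unfolding d(9) d(5)[symmetric] using s'(2) s d(3) \<beta> by simp
  show "out (cross k f) = out f" unfolding d(9) unfolding d(8) using s' by simp
  have k: "Suc k < arity f" using assms by (simp add: crossable_def)
  have g0: "0 < arity g" using pluggableD(3)[OF d(1)] .
  show "ins (cross k f) = permute_list (transpose k (Suc k)) (ins f)"
  proof (rule nth_equalityI)
    show "arity (cross k f) = length (permute_list (transpose k (Suc k)) (ins f))" using ar by simp
    fix j assume j: "j < arity (cross k f)"
    have c: "ins (g \<circ>[0] (h' \<circ>[0] q)) ! j = (if j < k then ins q ! j else if j = k then ins h' ! 1
        else if j = Suc k then ins h' ! 2 else ins g ! (j + 1 - (k + 2)))"
      if "pluggable 0 g (h' \<circ>[0] q)" "pluggable 0 h' q" "arity h' = 3" "j < arity f" for h' j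
    proof -
      have a: "arity (h' \<circ>[0] q) = k + 2" using that d(7) by simp
      have "j < arity g + (k + 2) - 1" using that(4) arf by simp
      then have X: "ins (g \<circ>[0] (h' \<circ>[0] q)) ! j =
          (if j < k + 2 then ins (h' \<circ>[0] q) ! j else ins g ! (j + 1 - (k + 2)))"
        using ins_subst_nth[OF that(1), of j] unfolding a by simp
      consider "j < k" | "j = k" | "j = Suc k" | "k + 2 \<le> j" by linarith
      then have "(if j < k + 2 then ins (h' \<circ>[0] q) ! j else X) = (if j < k then ins q ! j
          else if j = k then ins h' ! 1 else if j = Suc k then ins h' ! 2 else X)" for X
        using that(3) d(7) by cases (auto simp: ins_subst_nth[OF that(2)] numeral_2_eq_2)
      from this[of "ins g ! (j + 1 - (k + 2))"] X show ?thesis by (rule HOL.trans[rotated])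
    qed
    note c1 = c[OF s'(1) d(2,6), folded d(8)] and c2 = c[OF s'(2) s(2) \<beta>(3), folded d(9)]
    show "ins (cross k f) ! j = permute_list (transpose k (Suc k)) (ins f) ! j"
      using j k permute_list_transpose_nth[of k "ins f" j] c1[of k] c1[of "Suc k"] c1[of j] c2[of j]
      unfolding ar \<beta>(6,7) by simp
  qed
qed

lemma crossable_subst:
  assumes "pluggable j g f" "j < k" "crossable k g"
  shows "crossable (k + arity f - 1) (g \<circ>[j] f)"
proof -
  have "0 < k + arity f - 1" if "tight (g \<circ>[j] f)"
  proof (cases "j = 0")
    case True
    then have "tight f" using that assms(1) by (cases "kind g") auto
    then have "0 < arity f" by (rule tight_arity[OF pluggableD(2)[OF assms(1)]])
    then show ?thesis using assms(2) by linarith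
  qed (use assms(2) in simp)
  then show ?thesis
    using assms by (auto simp: crossable_def)
qed

lemma crossable_outer:
  assumes "pluggable j g f" "Suc k < j" "crossable k g"
  shows "crossable k (g \<circ>[j] f)"
  using assms pluggableD(3)[OF assms(1)] by (cases "kind g") (auto simp: crossable_def)

lemma crossable_inner:
  assumes "pluggable j g f" "crossable k f"
  shows "crossable (j + k) (g \<circ>[j] f)"
proof -
  have "0 < j + k" if "tight (g \<circ>[j] f)"
  proof (cases "j = 0")
    case True
    then have "tight f" using that assms(1) by (cases "kind g") auto
    then show ?thesis using assms(2) by (simp add: crossable_def)
  qed simp
  then show ?thesis
    using assms pluggableD(3)[OF assms(1)] by (auto simp: crossable_def)
qed

lemma pluggable_cross:
  assumes "crossable k g"
  shows "j \<noteq> k \<Longrightarrow> j \<noteq> Suc k \<Longrightarrow> pluggable j (cross k g) f \<longleftrightarrow> pluggable j g f"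
    "pluggable k (cross k g) f \<longleftrightarrow> pluggable (Suc k) g f"
    "pluggable (Suc k) (cross k g) f \<longleftrightarrow> pluggable k g f"
    "pluggable i h (cross k g) \<longleftrightarrow> pluggable i h g"
proof -
  note c = cross_simps[OF assms]
  have k: "Suc k < arity g" "g \<in> arrows" using assms by (auto simp: crossable_def)
  note n = permute_list_transpose_nth[OF k(1)]
  show "j \<noteq> k \<Longrightarrow> j \<noteq> Suc k \<Longrightarrow> pluggable j (cross k g) f \<longleftrightarrow> pluggable j g f"
    unfolding pluggable_def composable_def c(5) using n[of j, folded c(4)] k c(1) by auto
  show "pluggable k (cross k g) f \<longleftrightarrow> pluggable (Suc k) g f"
    "pluggable (Suc k) (cross k g) f \<longleftrightarrow> pluggable k g f"
    unfolding pluggable_def composable_def c(5)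
    using n[of k, folded c(4)] n[of "Suc k", folded c(4)] k c(1) by auto
  show "pluggable i h (cross k g) \<longleftrightarrow> pluggable i h g"
    unfolding pluggable_def composable_def c(3) using k c(1) by auto
qed

text \<open>The splitting of \<open>f\<close> is also one of \<open>g \<circ>[0] f\<close>, with \<open>g\<close> absorbed into its outer factor; in
  \<open>cross_pre\<close> it is the innermost factor that absorbs \<open>q\<close>.\<close>

lemma cross_post:
  assumes "pluggable 0 g f" "tight g" "crossable k f"
  shows "cross k (g \<circ>[0] f) = g \<circ>[0] cross k f"
proof -
  obtain G h q where "crossing k f G h q"
    by (rule crossable_decomposition[OF assms(3)])
  note d = crossingD[OF this]
  have h: "h \<in> arrows" using pluggableD d by blast
  have s: "pluggable 0 g G" using assms(1) d(1,2) unfolding d(8) by simp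
  have s': "pluggable 0 (g \<circ>[0] G) h" "pluggable 0 G (\<beta> h)" "pluggable 0 (\<beta> h) q"
    using s d pluggableD(3)[OF d(1)] h by (auto simp: pluggable_outer pluggable_swap)
  have "g \<circ>[0] f = (g \<circ>[0] G) \<circ>[0] (h \<circ>[0] q)"
    unfolding d(8) using s d(1,2) by (simp add: plug_plug_0)
  moreover have "tight (g \<circ>[0] G)" using s d(3) assms(2) by simp
  ultimately have "cross k (g \<circ>[0] f) = (g \<circ>[0] G) \<circ>[0] (\<beta> h \<circ>[0] q)"
    using cross_sandwich[OF s'(1) d(2) _ d(4,6)] d(7) by simp
  also have "\<dots> = g \<circ>[0] cross k f"
    unfolding d(9) using s s' by (simp add: plug_plug_0)
  finally show ?thesis .
qed

lemma cross_pre: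
  assumes "pluggable 0 g q" "tight g" "crossable k g" "j = k + arity q - 1"
  shows "cross j (g \<circ>[0] q) = cross k g \<circ>[0] q"
proof -
  obtain G h e where "crossing k g G h e"
    by (rule crossable_decomposition[OF assms(3)])
  note d = crossingD[OF this]
  have h: "h \<in> arrows" using pluggableD d by blast
  have k: "0 < k" using assms(2,3) by (simp add: crossable_def)
  have s: "pluggable 0 e q"
    using assms(1) d(1,2,6,7) k unfolding d(8) by (simp add: pluggable_outer)
  have s': "pluggable 0 G (\<beta> h)" "pluggable 0 (\<beta> h) e"
    using d h by (auto simp: pluggable_swap)
  note a = swap_simps(3)[OF h d(4,6)]
  have "g \<circ>[0] q = G \<circ>[0] (h \<circ>[0] (e \<circ>[0] q))"
    unfolding d(8) using d(1,2,6,7) s k by (simp add: plug_plug_0 pluggable_outer)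
  moreover have "arity (e \<circ>[0] q) = j" using s d(7) assms(4) by simp
  moreover have "pluggable 0 h (e \<circ>[0] q)" using s d(2) by simp
  ultimately have "cross j (g \<circ>[0] q) = G \<circ>[0] (\<beta> h \<circ>[0] (e \<circ>[0] q))"
    using cross_sandwich[OF d(1) _ d(3,4,6)] by metis
  also have "\<dots> = cross k g \<circ>[0] q"
    unfolding d(9) using d(7) s s' k a by (simp add: plug_plug_0 pluggable_outer)
  finally show ?thesis .
qed

text \<open>Splitting \<open>g\<close> just behind the crossed inputs puts the crossing into the inner factor and the
  substitution into the outer one.\<close>

lemma cross_subst_after:
  assumes "pluggable j g f" "crossable k g" "Suc k < j"
  shows "cross k (g \<circ>[j] f) = cross k g \<circ>[j] f"
proof -
  have g: "g \<in> arrows" "k + 2 \<le> arity g" using assms(2) by (auto simp: crossable_def)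
  have pos: "0 < k + 2" by simp
  obtain g' q where d: "pluggable 0 g' q" "tight g'" "kind q = kind g" "arity q = k + 2"
    "g = g' \<circ>[0] q" "arity g = arity g' + (k + 2) - 1"
    by (rule left_factor[OF g pos])
  define i where "i = j - k - 1"
  have i: "0 < i" "j = i + arity q - 1" using assms(3) d(4) by (auto simp: i_def)
  have s: "pluggable i g' f"
    using assms(1) pluggable_after[OF d(1) i] unfolding d(5) by simp
  have q: "crossable k q" using assms(2) d(3,4) pluggableD(2)[OF d(1)] by (auto simp: crossable_def)
  note c = pluggable_cross(4)[OF q] cross_simps(5)[OF q]
  have "g \<circ>[j] f = (g' \<circ>[i] f) \<circ>[0] q"
    unfolding d(5) using d(1) s i by (rule plug_swap)
  moreover have "pluggable 0 (g' \<circ>[i] f) q"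
    using s d(1) i by (simp add: pluggable_outer)
  moreover have "tight (g' \<circ>[i] f)" using s i d(2) by simp
  ultimately have "cross k (g \<circ>[j] f) = (g' \<circ>[i] f) \<circ>[0] cross k q"
    using cross_post q by simp
  also have "\<dots> = (g' \<circ>[0] cross k q) \<circ>[j] f"
    using d(1) s i by (intro plug_swap[symmetric]) (auto simp: c)
  also have "g' \<circ>[0] cross k q = cross k g"
    unfolding d(5) using cross_post[OF d(1,2) q] by simp
  finally show ?thesis .
qed

text \<open>Splitting \<open>g\<close> just before the crossed inputs puts the crossing into the outer factor and the
  substitution into the inner one.\<close>

lemma cross_subst_before:
  assumes "pluggable j g f" "crossable k g" "j < k" "i = k + arity f - 1"
  shows "cross i (g \<circ>[j] f) = cross k g \<circ>[j] f"
proof -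
  have g: "g \<in> arrows" "k \<le> arity g" "k + 1 < arity g" using assms(2) by (auto simp: crossable_def)
  have pos: "0 < k" using assms(3) by simp
  obtain g' q where d: "pluggable 0 g' q" "tight g'" "kind q = kind g" "arity q = k"
    "g = g' \<circ>[0] q" "arity g = arity g' + k - 1"
    by (rule left_factor[OF g(1,2) pos])
  have g': "crossable 1 g'" using d(6) g(3) pluggableD(1)[OF d(1)] by (auto simp: crossable_def)
  have s: "pluggable j q f"
    using assms(1,3) d(1,4) unfolding d(5) by (simp add: pluggable_outer)
  have s': "pluggable 0 (cross 1 g') q"
    using d(1) pluggable_cross(1)[OF g', of 0] by simp
  have "g \<circ>[j] f = g' \<circ>[0] (q \<circ>[j] f)"
    unfolding d(5) using d(1) s by (rule plug_plug_0)
  moreover have "i = 1 + arity (q \<circ>[j] f) - 1" using s d(4) assms(3,4) by simp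
  moreover have "pluggable 0 g' (q \<circ>[j] f)" using s d(1) by simp
  ultimately have "cross i (g \<circ>[j] f) = cross 1 g' \<circ>[0] (q \<circ>[j] f)"
    using cross_pre[OF _ d(2) g'] by metis
  also have "\<dots> = (cross 1 g' \<circ>[0] q) \<circ>[j] f"
    using s' s by (rule plug_plug_0[symmetric])
  also have "cross 1 g' \<circ>[0] q = cross k g"
    unfolding d(5) using cross_pre[OF d(1,2) g', of k] d(4) by simp
  finally show ?thesis .
qed

lemma cross_loosen:
  assumes "crossable k f" "tight f"
  shows "cross k (loosen C f) = loosen C (cross k f)"
proof -
  obtain G h q where "crossing k f G h q"
    by (rule crossable_decomposition[OF assms(1)])
  note d = crossingD[OF this]
  have h: "h \<in> arrows" "q \<in> arrows" using pluggableD d by blast+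
  have q: "tight q" using d(5) assms(2) by simp
  have l: "g \<circ>[0] loosen C x = loosen C (g \<circ>[0] x)" if "pluggable 0 g x" "tight g" "tight x" for g x
    using subst_loosen[of g x 0] that by (simp add: loosen_to_def pluggable_def)
  have s: "pluggable 0 h (loosen C q)"
    using d(2) h q by (simp add: pluggable_def composable_def)
  have s\<beta>: "pluggable 0 G (\<beta> h)" "pluggable 0 (\<beta> h) q" "tight (\<beta> h)"
    using d(1,2,4,6) h swap_simps[OF h(1) d(4,6)] by (auto simp: pluggable_swap)
  have "loosen C f = G \<circ>[0] (h \<circ>[0] loosen C q)"
    unfolding d(8) using d(1-4) q by (simp add: l)
  moreover have "arity (loosen C q) = k" using h q d(7) by simp
  ultimately have "cross k (loosen C f) = G \<circ>[0] (\<beta> h \<circ>[0] loosen C q)"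
    using cross_sandwich[OF d(1) s d(3,4,6)] by simp
  also have "\<dots> = loosen C (cross k f)"
    unfolding d(9) using s\<beta> q d(3) by (simp add: l)
  finally show ?thesis .
qed

lemma crossable_cross [simp]: "crossable i f \<Longrightarrow> crossable k (cross i f) \<longleftrightarrow> crossable k f"
  using cross_simps[of i f] by (auto simp: crossable_def)

lemma cross_far:
  assumes "crossable i f" "crossable k f" "Suc i < k"
  shows "cross k (cross i f) = cross i (cross k f)"
proof -
  have g: "f \<in> arrows" "i + 2 \<le> arity f" using assms(1) by (auto simp: crossable_def)
  have pos: "0 < i + 2" by simp
  obtain g q where d: "pluggable 0 g q" "tight g" "kind q = kind f" "arity q = i + 2"
    "f = g \<circ>[0] q" "arity f = arity g + (i + 2) - 1"
    by (rule left_factor[OF g pos])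
  define k' where "k' = k - i - 1"
  have k': "crossable k' g" "k = k' + arity q - 1"
    using assms(2,3) d(4,6) pluggableD(1)[OF d(1)] by (auto simp: crossable_def k'_def)
  have q: "crossable i q" using assms(1) d(3,4) pluggableD(2)[OF d(1)] by (auto simp: crossable_def)
  note c = pluggable_cross(4)[OF q] cross_simps(2,5)[OF q]
  have "0 < k'" using k'(1) d(2) by (simp add: crossable_def)
  then have s: "pluggable 0 (cross k' g) q"
    using pluggable_cross(1)[OF k'(1), of 0] d(1) by simp
  have "cross i f = g \<circ>[0] cross i q" unfolding d(5) by (rule cross_post[OF d(1,2) q])
  then have "cross k (cross i f) = cross k' g \<circ>[0] cross i q"
    using cross_pre[OF _ d(2) k'(1), of "cross i q" k] d(1) k'(2) c by simp
  moreover have "cross k f = cross k' g \<circ>[0] q"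
    unfolding d(5) by (rule cross_pre[OF d(1,2) k'])
  then have "cross i (cross k f) = cross k' g \<circ>[0] cross i q"
    using cross_post[OF s _ q] cross_simps(2)[OF k'(1)] d(2) by simp
  ultimately show ?thesis by simp
qed

text \<open>The next two lemmas move operations on a multimap into the factor \<open>h\<close> of a splitting.  This
  reduces laws about arbitrary positions to laws about a tight \<open>h\<close> of arity 3 or 4.\<close>

lemma sandwich_subst:
  assumes "pluggable 0 g h" "pluggable 0 h q" "pluggable i h f" "0 < i"
    "j = i + arity q - 1"
  shows "(g \<circ>[0] (h \<circ>[0] q)) \<circ>[j] f = g \<circ>[0] ((h \<circ>[i] f) \<circ>[0] q)"
    "pluggable 0 g (h \<circ>[i] f)" "pluggable 0 (h \<circ>[i] f) q"
proof -
  show "pluggable 0 g (h \<circ>[i] f)" using assms by simp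
  show "pluggable 0 (h \<circ>[i] f) q" using assms by (simp add: pluggable_outer)
  have s: "pluggable j (h \<circ>[0] q) f"
    using assms(3) pluggable_after[OF assms(2,4,5)] by simp
  have "(g \<circ>[0] (h \<circ>[0] q)) \<circ>[j] f = g \<circ>[0] ((h \<circ>[0] q) \<circ>[j] f)"
    using assms(1,2) s by (intro plug_plug_0) simp_all
  also have "(h \<circ>[0] q) \<circ>[j] f = (h \<circ>[i] f) \<circ>[0] q"
    using assms by (intro plug_swap) auto
  finally show "(g \<circ>[0] (h \<circ>[0] q)) \<circ>[j] f = g \<circ>[0] ((h \<circ>[i] f) \<circ>[0] q)" .
qed

lemma sandwich_cross:
  assumes "pluggable 0 g h" "pluggable 0 h q" "crossable i h" "tight h" "tight g"
    "j = i + arity q - 1"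
  shows "cross j (g \<circ>[0] (h \<circ>[0] q)) = g \<circ>[0] (cross i h \<circ>[0] q)"
    "pluggable 0 g (cross i h)" "pluggable 0 (cross i h) q"
proof -
  have i: "0 < i" using assms(3,4) by (simp add: crossable_def)
  show "pluggable 0 g (cross i h)" "pluggable 0 (cross i h) q"
    using assms(1,2) i pluggable_cross(1,4)[OF assms(3), of 0] by auto
  have "crossable j (h \<circ>[0] q)"
    unfolding assms(6) using assms(2) i assms(3) by (intro crossable_subst) auto
  then have "cross j (g \<circ>[0] (h \<circ>[0] q)) = g \<circ>[0] cross j (h \<circ>[0] q)"
    using assms by (intro cross_post) auto
  also have "cross j (h \<circ>[0] q) = cross i h \<circ>[0] q"
    using assms by (intro cross_pre) auto
  finally show "cross j (g \<circ>[0] (h \<circ>[0] q)) = g \<circ>[0] (cross i h \<circ>[0] q)" .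
qed

end

section \<open>Substituting into a crossed input\<close>

text \<open>These laws are collected separately because the inverse of a braided swap satisfies them too.\<close>

locale hexagonal_swap = natural_swap C \<beta>
  for C :: "('o, 'm) skew_multicat" and \<beta> :: "('o, 'm) mmap \<Rightarrow> ('o, 'm) mmap" +
  assumes swap_inj: "\<lbrakk>\<beta> h = \<beta> h'; h \<in> arrows; tight h; arity h = 3; h' \<in> arrows; tight h'; arity h' = 3\<rbrakk> \<Longrightarrow>
      h = h'"
    and swap_pre_1: "\<lbrakk>pluggable 1 h p; tight p; arity p = 1; tight h; arity h = 3\<rbrakk> \<Longrightarrow>
      \<beta> (h \<circ>[1] p) = \<beta> h \<circ>[2] p"
    and hexagon_1: "\<lbrakk>pluggable 1 g f; tight g; arity g = 3; tight f; arity f = 2\<rbrakk> \<Longrightarrow>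
      cross 1 (cross 2 (g \<circ>[1] f)) = \<beta> g \<circ>[2] f"
begin

text \<open>By naturality \<open>v\<close> may be taken to be the unit \<open>u\<close>.  Apply the hexagon to \<open>G = T \<circ>[1] l\<close>, where \<open>l\<close>
  is the multimap of \<open>unit_exists\<close>, and substitute \<open>u\<close> into the second input of \<open>l\<close>: since \<open>\<beta>\<close> is
  injective, the crossing of this input with the last one can be dropped.  Substituting \<open>u\<close> also
  into the first input of \<open>l\<close>, where it makes \<open>l\<close> an identity, leaves the claim.\<close>

lemma swap_nullary:
  assumes T: "T \<in> arrows" "tight T" "arity T = 3" and v: "arity v = 0" and s: "pluggable 1 T v"
  shows "\<beta> T \<circ>[2] v = T \<circ>[1] v"
proof -
  obtain u l where u: "left_universal u" "kind u = Loose" "arity u = 0"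
    and l: "pluggable 0 l u" "tight l" "arity l = 2" "pluggable 1 l u" "out l = out u"
      "l \<circ>[0] u = loosen C (ident C (out u))"
    by (rule unit_exists)
  have la: "l \<in> arrows" "u \<in> arrows" using pluggableD[OF l(1)] by auto
  let ?r = "l \<circ>[1] u"
  have r: "tight ?r" "arity ?r = 1" using l(2-4) u(3) by simp_all
  have Tl: "pluggable i T' l \<longleftrightarrow> pluggable i T' u" for i T'
    using l(5) la by (simp add: pluggable_def composable_def)
  have lid: "T' \<circ>[i] (l \<circ>[0] u) = T'" if "pluggable i T' u" "tight T'" "0 < i" for i T'
    unfolding l(6) using subst_loosen_ident[of T' i] that pluggableD[OF that(1)] by simp
  have unit_1: "\<beta> T \<circ>[2] u = T \<circ>[1] u"
    if T: "T \<in> arrows" "tight T" "arity T = 3" and s: "pluggable 1 T u" for T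
  proof -
    let ?G = "T \<circ>[1] l"
    have sl: "pluggable 1 T l" using s Tl by simp
    have bs: "pluggable 2 (\<beta> T) l" using sl by (simp add: pluggable_swap[OF T])
    have G: "?G \<in> arrows" "tight ?G" "arity ?G = 4" using sl T l(2,3) by simp_all
    have c: "crossable 1 ?G" "crossable 2 ?G" using G by (simp_all add: crossable_def)
    let ?G' = "cross 2 ?G"
    have G': "?G' \<in> arrows" "tight ?G'" "arity ?G' = 4" using cross_simps[OF c(2)] G by simp_all
    have s1: "pluggable 1 ?G u" using sl l(1,3) by (simp add: pluggable_outer)
    have s2: "pluggable 2 ?G u" using sl l(3,4) by (simp add: pluggable_outer)
    have s1': "pluggable 1 ?G' u" using s1 pluggable_cross(1)[OF c(2), of 1] by simp
    have s3: "pluggable 3 ?G' u" using s2 pluggable_cross(3)[OF c(2)] by (simp add: numeral_3_eq_3 numeral_2_eq_2)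
    let ?X = "?G' \<circ>[3] u"
    have X: "?X \<in> arrows" "tight ?X" "arity ?X = 3" using s3 G' u(3) by simp_all
    have Gu: "?G \<circ>[2] u = T \<circ>[1] ?r" using plug_plug[OF sl l(4)] by (simp add: numeral_2_eq_2)
    have tr: "pluggable 1 T ?r" using sl l(4) by simp
    have Gu': "?G \<circ>[2] u \<in> arrows" "tight (?G \<circ>[2] u)" "arity (?G \<circ>[2] u) = 3"
      using s2 G u(3) by simp_all
    \<comment> \<open>the hexagon, with \<open>u\<close> in the second input of \<open>l\<close>\<close>
    have "\<beta> ?X = cross 1 ?G' \<circ>[3] u"
      using cross_subst_after[OF s3, of 1] c cross_ternary[OF X] by simp
    also have "\<dots> = (\<beta> T \<circ>[2] l) \<circ>[2 + 1] u"
      using hexagon_1[OF sl T(2,3) l(2,3)] by simp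
    also have "\<dots> = \<beta> T \<circ>[2] ?r" using bs l(4) by (rule plug_plug)
    also have "\<dots> = \<beta> (T \<circ>[1] ?r)" using swap_pre_1[OF tr r T(2,3)] by simp
    finally have "\<beta> ?X = \<beta> (?G \<circ>[2] u)" unfolding Gu .
    then have X2: "?X = ?G \<circ>[2] u" using X Gu' by (rule swap_inj)
    \<comment> \<open>now \<open>u\<close> in the first input of \<open>l\<close> as well\<close>
    have G1: "?G \<circ>[1] u = T" using plug_0_plug[OF sl l(1)] lid[OF s T(2)] by simp
    have "?G' \<circ>[1] u = cross 1 (?G \<circ>[1] u)"
      using u(3) by (intro cross_subst_before[symmetric, OF s1 c(2)]) simp_all
    then have G1': "?G' \<circ>[1] u = \<beta> T" unfolding G1 using cross_ternary[OF T] by simp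
    have "\<beta> T \<circ>[2] u = ?X \<circ>[1] u"
      unfolding G1'[symmetric] using u(3) by (intro plug_swap[OF s1' s3]) simp_all
    also have "\<dots> = (?G \<circ>[1] u) \<circ>[1] u"
      unfolding X2 using u(3) by (intro plug_swap[symmetric, OF s1 s2]) simp_all
    finally show ?thesis unfolding G1 .
  qed
  have v': "v \<in> arrows" using pluggableD[OF s] by simp
  have k: "kind v = kind u" using tight_arity[OF v'] v u(2) by (cases "kind v") auto
  have t: "take (arity u) (ins v) = ins u" using u(3) by simp
  obtain p where p: "pluggable 0 p u" "tight p" "v = p \<circ>[0] u"
    by (rule left_universal_factor[OF u(1) v' k t])
  have p1: "arity p = 1"
    using subst_facts(4)[OF p(1), folded p(3)] v u(3) pluggableD(3)[OF p(1)] by linarith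
  have sp: "pluggable 1 T p" using s p(1) unfolding p(3) by simp
  have Tp: "T \<circ>[1] p \<in> arrows" "tight (T \<circ>[1] p)" "arity (T \<circ>[1] p) = 3"
    using sp T p p1 by simp_all
  have b: "pluggable 2 (\<beta> T) p" using sp by (simp add: pluggable_swap[OF T])
  have su: "pluggable 1 (T \<circ>[1] p) u" using sp p1 p(1) by (simp add: pluggable_outer)
  have "\<beta> T \<circ>[2] v = (\<beta> T \<circ>[2] p) \<circ>[2] u" unfolding p(3) by (rule plug_0_plug[symmetric, OF b p(1)])
  also have "\<dots> = (T \<circ>[1] p) \<circ>[1] u"
    using swap_pre_1[OF sp p(2) p1 T(2,3)] unit_1[OF Tp su] by simp
  also have "\<dots> = T \<circ>[1] v" unfolding p(3) by (rule plug_0_plug[OF sp p(1)])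
  finally show ?thesis .
qed

text \<open>A common splitting for \<open>cross k g\<close> and for every substitution into the input \<open>k\<close> of \<open>g\<close>.\<close>

lemma crossable_sandwich:
  assumes "crossable k g"
  obtains g3 g2 g1 where "tight g3" "tight g2" "arity g2 = 3" "arity g1 = k" "kind g1 = kind g"
    "\<And>f. pluggable k g f \<Longrightarrow> pluggable 1 g2 f \<and> pluggable 0 g3 (g2 \<circ>[1] f) \<and>
      pluggable 0 (g2 \<circ>[1] f) g1 \<and> g \<circ>[k] f = g3 \<circ>[0] ((g2 \<circ>[1] f) \<circ>[0] g1) \<and>
      cross k g \<circ>[Suc k] f = g3 \<circ>[0] ((\<beta> g2 \<circ>[2] f) \<circ>[0] g1)"
proof -
  obtain g3 g2 g1 where "crossing k g g3 g2 g1"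
    by (rule crossable_decomposition[OF assms])
  note d = crossingD[OF this]
  note h = pluggableD(1)[OF d(2)] d(4,6)
  note \<beta> = swap_simps[OF h]
  have db: "pluggable 0 g3 (\<beta> g2)" "pluggable 0 (\<beta> g2) g1"
    using d(1,2) by (simp_all add: pluggable_swap[OF h])
  have k: "k = 1 + arity g1 - 1" "Suc k = 2 + arity g1 - 1" using d(7) by simp_all
  have s0: "pluggable j g f \<longleftrightarrow> pluggable j (g2 \<circ>[0] g1) f" if "j < k + 2" for j f
    unfolding d(8) using that d(1,2,6,7) by (simp add: pluggable_outer)
  have s1: "pluggable k g f \<longleftrightarrow> pluggable 1 g2 f" for f
    using s0[of k f] pluggable_after[OF d(2) _ k(1)] by simp
  show ?thesis
  proof (rule that[OF d(3,4,6,7,5)])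
    fix f assume "pluggable k g f"
    then have f: "pluggable 1 g2 f" "pluggable 2 (\<beta> g2) f"
      using s1 pluggable_swap(3)[OF h] by blast+
    show "pluggable 1 g2 f \<and> pluggable 0 g3 (g2 \<circ>[1] f) \<and>
      pluggable 0 (g2 \<circ>[1] f) g1 \<and> g \<circ>[k] f = g3 \<circ>[0] ((g2 \<circ>[1] f) \<circ>[0] g1) \<and>
      cross k g \<circ>[Suc k] f = g3 \<circ>[0] ((\<beta> g2 \<circ>[2] f) \<circ>[0] g1)"
      using f(1) sandwich_subst[OF d(1,2) f(1) _ k(1)] sandwich_subst(1)[OF db f(2) _ k(2)]
      unfolding d(8)[symmetric] d(9)[symmetric] by simp
  qed
qed

lemma crossable_subst_binary:
  assumes "pluggable j g b" "tight b" "arity b = 2" "crossable k g" "j = k \<or> j = Suc k"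
  shows "crossable k (g \<circ>[j] b)" "crossable (Suc k) (g \<circ>[j] b)"
  using assms by (cases "kind g"; auto simp: crossable_def)+

text \<open>Induction on the arity of \<open>f\<close>.  For \<open>f = b \<circ>[0] e\<close> with \<open>b\<close> binary, the hexagon moves \<open>b\<close> across the
  other input by two crossings.  The earlier one crosses inputs behind \<open>e\<close> and commutes with the
  substitution of \<open>e\<close>; the later one has \<open>e\<close> in its first input, as in the induction hypothesis.\<close>

lemma cross_subst_first:
  assumes "pluggable k g f" "crossable k g"
  shows "cross k g \<circ>[Suc k] f = fold cross (rev [k..<k + arity f]) (g \<circ>[k] f)"
  using assms
proof (induction "arity f" arbitrary: f g rule: less_induct)
  case less
  obtain g3 g2 g1 where d: "tight g3" "tight g2" "arity g2 = 3" "arity g1 = k" "kind g1 = kind g"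
    "\<And>f. pluggable k g f \<Longrightarrow> pluggable 1 g2 f \<and> pluggable 0 g3 (g2 \<circ>[1] f) \<and>
      pluggable 0 (g2 \<circ>[1] f) g1 \<and> g \<circ>[k] f = g3 \<circ>[0] ((g2 \<circ>[1] f) \<circ>[0] g1) \<and>
      cross k g \<circ>[Suc k] f = g3 \<circ>[0] ((\<beta> g2 \<circ>[2] f) \<circ>[0] g1)"
    using crossable_sandwich[OF less.prems(2)] by metis
  note D = d(6)[OF less.prems(1)]
  have g2: "g2 \<in> arrows" using D pluggableD(1) by blast
  have k: "k = 1 + arity g1 - 1" "Suc k = 2 + arity g1 - 1" using d(4) by simp_all
  consider "arity f = 0" | "tight f" "arity f = 1" | "arity f \<noteq> 0" "\<not> (tight f \<and> arity f = 1)" by blast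
  then show ?case
  proof cases
    case 1
    then show ?thesis using D swap_nullary[OF g2 d(2,3)] by simp
  next
    case 2
    let ?h = "g2 \<circ>[1] f"
    have h: "?h \<in> arrows" "tight ?h" "arity ?h = 3" using D d(2,3) 2 by simp_all
    then have "crossable 1 ?h" by (simp add: crossable_def)
    then have "cross k (g \<circ>[k] f) = g3 \<circ>[0] (cross 1 ?h \<circ>[0] g1)"
      using D h(2) d(1) k(1) by (metis sandwich_cross(1))
    also have "cross 1 ?h = \<beta> g2 \<circ>[2] f"
      using cross_ternary[OF h] swap_pre_1[of g2 f] D 2 d(2,3) by simp
    also have "g3 \<circ>[0] ((\<beta> g2 \<circ>[2] f) \<circ>[0] g1) = cross k g \<circ>[Suc k] f" using D by simp
    finally show ?thesis using 2 by simp
  next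
    case 3
    have f: "f \<in> arrows" using pluggableD(2)[OF less.prems(1)] .
    obtain b e where b: "pluggable 0 b e" "tight b" "arity b = 2" "f = b \<circ>[0] e" "arity f = Suc (arity e)"
      by (rule binary_factor[OF f 3])
    have gb: "pluggable k g b" using less.prems(1) b(1) unfolding b(4) by simp
    note B = d(6)[OF gb]
    let ?h = "g2 \<circ>[1] b" and ?H = "g \<circ>[k] b"
    have h: "?h \<in> arrows" "tight ?h" "arity ?h = 4" using B d(2,3) b(3) by simp_all
    then have c: "crossable 2 ?h" "crossable 1 (cross 2 ?h)" "tight (cross 2 ?h)"
      using cross_simps[of 2 ?h] by (simp_all add: crossable_def)
    note cH = crossable_subst_binary[OF gb b(2,3) less.prems(2), simplified]
    have "cross (Suc k) ?H = g3 \<circ>[0] (cross 2 ?h \<circ>[0] g1)" "pluggable 0 g3 (cross 2 ?h)"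
      "pluggable 0 (cross 2 ?h) g1"
      using B c(1) h(2) d(1) k(2) by (metis sandwich_cross)+
    then have "cross k (cross (Suc k) ?H) = g3 \<circ>[0] (cross 1 (cross 2 ?h) \<circ>[0] g1)"
      using c d(1) k(1) by (metis sandwich_cross(1))
    also have "cross 1 (cross 2 ?h) = \<beta> g2 \<circ>[2] b"
      using hexagon_1[of g2 b] B d(2,3) b(2,3) by simp
    also have "g3 \<circ>[0] ((\<beta> g2 \<circ>[2] b) \<circ>[0] g1) = cross k g \<circ>[Suc k] b" using B by simp
    finally have 1: "cross k g \<circ>[Suc k] b = cross k (cross (Suc k) ?H)" by simp
    have sH: "pluggable k ?H e" using gb b(1,3) by (simp add: pluggable_outer)
    have sH': "pluggable k (cross (Suc k) ?H) e"
      using sH pluggable_cross(1)[OF cH(2), of k] by simp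
    have sg: "pluggable (Suc k) (cross k g) b"
      using gb pluggable_cross(3)[OF less.prems(2)] by simp
    have "cross k g \<circ>[Suc k] f = (cross k g \<circ>[Suc k] b) \<circ>[Suc k] e"
      unfolding b(4) by (rule plug_0_plug[symmetric, OF sg b(1)])
    also have "\<dots> = fold cross (rev [k..<k + arity e]) (cross (Suc k) ?H \<circ>[k] e)"
      unfolding 1 using b(5) sH' cH by (intro less.hyps) simp_all
    also have "cross (Suc k) ?H \<circ>[k] e = cross (k + arity e) (?H \<circ>[k] e)"
      by (intro cross_subst_before[symmetric, OF sH cH(2)]) simp_all
    also have "?H \<circ>[k] e = g \<circ>[k] f"
      unfolding b(4) by (rule plug_0_plug[OF gb b(1)])
    finally show ?thesis unfolding b(5) by simp
  qed
qed

end

section \<open>Braided swaps\<close>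

lemma tight_mmaps_iff: "f \<in> tight_mmaps H n \<longleftrightarrow> f \<in> all_mmaps H \<and> kind f = Tight \<and> arity f = n"
  by (auto simp: tight_mmaps_def shape_def)

lemma permute_list_transpose_twice:
  assumes "Suc k < length xs"
  shows "permute_list (transpose k (Suc k)) (permute_list (transpose k (Suc k)) xs) = xs"
proof -
  have p: "transpose k (Suc k) permutes {..<length xs}" using assms by (auto intro: permutes_swap_id)
  show ?thesis using permute_list_compose[OF p, of "transpose k (Suc k)"] by simp
qed

text \<open>The laws of a short braiding, with the operations on multimaps of arity 4 expressed as crossings
  that come from \<open>\<beta>\<close>.\<close>

locale braided_swap = hexagonal_swap C \<beta>
  for C :: "('o, 'm) skew_multicat" and \<beta> :: "('o, 'm) mmap \<Rightarrow> ('o, 'm) mmap" +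
  assumes swap_bij: "bij_betw \<beta> (tights 3) (tights 3)"
    and swap_pre_2: "\<lbrakk>pluggable 2 h p; tight p; arity p = 1; tight h; arity h = 3\<rbrakk> \<Longrightarrow>
      \<beta> (h \<circ>[2] p) = \<beta> h \<circ>[1] p"
    and cross_2_inner: "\<lbrakk>pluggable 1 g h; tight g; arity g = 2; tight h; arity h = 3\<rbrakk> \<Longrightarrow>
      cross 2 (g \<circ>[1] h) = g \<circ>[1] \<beta> h"
    and hexagon_2: "\<lbrakk>pluggable 2 g f; tight g; arity g = 3; tight f; arity f = 2\<rbrakk> \<Longrightarrow>
      cross 2 (cross 1 (g \<circ>[2] f)) = \<beta> g \<circ>[1] f"
    and yang_baxter: "\<lbrakk>h \<in> arrows; tight h; arity h = 4\<rbrakk> \<Longrightarrow>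
      cross 1 (cross 2 (cross 1 h)) = cross 2 (cross 1 (cross 2 h))"
begin

definition swap_inv :: "('o, 'm) mmap \<Rightarrow> ('o, 'm) mmap" where
  "swap_inv = inv_into (tights 3) \<beta>"

lemma swap_inv:
  assumes "h \<in> arrows" "tight h" "arity h = 3"
  shows "swap_inv h \<in> arrows" "tight (swap_inv h)" "arity (swap_inv h) = 3"
    "\<beta> (swap_inv h) = h" "swap_inv (\<beta> h) = h"
proof -
  have h: "h \<in> tights 3" using assms by (simp add: tight_mmaps_iff)
  then have h': "h \<in> \<beta> ` tights 3" using bij_betw_imp_surj_on[OF swap_bij] by simp
  show "\<beta> (swap_inv h) = h" unfolding swap_inv_def by (rule f_inv_into_f[OF h'])
  show "swap_inv (\<beta> h) = h" unfolding swap_inv_def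
    by (rule inv_into_f_f[OF bij_betw_imp_inj_on[OF swap_bij] h])
  have "swap_inv h \<in> tights 3" unfolding swap_inv_def by (rule inv_into_into[OF h'])
  then show "swap_inv h \<in> arrows" "tight (swap_inv h)" "arity (swap_inv h) = 3"
    by (simp_all add: tight_mmaps_iff)
qed

sublocale inv: natural_swap C swap_inv
proof
  fix h assume h: "h \<in> arrows" "tight h" "arity h = 3"
  note i = swap_inv[OF h]
  note s = swap_simps[OF i(1-3), unfolded i(4)]
  have "ins (swap_inv h) = permute_list (transpose 1 2) (ins h)"
    using permute_list_transpose_twice[of 1 "ins (swap_inv h)"] s(8) i(3) by (simp add: numeral_2_eq_2)
  then show "swap_inv h \<in> mmaps (homs C) Tight (permute_list (transpose 1 2) (ins h)) (out h)"
    using i s by (simp add: mmaps_iff)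
next
  fix p h assume a: "pluggable 0 p h" "tight p" "arity p = 1" "tight h" "arity h = 3"
  note h = pluggableD(2)[OF a(1)] a(4,5)
  note i = swap_inv[OF h]
  have s: "pluggable 0 p (swap_inv h)"
    using a(1) pluggable_swap(4)[OF i(1-3), unfolded i(4)] by simp
  have ph: "p \<circ>[0] h \<in> arrows" "tight (p \<circ>[0] h)" "arity (p \<circ>[0] h) = 3" using a by simp_all
  have "\<beta> (p \<circ>[0] swap_inv h) = p \<circ>[0] h"
    using swap_post[OF s a(2,3) i(2,3)] i(4) by simp
  then show "swap_inv (p \<circ>[0] h) = p \<circ>[0] swap_inv h"
    using swap_inv[OF ph] s a i by - (rule swap_inj, simp_all)
next
  fix p h assume a: "pluggable 0 h p" "tight p" "arity p = 1" "tight h" "arity h = 3"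
  note h = pluggableD(1)[OF a(1)] a(4,5)
  note i = swap_inv[OF h]
  have s: "pluggable 0 (swap_inv h) p"
    using a(1) pluggable_swap(1)[OF i(1-3), unfolded i(4)] by simp
  have ph: "h \<circ>[0] p \<in> arrows" "tight (h \<circ>[0] p)" "arity (h \<circ>[0] p) = 3" using a by simp_all
  have "\<beta> (swap_inv h \<circ>[0] p) = h \<circ>[0] p"
    using swap_pre[OF s a(2,3) i(2,3)] i(4) by simp
  then show "swap_inv (h \<circ>[0] p) = swap_inv h \<circ>[0] p"
    using swap_inv[OF ph] s a i by - (rule swap_inj, simp_all)
qed

lemma cross_inverse:
  assumes "crossable k f"
  shows "inv.cross k (cross k f) = f" "cross k (inv.cross k f) = f"
proof -
  obtain G h q where "crossing k f G h q"
    by (rule crossable_decomposition[OF assms])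
  note d = crossingD[OF this]
  note h = pluggableD(1)[OF d(2)] d(4,6)
  note b = swap_simps[OF h] and i = inv.swap_simps[OF h]
  have s: "pluggable 0 G (\<beta> h)" "pluggable 0 (\<beta> h) q"
    "pluggable 0 G (swap_inv h)" "pluggable 0 (swap_inv h) q"
    using d(1,2) by (simp_all add: pluggable_swap[OF h] inv.pluggable_swap[OF h])
  show "inv.cross k (cross k f) = f"
    using inv.cross_sandwich[OF s(1,2) d(3) b(2,3)] swap_inv(5)[OF h]
    unfolding d(7,9) by (simp add: d(8))
  have "inv.cross k f = G \<circ>[0] (swap_inv h \<circ>[0] q)"
    using inv.cross_sandwich[OF d(1-4,6)] unfolding d(7) d(8)[symmetric] .
  then show "cross k (inv.cross k f) = f"
    using cross_sandwich[OF s(3,4) d(3) i(2,3)] swap_inv(4)[OF h]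
    unfolding d(7) by (simp add: d(8))
qed

text \<open>The second hexagon for \<open>\<beta>\<close>, solved for \<open>swap_inv\<close>, is the first hexagon for \<open>swap_inv\<close>.\<close>

sublocale inv: hexagonal_swap C swap_inv
proof
  fix h h' assume e: "swap_inv h = swap_inv h'" and h: "h \<in> arrows" "tight h" "arity h = 3"
    and h': "h' \<in> arrows" "tight h'" "arity h' = 3"
  show "h = h'" using arg_cong[OF e, of \<beta>] unfolding swap_inv(4)[OF h] swap_inv(4)[OF h'] .
next
  fix h p assume a: "pluggable 1 h p" "tight p" "arity p = 1" "tight h" "arity h = 3"
  note h = pluggableD(1)[OF a(1)] a(4,5)
  note i = swap_inv[OF h]
  have s: "pluggable 2 (swap_inv h) p"
    using a(1) pluggable_swap(2)[OF i(1-3), unfolded i(4)] by blast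
  have hp: "h \<circ>[1] p \<in> arrows" "tight (h \<circ>[1] p)" "arity (h \<circ>[1] p) = 3" using a by simp_all
  have "\<beta> (swap_inv h \<circ>[2] p) = h \<circ>[1] p"
    using swap_pre_2[OF s a(2,3) i(2,3)] i(4) by simp
  then show "swap_inv (h \<circ>[1] p) = swap_inv h \<circ>[2] p"
    using swap_inv[OF hp] s a i by - (rule swap_inj, simp_all)
next
  fix g f assume a: "pluggable 1 g f" "tight g" "arity g = 3" "tight f" "arity f = 2"
  note g = pluggableD(1)[OF a(1)] a(2,3)
  note i = swap_inv[OF g]
  have s: "pluggable 2 (swap_inv g) f"
    using a(1) pluggable_swap(2)[OF i(1-3), unfolded i(4)] by blast
  let ?x = "swap_inv g \<circ>[2] f"
  have x: "?x \<in> arrows" "tight ?x" "arity ?x = 4" using s i a(5) by simp_all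
  have c: "crossable 1 ?x" "crossable 2 ?x" using x by (simp_all add: crossable_def)
  have "g \<circ>[1] f = cross 2 (cross 1 ?x)" using hexagon_2[OF s i(2,3) a(4,5)] i(4) by simp
  then show "inv.cross 1 (inv.cross 2 (g \<circ>[1] f)) = swap_inv g \<circ>[2] f"
    using cross_inverse(1)[of 1 ?x] cross_inverse(1)[of 2 "cross 1 ?x"] c by simp
qed

text \<open>In a splitting of \<open>g\<close> around its input \<open>j\<close> the middle factor is binary, so that \<open>cross_2_inner\<close>
  applies.\<close>

lemma cross_subst_ternary:
  assumes "pluggable j g h" "tight h" "arity h = 3" "tight g \<Longrightarrow> 0 < j"
  shows "cross (Suc j) (g \<circ>[j] h) = g \<circ>[j] \<beta> h"
proof -
  note h = pluggableD(2)[OF assms(1)] assms(2,3)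
  have j: "g \<in> arrows" "j + 1 \<le> arity g" using pluggableD[OF assms(1)] by auto
  obtain g3 g2 g1 where d: "pluggable 0 g3 g2" "pluggable 0 g2 g1" "tight g3" "tight g2"
    "kind g1 = kind g" "arity g2 = Suc 1" "arity g1 = j" "g = g3 \<circ>[0] (g2 \<circ>[0] g1)"
    "arity g = arity g3 + (j + 1) - 1"
    by (rule sandwich_decomposition[OF j assms(4)])
  have j1: "j = 1 + arity g1 - 1" "Suc j = 2 + arity g1 - 1" using d(7) by simp_all
  have s2: "pluggable j (g2 \<circ>[0] g1) h"
    using assms(1) d(1,2,6,7) unfolding d(8) by (simp add: pluggable_outer)
  have s: "pluggable 1 g2 h"
    using s2 pluggable_after[OF d(2) _ j1(1)] by simp
  have s': "pluggable 1 g2 (\<beta> h)" using s by (simp add: pluggable_swap[OF h])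
  note S = sandwich_subst[OF d(1,2) s _ j1(1)] and S' = sandwich_subst[OF d(1,2) s' _ j1(1)]
  have c: "crossable 2 (g2 \<circ>[1] h)" "tight (g2 \<circ>[1] h)"
    using s h d(4,6) by (simp_all add: crossable_def)
  have "cross (Suc j) (g \<circ>[j] h) = cross (Suc j) (g3 \<circ>[0] ((g2 \<circ>[1] h) \<circ>[0] g1))"
    unfolding d(8) using S by simp
  also have "\<dots> = g3 \<circ>[0] (cross 2 (g2 \<circ>[1] h) \<circ>[0] g1)"
    using S c d(3) j1(2) by (intro sandwich_cross) simp_all
  also have "cross 2 (g2 \<circ>[1] h) = g2 \<circ>[1] \<beta> h"
    using s d(4,6) h by (intro cross_2_inner) simp_all
  also have "g3 \<circ>[0] ((g2 \<circ>[1] \<beta> h) \<circ>[0] g1) = g \<circ>[j] \<beta> h"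
    unfolding d(8) using S' by simp
  finally show ?thesis .
qed

text \<open>Only the ternary factor in a splitting of \<open>f\<close> matters: its inner factor can be taken out by
  \<open>cross_subst_before\<close>, and its outer factor can be absorbed by \<open>g\<close>.\<close>

lemma cross_subst_inner:
  assumes "pluggable j g f" "crossable k f"
  shows "cross (j + k) (g \<circ>[j] f) = g \<circ>[j] cross k f"
proof (cases "tight g \<and> j = 0")
  case True
  then show ?thesis using cross_post assms by simp
next
  case False
  obtain G h q where "crossing k f G h q"
    by (rule crossable_decomposition[OF assms(2)])
  note d = crossingD[OF this]
  note h = pluggableD(1)[OF d(2)] d(4,6)
  have gG: "pluggable j g G"
    using assms(1) d(1,2) unfolding d(8) by simp
  let ?g = "g \<circ>[j] G"
  have jg: "j < arity g" using pluggableD(3)[OF assms(1)] .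
  have G0: "0 < arity G" using pluggableD(3)[OF d(1)] .
  have tight: "0 < j" if "tight ?g" using that gG False by (cases "kind g") auto
  have s: "pluggable j ?g h" using gG d(1) G0 by (simp add: pluggable_outer)
  have sb: "pluggable j ?g (\<beta> h)" using s by (simp add: pluggable_swap[OF h])
  have s\<beta>: "pluggable 0 G (\<beta> h)" "pluggable 0 (\<beta> h) q"
    using d(1,2) by (simp_all add: pluggable_swap[OF h])
  have f: "g \<circ>[j] f = (?g \<circ>[j] h) \<circ>[j] q" "g \<circ>[j] cross k f = (?g \<circ>[j] \<beta> h) \<circ>[j] q"
  proof -
    show "g \<circ>[j] f = (?g \<circ>[j] h) \<circ>[j] q"
      unfolding d(8) plug_0_plug[OF s d(2)] using gG d(1,2) by (intro plug_0_plug[symmetric]) simp_all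
    show "g \<circ>[j] cross k f = (?g \<circ>[j] \<beta> h) \<circ>[j] q"
      unfolding d(9) plug_0_plug[OF sb s\<beta>(2)] using gG s\<beta> by (intro plug_0_plug[symmetric]) simp_all
  qed
  have c: "crossable (Suc j) (?g \<circ>[j] h)"
    using s h pluggableD(3)[OF s] by (auto simp: crossable_def)
  have s3: "pluggable j (?g \<circ>[j] h) q"
    using s d(2,6) by (simp add: pluggable_outer)
  have "cross (j + k) ((?g \<circ>[j] h) \<circ>[j] q) = cross (Suc j) (?g \<circ>[j] h) \<circ>[j] q"
    using d(7) by (intro cross_subst_before[OF s3 c]) simp_all
  also have "cross (Suc j) (?g \<circ>[j] h) = ?g \<circ>[j] \<beta> h"
    using tight by (intro cross_subst_ternary[OF s h(2,3)])
  finally show ?thesis unfolding f .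
qed

end

section \<open>Braid words that fix the first strand\<close>

definition acting_words :: "tightness \<Rightarrow> nat \<Rightarrow> braid_word set" where
  "acting_words k n = {w \<in> braid_words n. k = Tight \<longrightarrow> (\<forall>l\<in>set w. 0 < fst l)}"

lemma acting_words_simps [simp]:
  "[] \<in> acting_words k n"
  "l # w \<in> acting_words k n \<longleftrightarrow> Suc (fst l) < n \<and> (k = Tight \<longrightarrow> 0 < fst l) \<and> w \<in> acting_words k n"
  "u @ v \<in> acting_words k n \<longleftrightarrow> u \<in> acting_words k n \<and> v \<in> acting_words k n"
  by (auto simp: acting_words_def)

lemma acting_wordsI:
  assumes "\<And>l. l \<in> set w \<Longrightarrow> Suc (fst l) < n \<and> (k = Tight \<longrightarrow> 0 < fst l)"
  shows "w \<in> acting_words k n"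
  using assms by (induction w) auto

lemma inverse_word_acting [simp]: "inverse_word w \<in> acting_words k n \<longleftrightarrow> w \<in> acting_words k n"
  by (induction w) auto

lemma acting_words_braid_words: "w \<in> acting_words k n \<Longrightarrow> w \<in> braid_words n"
  by (simp add: acting_words_def)

lemma braid_shift_braid_shift: "braid_shift a (braid_shift b w) = braid_shift (b + a) w"
  by (induction w) auto

lemma braid_shift_0 [simp]: "braid_shift 0 w = w"
  by (induction w) auto

lemma acting_words_Tight:
  assumes "w \<in> acting_words Tight n"
  obtains u where "w = braid_shift 1 u" "u \<in> braid_words (n - 1)"
proof -
  have "\<exists>u. w = braid_shift 1 u \<and> u \<in> braid_words (n - 1)" using assms
  proof (induction w)
    case Nil
    then show ?case by (intro exI[of _ "[]"]) simp
  next
    case (Cons l w)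
    then obtain u where "w = braid_shift 1 u" "u \<in> braid_words (n - 1)" by auto
    then show ?case using Cons.prems by (intro exI[of _ "(fst l - 1, snd l) # u"]) auto
  qed
  then show ?thesis using that by blast
qed

lemma acting_braids_eq: "acting_braids k n = braid_class n ` acting_words k n"
proof (cases k)
  case Tight
  have "acting_words Tight n = braid_shift 1 ` braid_words (n - 1)"
  proof
    show "acting_words Tight n \<subseteq> braid_shift 1 ` braid_words (n - 1)"
      by (auto elim: acting_words_Tight)
    have "braid_shift 1 u \<in> acting_words Tight n" if "u \<in> braid_words (n - 1)" for u
      using that by (induction u) auto
    then show "braid_shift 1 ` braid_words (n - 1) \<subseteq> acting_words Tight n" by blast
  qed
  then show ?thesis unfolding Tight acting_braids_def braids_fixing_first_def by (auto simp: image_image)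
next
  case Loose
  then show ?thesis by (simp add: acting_braids_def acting_words_def braid_group_def)
qed

text \<open>Replacing the first strand by no strands and each other strand by itself deletes the first
  strand.\<close>

lemma block_word_delete_first:
  assumes "u \<in> braid_words n"
  shows "block_word (0 # replicate n 1) (braid_shift 1 u) = u"
  using assms
proof (induction u)
  case (Cons l u)
  let ?ks = "0 # replicate n 1 :: nat list"
  have l: "Suc (fst l) < n" using Cons.prems by simp
  have "permute_list (transpose (Suc (fst l)) (Suc (Suc (fst l)))) ?ks = ?ks"
    using l by (intro nth_equalityI) (auto simp: permute_list_transpose_nth nth_Cons split: nat.split)
  moreover have "sum_list (take (Suc (fst l)) ?ks) = fst l" using l by (simp add: sum_list_replicate min_def)
  then have "block_letter ?ks (Suc (fst l), snd l) = [l]"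
    using l by (cases l) (simp add: block_letter_def Let_def cross_one_def)
  ultimately show ?case using Cons by simp
qed simp

text \<open>The braid group on \<open>n\<close> strands embeds into the one on \<open>n + 1\<close> strands, with deletion of the first
  strand as a left inverse.  The deletion respects equality of braids by \<open>block_word_cong\<close>.\<close>

lemma braid_eq_shift_inject:
  assumes "braid_eq (Suc n) (braid_shift 1 u) (braid_shift 1 v)" "u \<in> braid_words n" "v \<in> braid_words n"
  shows "braid_eq n u v"
  using block_word_cong[OF assms(1), of "0 # replicate n 1"] assms(2,3)
  by (simp add: block_word_delete_first sum_list_replicate del: One_nat_def)

section \<open>Braid words acting on multimaps\<close>

context braided_swap
begin

definition cross_letter :: "nat \<times> bool \<Rightarrow> ('o, 'm) mmap \<Rightarrow> ('o, 'm) mmap" where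
  "cross_letter l = (if snd l then cross (fst l) else inv.cross (fst l))"

definition word_action :: "braid_word \<Rightarrow> ('o, 'm) mmap \<Rightarrow> ('o, 'm) mmap" where
  "word_action w = fold cross_letter w"

lemma word_action_simps [simp]:
  "word_action [] f = f"
  "word_action (l # w) f = word_action w (cross_letter l f)"
  "word_action (u @ v) f = word_action v (word_action u f)"
  "cross_letter (i, True) f = cross i f"
  by (simp_all add: word_action_def cross_letter_def)

lemma cross_braid:
  assumes "crossable i f" "crossable (Suc i) f"
  shows "cross i (cross (Suc i) (cross i f)) = cross (Suc i) (cross i (cross (Suc i) f))"
proof -
  have f: "f \<in> arrows" "i + 3 \<le> arity f" "tight f \<Longrightarrow> 0 < i" using assms by (auto simp: crossable_def)
  obtain g h q where d: "pluggable 0 g h" "pluggable 0 h q" "tight g" "tight h"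
    "kind q = kind f" "arity h = Suc 3" "arity q = i" "f = g \<circ>[0] (h \<circ>[0] q)" "arity f = arity g + (i + 3) - 1"
    by (rule sandwich_decomposition[OF f])
  have h: "h \<in> arrows" "tight h" "arity h = 4" using pluggableD(1)[OF d(2)] d(4,6) by simp_all
  have i: "i = 1 + arity q - 1" "Suc i = 2 + arity q - 1" using d(7) by simp_all
  let ?P = "\<lambda>x. pluggable 0 g x \<and> pluggable 0 x q \<and> x \<in> arrows \<and> tight x \<and> arity x = 4"
  have 1: "cross i (g \<circ>[0] (x \<circ>[0] q)) = g \<circ>[0] (cross 1 x \<circ>[0] q) \<and> ?P (cross 1 x)"
    and 2: "cross (Suc i) (g \<circ>[0] (x \<circ>[0] q)) = g \<circ>[0] (cross 2 x \<circ>[0] q) \<and> ?P (cross 2 x)" if "?P x" for x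
  proof -
    have c: "crossable 1 x" "crossable 2 x" using that by (simp_all add: crossable_def)
    show "cross i (g \<circ>[0] (x \<circ>[0] q)) = g \<circ>[0] (cross 1 x \<circ>[0] q) \<and> ?P (cross 1 x)"
      using sandwich_cross[OF _ _ c(1) _ d(3) i(1)] cross_simps[OF c(1)] that by simp
    show "cross (Suc i) (g \<circ>[0] (x \<circ>[0] q)) = g \<circ>[0] (cross 2 x \<circ>[0] q) \<and> ?P (cross 2 x)"
      using sandwich_cross[OF _ _ c(2) _ d(3) i(2)] cross_simps[OF c(2)] that by simp
  qed
  have P: "?P h" using d(1,2) h by simp
  have L: "cross i (cross (Suc i) (cross i f)) = g \<circ>[0] (cross 1 (cross 2 (cross 1 h)) \<circ>[0] q)"
    unfolding d(8) using 1 2 P by metis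
  have R: "cross (Suc i) (cross i (cross (Suc i) f)) = g \<circ>[0] (cross 2 (cross 1 (cross 2 h)) \<circ>[0] q)"
    unfolding d(8) using 1 2 P by metis
  show ?thesis unfolding L R yang_baxter[OF h] ..
qed

lemma cross_letter_simps:
  assumes "crossable (fst l) f"
  shows "cross_letter l f \<in> arrows" "kind (cross_letter l f) = kind f" "out (cross_letter l f) = out f"
    "ins (cross_letter l f) = permute_list (transpose (fst l) (Suc (fst l))) (ins f)"
    "arity (cross_letter l f) = arity f"
  using cross_simps[OF assms] inv.cross_simps[OF assms] by (simp_all add: cross_letter_def)

lemma pluggable_cross_letter:
  assumes "crossable (fst l) g"
  shows "j \<noteq> fst l \<Longrightarrow> j \<noteq> Suc (fst l) \<Longrightarrow> pluggable j (cross_letter l g) f \<longleftrightarrow> pluggable j g f"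
    "pluggable i h (cross_letter l g) \<longleftrightarrow> pluggable i h g"
  using pluggable_cross[OF assms] inv.pluggable_cross[OF assms] by (simp_all add: cross_letter_def)

text \<open>A relational form of \<open>word_action\<close>, which also records that the word is allowed to act.  The
  lemmas below propagate both facts at once.\<close>

definition carries :: "braid_word \<Rightarrow> ('o, 'm) mmap \<Rightarrow> ('o, 'm) mmap \<Rightarrow> bool" where
  "carries w f f' \<longleftrightarrow> f \<in> arrows \<and> w \<in> acting_words (kind f) (arity f) \<and> f' = word_action w f"

lemma carries_Nil [simp]: "carries [] f f' \<longleftrightarrow> f \<in> arrows \<and> f' = f"
  by (auto simp: carries_def)

lemma carries_Cons:
  "carries (l # w) f f' \<longleftrightarrow> crossable (fst l) f \<and> carries w (cross_letter l f) f'"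
  using cross_letter_simps[of l f] unfolding carries_def by (auto simp: crossable_def)

lemma carries_facts:
  assumes "carries w f f'"
  shows "f' \<in> arrows" "kind f' = kind f" "out f' = out f" "arity f' = arity f"
    "ins f' = permute_list (word_perm w) (ins f)"
    "f \<in> arrows" "w \<in> acting_words (kind f) (arity f)" "w \<in> braid_words (arity f)"
proof -
  show w: "f \<in> arrows" "w \<in> acting_words (kind f) (arity f)" using assms by (auto simp: carries_def)
  then show "w \<in> braid_words (arity f)" by (simp add: acting_words_def)
  have "f' \<in> arrows \<and> kind f' = kind f \<and> out f' = out f \<and> arity f' = arity f \<and>
      ins f' = permute_list (word_perm w) (ins f)"
    using assms
  proof (induction w arbitrary: f)
    case (Cons l w)
    let ?f = "cross_letter l f"
    have c: "crossable (fst l) f" "carries w ?f f'" using Cons.prems by (auto simp: carries_Cons)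
    note s = cross_letter_simps[OF c(1)]
    have "w \<in> braid_words (arity f)" using c(2) s by (simp add: carries_def acting_words_def)
    then have p: "word_perm w permutes {..<arity f}" by (rule word_perm_permutes)
    show ?case
      using Cons.IH[OF c(2)] s unfolding word_perm_simps permute_list_compose[OF p] by simp
  qed simp
  then show "f' \<in> arrows" "kind f' = kind f" "out f' = out f" "arity f' = arity f"
    "ins f' = permute_list (word_perm w) (ins f)" by blast+
qed

lemma carries_append: "carries (u @ v) f f'' \<longleftrightarrow> (\<exists>f'. carries u f f' \<and> carries v f' f'')"
  by (induction u arbitrary: f) (auto simp: carries_Cons carries_facts(6))

lemma carries_append_trans: "carries u f f' \<Longrightarrow> carries v f' f'' \<Longrightarrow> carries (u @ v) f f''"
  by (auto simp: carries_append)

lemma carries_inverse: "carries w f f' \<Longrightarrow> carries (inverse_word w) f' f"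
proof (induction w arbitrary: f)
  case (Cons l w)
  let ?f = "cross_letter l f"
  have c: "crossable (fst l) f" "carries w ?f f'" using Cons.prems by (auto simp: carries_Cons)
  have "crossable (fst l) ?f" using cross_letter_simps[OF c(1)] c(1) by (simp add: crossable_def)
  moreover have "f \<in> arrows" using c(1) by (simp add: crossable_def)
  ultimately have "carries [(fst l, \<not> snd l)] ?f f"
    using cross_inverse[OF c(1)] by (auto simp: carries_Cons cross_letter_def)
  then show ?case using Cons.IH[OF c(2)] by (auto simp: carries_append)
qed auto

lemma cross_letter_subst_inner:
  assumes "pluggable j g f" "crossable (fst l) f"
  shows "cross_letter (fst l + j, snd l) (g \<circ>[j] f) = g \<circ>[j] cross_letter l f"
proof (cases "snd l")
  case True
  then show ?thesis using cross_subst_inner[OF assms] by (simp add: cross_letter_def add.commute)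
next
  case False
  let ?f = "inv.cross (fst l) f"
  have c: "crossable (fst l) ?f" using inv.crossable_cross[OF assms(2)] assms(2) by simp
  have s: "pluggable j g ?f" using inv.pluggable_cross(4)[OF assms(2)] assms(1) by simp
  have "cross (j + fst l) (g \<circ>[j] ?f) = g \<circ>[j] f"
    using cross_subst_inner[OF s c] cross_inverse(2)[OF assms(2)] by simp
  then have "inv.cross (j + fst l) (g \<circ>[j] f) = g \<circ>[j] ?f"
    using cross_inverse(1)[OF crossable_inner[OF s c]] by simp
  then show ?thesis using False by (simp add: cross_letter_def add.commute)
qed

lemma carries_inner:
  "pluggable j g f \<Longrightarrow> carries w f f' \<Longrightarrow> carries (braid_shift j w) (g \<circ>[j] f) (g \<circ>[j] f')"
proof (induction w arbitrary: f)
  case (Cons l w)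
  let ?f = "cross_letter l f"
  have c: "crossable (fst l) f" "carries w ?f f'" using Cons.prems by (auto simp: carries_Cons)
  have "pluggable j g ?f" using Cons.prems(1) pluggable_cross_letter(2)[OF c(1)] by simp
  from Cons.IH[OF this c(2)] show ?case
    using cross_letter_subst_inner[OF Cons.prems(1) c(1)] crossable_inner[OF Cons.prems(1) c(1)]
    by (simp add: carries_Cons add.commute)
qed simp

text \<open>Positions are written as \<open>Suc j + i\<close> before and \<open>j + arity f + i\<close> after the substitution, which
  avoids a subtraction when \<open>f\<close> is nullary.\<close>

lemma carries_after:
  "pluggable j g f \<Longrightarrow> carries (braid_shift (Suc j) w) g g' \<Longrightarrow>
    carries (braid_shift (j + arity f) w) (g \<circ>[j] f) (g' \<circ>[j] f) \<and> pluggable j g' f"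
proof (induction w arbitrary: g)
  case (Cons l w)
  let ?l = "(fst l + Suc j, snd l)"
  let ?g = "cross_letter ?l g"
  have c: "crossable (fst l + Suc j) g" "carries (braid_shift (Suc j) w) ?g g'"
    using Cons.prems(2) by (auto simp: carries_Cons)
  have "pluggable j ?g f"
    using Cons.prems(1) pluggable_cross_letter(1)[of ?l g j] c(1) by simp
  note IH = Cons.IH[OF this c(2)]
  have i: "fst l + (j + arity f) = (fst l + Suc j) + arity f - 1" by simp
  have "crossable (fst l + (j + arity f)) (g \<circ>[j] f)"
    unfolding i using Cons.prems(1) c(1) by (intro crossable_subst) auto
  moreover have "cross_letter (fst l + (j + arity f), snd l) (g \<circ>[j] f) = ?g \<circ>[j] f"
    using cross_subst_before[OF Cons.prems(1) c(1) _ i] inv.cross_subst_before[OF Cons.prems(1) c(1) _ i]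
    by (simp add: cross_letter_def)
  ultimately show ?case using IH by (simp add: carries_Cons)
qed simp

lemma tight_substD:
  assumes "pluggable j g f" "tight (g \<circ>[j] f)"
  shows "tight g"
  using assms by (cases "kind g") auto

lemma word_action_positions:
  "word_action (map (\<lambda>i. (i, e)) is) f = fold (if e then cross else inv.cross) is f"
  by (induction "is" arbitrary: f) (auto simp: cross_letter_def)

lemma carries_cross_letter_first:
  assumes "pluggable k g f" "crossable k g"
  shows "carries (map (\<lambda>i. (i, e)) (rev [k..<k + arity f])) (g \<circ>[k] f) (cross_letter (k, e) g \<circ>[Suc k] f)"
proof -
  have "0 < k" if "tight (g \<circ>[k] f)" using tight_substD[OF assms(1) that] assms(2) by (simp add: crossable_def)
  then have "map (\<lambda>i. (i, e)) (rev [k..<k + arity f]) \<in> acting_words (kind (g \<circ>[k] f)) (arity (g \<circ>[k] f))"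
    using assms by (intro acting_wordsI) (auto simp: crossable_def)
  then show ?thesis
    using assms cross_subst_first[OF assms] inv.cross_subst_first[OF assms]
    by (simp add: carries_def word_action_positions cross_letter_def)
qed

lemma carries_cross_first:
  assumes "pluggable k g f" "crossable k g"
  shows "carries (cross_blocks k (arity f) 1) (g \<circ>[k] f) (cross k g \<circ>[Suc k] f)"
proof -
  have "cross_blocks k m 1 = map (\<lambda>i. (i, True)) (rev [k..<k + m])" for m
    by (induction m) (simp_all add: cross_one_def)
  then show ?thesis using carries_cross_letter_first[OF assms, of True] by simp
qed

text \<open>The inverse crossing of \<open>cross k g\<close> moves \<open>f\<close> from its first to its second crossed input, by
  negative letters.  Reading this backwards gives a positive word.\<close>

lemma carries_cross_second:
  assumes "pluggable (Suc k) g f" "crossable k g"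
  shows "carries (cross_one k (arity f)) (g \<circ>[Suc k] f) (cross k g \<circ>[k] f)"
proof -
  let ?g = "cross k g"
  have c: "crossable k ?g" using assms(2) by simp
  have s: "pluggable k ?g f" using assms(1) pluggable_cross(2)[OF assms(2)] by simp
  have "carries (map (\<lambda>i. (i, False)) (rev [k..<k + arity f])) (?g \<circ>[k] f) (g \<circ>[Suc k] f)"
    using carries_cross_letter_first[OF s c, of False] cross_inverse(1)[OF assms(2)]
    by (simp add: cross_letter_def)
  from carries_inverse[OF this] show ?thesis
    by (simp add: inverse_word_def cross_one_def rev_map comp_def)
qed

text \<open>Here \<open>d\<close> is the number of strands at the left on which nothing acts.\<close>

lemma carries_shift_cong:
  assumes "braid_eq n u v" and d: "d = (if k = Tight then 1 else 0)"
  shows "\<lbrakk>f \<in> arrows; arity f = n + d; kind f = k\<rbrakk> \<Longrightarrow>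
    carries (braid_shift d u) f f' \<longleftrightarrow> carries (braid_shift d v) f f'"
  using assms(1)
proof (induction arbitrary: f f' rule: braid_eq.induct)
  case (append u u' v v')
  have "carries (braid_shift d v) x f' \<longleftrightarrow> carries (braid_shift d v') x f'" if "carries (braid_shift d u) f x" for x
    using carries_facts(1,2,4)[OF that] append by auto
  moreover have "carries (braid_shift d u) f x \<longleftrightarrow> carries (braid_shift d u') f x" for x
    using append by blast
  ultimately show ?case by (auto simp: carries_append)
next
  case (cancel i e)
  have c: "crossable (fst (i + d, e)) f" using cancel d by (auto simp: crossable_def split: if_splits)
  let ?f = "cross_letter (i + d, e) f"
  have "carries [(i + d, e)] f ?f" using c cross_letter_simps(1)[OF c] by (simp add: carries_Cons)
  from carries_append_trans[OF this carries_inverse[OF this]]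
  have "carries [(i + d, e), (i + d, \<not> e)] f f" by simp
  then show ?case using cancel.prems(1) by (auto simp: carries_def)
next
  case (far i j)
  have "crossable (i + d) f" "crossable (j + d) f"
    using far d by (auto simp: crossable_def split: if_splits)
  then show ?case using cross_far[of "i + d" f "j + d"] far(1) by (simp add: carries_Cons)
next
  case (braid i)
  have "crossable (i + d) f" "crossable (Suc (i + d)) f"
    using braid d by (auto simp: crossable_def split: if_splits)
  then show ?case using cross_braid[of "i + d" f] by (simp add: carries_Cons)
qed blast+

text \<open>For a tight multimap the words are compared in the braid group on all but the first strand, where
  every step of a derivation acts.\<close>

lemma carries_cong:
  assumes "carries u f f'" "braid_eq (arity f) u v" "v \<in> acting_words (kind f) (arity f)"
  shows "carries v f f'"
proof (cases "tight f")
  case False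
  then show ?thesis
    using carries_shift_cong[OF assms(2), of 0 "kind f" f f'] assms(1) carries_facts(6)[OF assms(1)] by simp
next
  case True
  note u = carries_facts(6,7)[OF assms(1)]
  obtain n where n: "arity f = Suc n" using tight_arity[OF u(1) True] by (cases "arity f") auto
  obtain x where x: "u = braid_shift 1 x" "x \<in> braid_words n"
    using acting_words_Tight[of u "Suc n"] u(2) True n by auto
  obtain y where y: "v = braid_shift 1 y" "y \<in> braid_words n"
    using acting_words_Tight[of v "Suc n"] assms(3) True n by auto
  have "braid_eq n x y" using braid_eq_shift_inject[of n x y] assms(2) x y n by simp
  then show ?thesis
    using carries_shift_cong[of n x y 1 Tight f f'] assms(1) u(1) x(1) y(1) n True by simp
qed

lemma cross_blocks_0 [simp]: "cross_blocks k m 0 = []"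
  by (induction m) (auto simp: cross_one_def)

text \<open>The input of \<open>h\<close> into which \<open>f\<close> goes is moved across \<open>p\<close> strands one after the other.  Each step
  moves the strands of \<open>f\<close> across one strand, and these block crossings compose by
  \<open>cross_blocks_add\<close>.\<close>

lemma carries_cross_one_subst:
  assumes "carries (cross_one i p) h g" "pluggable i h f"
  shows "pluggable (i + p) g f \<and> carries (cross_blocks i (arity f) p) (h \<circ>[i] f) (g \<circ>[i + p] f)"
  using assms(1)
proof (induction p arbitrary: g)
  case 0
  then show ?case using assms(2) by (simp add: cross_one_def)
next
  case (Suc p)
  have e: "cross_one i (Suc p) = cross_one i p @ [(i + p, True)]"
    by (simp add: cross_one_def)
  obtain x where x: "carries (cross_one i p) h x" "crossable (i + p) x" "g = cross (i + p) x"
    using Suc.prems unfolding e by (auto simp: carries_append carries_Cons)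
  note IH = Suc.IH[OF x(1)]
  have s: "pluggable (i + Suc p) g f"
    using IH pluggable_cross(3)[OF x(2)] x(3) by simp
  have *: "carries (cross_blocks i (arity f) p @ cross_blocks (i + p) (arity f) 1) (h \<circ>[i] f) (g \<circ>[i + Suc p] f)"
    using carries_append_trans[OF conjunct2[OF IH] carries_cross_first[OF conjunct1[OF IH] x(2)]] x(3) by simp
  have h: "arity x = arity h" "kind x = kind h" using carries_facts[OF x(1)] by auto
  have n: "i + arity f + p + 1 \<le> arity (h \<circ>[i] f)"
  proof -
    have "Suc (i + p) < arity h" using x(2) h by (simp add: crossable_def)
    then show ?thesis unfolding subst_facts(4)[OF assms(2)] by linarith
  qed
  have "0 < i" if "tight (h \<circ>[i] f)"
  proof -
    have "tight h" by (rule tight_substD[OF assms(2) that])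
    then have "0 < i + p" "p \<noteq> 0 \<Longrightarrow> 0 < i"
      using x(2) h carries_facts(7)[OF x(1)] by (auto simp: crossable_def acting_words_def cross_one_def)
    then show ?thesis by (cases "p = 0") auto
  qed
  then have "cross_blocks i (arity f) (Suc p) \<in> acting_words (kind (h \<circ>[i] f)) (arity (h \<circ>[i] f))"
    using n by (intro acting_wordsI) (auto dest!: cross_blocks_set)
  then show ?case
    using carries_cong[OF * braid_eq.sym[OF cross_blocks_add[OF n]]] s by simp
qed

text \<open>First \<open>f'\<close> is substituted, so that the other input crosses its strands one at a time; then \<open>f\<close> is
  substituted into this input, wherever it has got to.\<close>

lemma carries_cross_blocks:
  assumes "crossable i g" "pluggable i g f" "pluggable (Suc i) g f'"
  shows "carries (cross_blocks i (arity f) (arity f')) ((g \<circ>[Suc i] f') \<circ>[i] f) ((cross i g \<circ>[Suc i] f) \<circ>[i] f')"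
proof -
  have s: "pluggable i (g \<circ>[Suc i] f') f" using assms(2,3) by (simp add: pluggable_outer)
  have s': "pluggable i (cross i g) f'" "pluggable (Suc i) (cross i g) f"
    using assms pluggable_cross(2,3)[OF assms(1)] by simp_all
  have "(cross i g \<circ>[i] f') \<circ>[i + arity f'] f = (cross i g \<circ>[Suc i] f) \<circ>[i] f'"
    using s' by (intro plug_swap) simp_all
  then show ?thesis
    using carries_cross_one_subst[OF carries_cross_second[OF assms(3,1)] s] by simp
qed

end

section \<open>Simultaneous substitution\<close>

context skew_multicategory
begin

definition plugs :: "nat \<Rightarrow> ('o, 'm) mmap \<Rightarrow> ('o, 'm) mmap list \<Rightarrow> bool" where
  "plugs k g fs \<longleftrightarrow> (\<forall>j<length fs. pluggable (k + j) g (fs ! j))"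

lemma plugs_simps [simp]:
  "plugs k g []"
  "plugs k g (f # fs) \<longleftrightarrow> pluggable k g f \<and> plugs (Suc k) g fs"
  by (simp_all add: plugs_def All_less_Suc2)

lemma plugs_append [simp]: "plugs k g (xs @ ys) \<longleftrightarrow> plugs k g xs \<and> plugs (k + length xs) g ys"
  by (induction xs arbitrary: k) auto

lemma plugs_all:
  assumes "g \<in> arrows" "set fs \<subseteq> arrows" "map out fs = ins g"
  shows "plugs 0 g fs"
proof -
  have len: "length fs = arity g" using arg_cong[OF assms(3), of length] by simp
  have "out (fs ! j) = ins g ! j" if "j < length fs" for j using that assms(3) by (metis nth_map)
  then show ?thesis
    using assms(1,2) len by (auto simp: plugs_def pluggable_def composable_def)
qed

lemma subst_from_facts:
  assumes "g \<in> arrows" "plugs k g fs"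
  shows "subst_from C k g fs \<in> arrows" "out (subst_from C k g fs) = out g"
    "kind (subst_from C k g fs) =
      (if k = 0 \<and> fs \<noteq> [] then subst_kind (kind g) 0 (kind (hd fs)) else kind g)"
    "arity (subst_from C k g fs) + length fs = arity g + sum_list (map arity fs)"
    "\<And>j f. j < k \<Longrightarrow> pluggable j (subst_from C k g fs) f \<longleftrightarrow> pluggable j g f"
proof -
  have "subst_from C k g fs \<in> arrows \<and> out (subst_from C k g fs) = out g \<and>
    kind (subst_from C k g fs) =
      (if k = 0 \<and> fs \<noteq> [] then subst_kind (kind g) 0 (kind (hd fs)) else kind g) \<and>
    arity (subst_from C k g fs) + length fs = arity g + sum_list (map arity fs) \<and>
    (\<forall>j f. j < k \<longrightarrow> pluggable j (subst_from C k g fs) f = pluggable j g f)"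
    using assms(2)
  proof (induction fs arbitrary: k)
    case Nil
    then show ?case using assms(1) by simp
  next
    case (Cons f fs)
    let ?h = "subst_from C (Suc k) g fs"
    have p: "pluggable k g f" "plugs (Suc k) g fs" using Cons.prems by auto
    note IH = Cons.IH[OF p(2)]
    have s: "pluggable k ?h f" using IH p(1) by simp
    have A: "kind (?h \<circ>[k] f) =
        (if k = 0 \<and> f # fs \<noteq> [] then subst_kind (kind g) 0 (kind (hd (f # fs))) else kind g)"
      using s IH by (cases "kind g") auto
    have B: "arity (?h \<circ>[k] f) + length (f # fs) = arity g + sum_list (map arity (f # fs))"
    proof -
      have "arity ?h + length fs = arity g + sum_list (map arity fs)" using IH by blast
      moreover have "x + a - 1 + Suc l = m + (a + n)" if "x + l = m + n" "k < x" for x a l m n :: nat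
        using that by linarith
      ultimately show ?thesis unfolding subst_facts(4)[OF s] using pluggableD(3)[OF s] by simp
    qed
    have "\<forall>j f'. j < k \<longrightarrow> pluggable j (?h \<circ>[k] f) f' = pluggable j g f'"
      using IH s by (simp add: pluggable_outer)
    then show ?case
      unfolding subst_from.simps
      by (intro conjI A B) (use s IH in simp_all)
  qed
  then show "subst_from C k g fs \<in> arrows" "out (subst_from C k g fs) = out g"
    "kind (subst_from C k g fs) =
      (if k = 0 \<and> fs \<noteq> [] then subst_kind (kind g) 0 (kind (hd fs)) else kind g)"
    "arity (subst_from C k g fs) + length fs = arity g + sum_list (map arity fs)"
    "\<And>j f. j < k \<Longrightarrow> pluggable j (subst_from C k g fs) f \<longleftrightarrow> pluggable j g f"
    by blast+
qed

lemma multisubst_arity: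
  assumes "g \<in> arrows" "set fs \<subseteq> arrows" "map out fs = ins g"
  shows "multisubst C g fs \<in> arrows" "arity (multisubst C g fs) = sum_list (map arity fs)"
  using subst_from_facts(1,4)[OF assms(1) plugs_all[OF assms]] arg_cong[OF assms(3), of length]
  by (simp_all add: multisubst_def)

end

context braided_swap
begin

text \<open>The word acts on strands to the right of all inputs that are substituted into.\<close>

lemma carries_subst_from_after:
  "\<lbrakk>g \<in> arrows; plugs k g fs; carries (braid_shift (k + length fs) w) g g'\<rbrakk> \<Longrightarrow>
    carries (braid_shift (k + sum_list (map arity fs)) w) (subst_from C k g fs) (subst_from C k g' fs)"
proof (induction fs arbitrary: k)
  case (Cons f fs)
  let ?h = "subst_from C (Suc k) g fs" and ?h' = "subst_from C (Suc k) g' fs"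
    and ?s = "sum_list (map arity fs)"
  have p: "pluggable k g f" "plugs (Suc k) g fs" using Cons.prems by auto
  have s: "pluggable k ?h f" using p subst_from_facts(5)[OF Cons.prems(1) p(2), of k f] by simp
  have "carries (braid_shift (Suc k + ?s) w) ?h ?h'"
    using Cons.prems(3) by (intro Cons.IH[OF Cons.prems(1) p(2)]) simp
  then have "carries (braid_shift (Suc k) (braid_shift ?s w)) ?h ?h'"
    by (simp add: braid_shift_braid_shift add.commute)
  from carries_after[OF s this] show ?case
    by (simp add: braid_shift_braid_shift ac_simps)
qed simp

lemma carries_subst_from_inner:
  "\<lbrakk>g \<in> arrows; plugs k g fs; list_all2 (\<lambda>w f. carries w f (word_action w f)) ws fs\<rbrakk> \<Longrightarrow>
    carries (braid_shift k (juxtapose_words (map arity fs) ws)) (subst_from C k g fs)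
      (subst_from C k g (map2 word_action ws fs))"
proof (induction fs arbitrary: k ws)
  case (Cons f fs)
  obtain w vs where ws: "ws = w # vs" using Cons.prems(3) by (cases ws) auto
  let ?f = "word_action w f"
  let ?h = "subst_from C (Suc k) g fs" and ?h' = "subst_from C (Suc k) g (map2 word_action vs fs)"
    and ?J = "juxtapose_words (map arity fs) vs"
  have p: "pluggable k g f" "plugs (Suc k) g fs" "carries w f ?f" using Cons.prems ws by auto
  have s: "pluggable k ?h f" using p subst_from_facts(5)[OF Cons.prems(1) p(2), of k f] by simp
  note c = carries_facts[OF p(3)]
  have s': "pluggable k ?h ?f" using s c(1,3) by (simp add: pluggable_def composable_def)
  have IH: "carries (braid_shift (Suc k) ?J) ?h ?h'"
    using Cons.prems(3) ws by (intro Cons.IH[OF Cons.prems(1) p(2)]) simp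
  have "carries (braid_shift k w @ braid_shift (k + arity f) ?J) (?h \<circ>[k] f) (?h' \<circ>[k] ?f)"
    using carries_append_trans[OF carries_inner[OF s p(3)] conjunct1[OF carries_after[OF s' IH]]] c(4)
    by simp
  then show ?case by (simp add: ws braid_shift_braid_shift add.commute)
qed simp

lemma cross_subst_from:
  "\<lbrakk>g \<in> arrows; plugs k g fs; crossable i g; Suc i < k\<rbrakk> \<Longrightarrow>
    subst_from C k (cross i g) fs = cross i (subst_from C k g fs) \<and> crossable i (subst_from C k g fs)"
proof (induction fs arbitrary: k)
  case (Cons f fs)
  let ?h = "subst_from C (Suc k) g fs"
  have p: "pluggable k g f" "plugs (Suc k) g fs" using Cons.prems by auto
  have s: "pluggable k ?h f" using p subst_from_facts(5)[OF Cons.prems(1) p(2), of k f] by simp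
  note IH = Cons.IH[OF Cons.prems(1) p(2) Cons.prems(3)]
  show ?case using IH Cons.prems(4) cross_subst_after[OF s] crossable_outer[OF s] by simp
qed simp

text \<open>The arguments behind the crossed inputs do not affect the crossing, the two crossed arguments turn
  it into a crossing of blocks, and those in front shift this block crossing to the right.\<close>

lemma carries_multisubst_cross:
  assumes "set fs \<subseteq> arrows" "map out fs = ins g" "crossable i g"
  shows "carries (block_letter (map arity fs) (i, True)) (multisubst C g fs)
    (multisubst C (cross i g) (permute_list (transpose i (Suc i)) fs))"
proof -
  have g: "g \<in> arrows" "Suc i < arity g" using assms(3) by (auto simp: crossable_def)
  have len: "length fs = arity g" using arg_cong[OF assms(2), of length] by simp
  define fs1 fs2 f f' where "fs1 = take i fs" and "fs2 = drop (Suc (Suc i)) fs"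
    and "f = fs ! i" and "f' = fs ! Suc i"
  have fs: "fs = fs1 @ f # f' # fs2" "length fs1 = i"
    using g(2) len by (simp_all add: fs1_def fs2_def f_def f'_def Cons_nth_drop_Suc)
  have perm: "permute_list (transpose i (Suc i)) fs = fs1 @ f' # f # fs2"
  proof (rule nth_equalityI)
    fix j assume "j < length (permute_list (transpose i (Suc i)) fs)"
    then show "permute_list (transpose i (Suc i)) fs ! j = (fs1 @ f' # f # fs2) ! j"
      using permute_list_transpose_nth[of i fs j] g(2) len fs(2)
      by (auto simp: fs(1) nth_append nth_Cons split: nat.split)
  qed (simp add: fs(1))
  have p: "plugs 0 g fs1" "pluggable i g f" "pluggable (Suc i) g f'" "plugs (i + 2) g fs2"
    using plugs_all[OF g(1) assms(1,2)] fs(2) by (auto simp: fs(1))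
  let ?x = "subst_from C (i + 2) g fs2"
  note F = subst_from_facts[OF g(1) p(4)]
  note X = cross_subst_from[OF g(1) p(4) assms(3)]
  have x: "pluggable i ?x f" "pluggable (Suc i) ?x f'" using p F(5) by simp_all
  let ?y = "(?x \<circ>[Suc i] f') \<circ>[i] f" and ?y' = "(cross i ?x \<circ>[Suc i] f) \<circ>[i] f'"
  have "carries (cross_blocks i (arity f) (arity f')) ?y ?y'"
    using X x by (intro carries_cross_blocks) auto
  then have c: "carries (braid_shift (0 + length fs1) (cross_blocks 0 (arity f) (arity f'))) ?y ?y'"
    by (simp add: braid_shift_cross_blocks fs(2))
  have s1: "pluggable i (?x \<circ>[Suc i] f') f" using x by (simp add: pluggable_outer)
  have "pluggable j ?y h \<longleftrightarrow> pluggable j g h" if "j < i" for j h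
    using that F(5)[of j h] pluggable_outer[OF s1, of j h] pluggable_outer[OF x(2), of j h] by simp
  then have p1: "plugs 0 ?y fs1" using p(1) fs(2) by (simp add: plugs_def)
  have "carries (braid_shift (0 + sum_list (map arity fs1)) (cross_blocks 0 (arity f) (arity f')))
      (subst_from C 0 ?y fs1) (subst_from C 0 ?y' fs1)"
    using s1 by (intro carries_subst_from_after[OF _ p1 c]) simp
  moreover have "subst_from C 0 ?y fs1 = multisubst C g fs"
    by (simp add: multisubst_def fs subst_from_append)
  moreover have "subst_from C 0 ?y' fs1 = multisubst C (cross i g) (fs1 @ f' # f # fs2)"
    using X by (simp add: multisubst_def fs(2) subst_from_append)
  moreover have "block_letter (map arity fs) (i, True) =
      cross_blocks (sum_list (map arity fs1)) (arity f) (arity f')"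
    using fs(2) by (simp add: block_letter_def Let_def fs(1) nth_append)
  ultimately show ?thesis unfolding perm by (simp add: braid_shift_cross_blocks)
qed

lemma permute_list_typing:
  assumes "map out fs = ins g" "set fs \<subseteq> arrows" "ins g' = permute_list r (ins g)" "r permutes {..<arity g}"
  shows "map out (permute_list r fs) = ins g'" "set (permute_list r fs) \<subseteq> arrows"
    "map arity (permute_list r fs) = permute_list r (map arity fs)"
proof -
  have len: "length fs = arity g" using arg_cong[OF assms(1), of length] by simp
  then have r: "r permutes {..<length fs}" using assms(4) by simp
  show "map out (permute_list r fs) = ins g'" using permute_list_map[OF r, of out] assms(1,3) by simp
  show "set (permute_list r fs) \<subseteq> arrows" using set_permute_list[OF r] assms(2) by simp
  show "map arity (permute_list r fs) = permute_list r (map arity fs)"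
    using permute_list_map[OF r, of arity] by simp
qed

text \<open>A negative letter is reduced to a positive one acting on \<open>inv.cross i g\<close>.\<close>

lemma carries_multisubst_letter:
  assumes "set fs \<subseteq> arrows" "map out fs = ins g" "crossable (fst l) g"
  shows "carries (block_letter (map arity fs) l) (multisubst C g fs)
    (multisubst C (cross_letter l g) (permute_list (transpose (fst l) (Suc (fst l))) fs))"
proof (cases "snd l")
  case True
  then show ?thesis
    using carries_multisubst_cross[OF assms] by (cases l) (simp add: cross_letter_def)
next
  case False
  define i where "i = fst l"
  have l: "l = (i, False)" using False by (cases l) (simp add: i_def)
  have c: "crossable i g" using assms(3) by (simp add: i_def)
  let ?t = "transpose i (Suc i)" and ?g = "inv.cross i g"
  have i: "Suc i < arity g" using c by (simp add: crossable_def)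
  have len: "length fs = arity g" using arg_cong[OF assms(2), of length] by simp
  have t: "?t permutes {..<arity g}" using i by (auto intro: permutes_swap_id)
  have c': "crossable i ?g" using inv.crossable_cross[OF c] c by simp
  note T = permute_list_typing[OF assms(2,1) inv.cross_simps(4)[OF c] t]
  have "carries (block_letter (permute_list ?t (map arity fs)) (i, True))
      (multisubst C ?g (permute_list ?t fs)) (multisubst C g fs)"
    using carries_multisubst_cross[OF T(2,1) c'] cross_inverse(2)[OF c] i len
    by (simp add: T(3) permute_list_transpose_twice)
  from carries_inverse[OF this]
  have "carries (inverse_word (block_letter (permute_list ?t (map arity fs)) (i, True)))
      (multisubst C g fs) (multisubst C ?g (permute_list ?t fs))" .
  moreover have "inverse_word (block_letter (permute_list ?t (map arity fs)) (i, True)) =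
      block_letter (map arity fs) l"
    using i len by (simp add: l block_letter_def Let_def permute_list_transpose_nth take_permute_list_transpose)
  ultimately show ?thesis by (simp add: l cross_letter_def)
qed

lemma carries_multisubst:
  "\<lbrakk>set fs \<subseteq> arrows; map out fs = ins g; carries w g g'\<rbrakk> \<Longrightarrow>
    carries (block_word (map arity fs) w) (multisubst C g fs) (multisubst C g' (permute_list (word_perm w) fs))"
proof (induction w arbitrary: g fs)
  case Nil
  then show ?case using multisubst_arity[of g fs] by simp
next
  case (Cons l w)
  let ?t = "transpose (fst l) (Suc (fst l))" and ?g = "cross_letter l g"
  have c: "crossable (fst l) g" "carries w ?g g'" using Cons.prems(3) by (auto simp: carries_Cons)
  have i: "Suc (fst l) < arity g" using c(1) by (simp add: crossable_def)
  then have t: "?t permutes {..<arity g}" by (auto intro: permutes_swap_id)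
  note T = permute_list_typing[OF Cons.prems(2,1) cross_letter_simps(4)[OF c(1)] t]
  have len: "length fs = arity g" using arg_cong[OF Cons.prems(2), of length] by simp
  have "word_perm w permutes {..<length fs}"
    using word_perm_permutes[OF carries_facts(8)[OF c(2)]] cross_letter_simps(5)[OF c(1)] len by simp
  then have "permute_list (word_perm (l # w)) fs = permute_list (word_perm w) (permute_list ?t fs)"
    unfolding word_perm_simps by (rule permute_list_compose)
  then show ?case
    using carries_append_trans[OF carries_multisubst_letter[OF Cons.prems(1,2) c(1)] Cons.IH[OF T(2,1) c(2)]]
    by (simp add: T(3) del: word_perm_simps)
qed

lemma cross_letter_loosen:
  assumes "crossable (fst l) f" "tight f"
  shows "cross_letter l (loosen C f) = loosen C (cross_letter l f)"
  using cross_loosen[OF assms] inv.cross_loosen[OF assms] by (simp add: cross_letter_def)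

lemma carries_loosen: "\<lbrakk>carries w f f'; tight f\<rbrakk> \<Longrightarrow> carries w (loosen C f) (loosen C f')"
proof (induction w arbitrary: f)
  case (Cons l w)
  have c: "crossable (fst l) f" "carries w (cross_letter l f) f'" using Cons.prems(1) by (auto simp: carries_Cons)
  have "tight (cross_letter l f)" using cross_letter_simps[OF c(1)] Cons.prems(2) by simp
  from Cons.IH[OF c(2) this] show ?case
    using cross_letter_loosen[OF c(1) Cons.prems(2)] c(1) Cons.prems(2) by (simp add: carries_Cons crossable_def)
qed simp

section \<open>The braiding given by a braided swap\<close>

text \<open>Any other representing word would do, by \<open>carries_cong\<close>.\<close>

definition braid_action :: "braid_word set \<Rightarrow> ('o, 'm) mmap \<Rightarrow> ('o, 'm) mmap" where
  "braid_action r f = (if f \<in> arrows \<and> r \<in> acting_braids (kind f) (arity f)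
    then word_action (SOME w. w \<in> acting_words (kind f) (arity f) \<and> r = braid_class (arity f) w) f
    else undefined)"

lemma carries_braid_action:
  assumes "f \<in> arrows" "w \<in> acting_words (kind f) (arity f)" "n = arity f"
  shows "carries w f (braid_action (braid_class n w) f)"
proof -
  let ?r = "braid_class (arity f) w"
  define v where "v = (SOME v. v \<in> acting_words (kind f) (arity f) \<and> ?r = braid_class (arity f) v)"
  have v: "v \<in> acting_words (kind f) (arity f) \<and> ?r = braid_class (arity f) v"
    unfolding v_def by (rule someI[of _ w]) (use assms in simp)
  have "braid_action ?r f = word_action v f"
    using assms by (simp add: braid_action_def acting_braids_eq v_def)
  then have c: "carries v f (braid_action ?r f)" using assms v by (simp add: carries_def)
  have "braid_eq (arity f) w v"
    using v assms(2) by (simp add: braid_class_eq_iff acting_words_braid_words)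
  then have "braid_eq (arity f) v w" by (rule braid_eq.sym)
  then show ?thesis unfolding assms(3) by (rule carries_cong[OF c _ assms(2)])
qed

lemma braid_action_eq: "carries w f f' \<Longrightarrow> n = arity f \<Longrightarrow> braid_action (braid_class n w) f = f'"
  using carries_braid_action[of f w n] by (simp add: carries_def)

lemma acting_braidsE:
  assumes "r \<in> acting_braids k n"
  obtains w where "w \<in> acting_words k n" "r = braid_class n w"
  using assms by (auto simp: acting_braids_eq)

lemma braiding_braid_action: "braiding C braid_action"
proof
  fix f r assume "f \<notin> arrows \<or> r \<notin> acting_braids (kind f) (arity f)"
  then show "braid_action r f = undefined" by (auto simp: braid_action_def)
next
  fix f r assume f: "f \<in> arrows" and "r \<in> acting_braids (kind f) (arity f)"
  then obtain w where w: "w \<in> acting_words (kind f) (arity f)" "r = braid_class (arity f) w"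
    by (rule_tac acting_braidsE)
  from carries_facts[OF carries_braid_action[OF f w(1) HOL.refl]]
  show "braid_action r f \<in> mmaps (homs C) (kind f) (permute_list (braid_perm r) (ins f)) (out f)"
    using w by (simp add: mmaps_iff braid_perm_class acting_words_braid_words)
next
  fix f assume "f \<in> arrows"
  then show "braid_action \<one>\<^bsub>braid_group (arity f)\<^esub> f = f"
    using braid_action_eq[of "[]" f f "arity f"] by (simp add: braid_group_def)
next
  fix f r s assume f: "f \<in> arrows" "r \<in> acting_braids (kind f) (arity f)" "s \<in> acting_braids (kind f) (arity f)"
  obtain u where u: "u \<in> acting_words (kind f) (arity f)" "r = braid_class (arity f) u"
    using f(2) by (rule acting_braidsE)
  obtain v where v: "v \<in> acting_words (kind f) (arity f)" "s = braid_class (arity f) v"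
    using f(3) by (rule acting_braidsE)
  note c = carries_braid_action[OF f(1) u(1) HOL.refl]
  let ?f = "braid_action (braid_class (arity f) u) f"
  have "carries v ?f (braid_action (braid_class (arity f) v) ?f)"
    using carries_facts[OF c] v by (intro carries_braid_action) auto
  from carries_append_trans[OF c this]
  show "braid_action (r \<otimes>\<^bsub>braid_group (arity f)\<^esub> s) f = braid_action s (braid_action r f)"
    using u v by (simp add: braid_mult_class acting_words_braid_words braid_action_eq)
next
  fix f r assume f: "f \<in> arrows" "tight f" "r \<in> acting_braids Tight (arity f)"
  obtain w where w: "w \<in> acting_words Tight (arity f)" "r = braid_class (arity f) w"
    using f(3) by (rule acting_braidsE)
  have "carries w (loosen C f) (loosen C (braid_action r f))"
    using f w by (intro carries_loosen) (simp_all add: carries_braid_action)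
  then show "braid_action r (loosen C f) = loosen C (braid_action r f)"
    using f w(2) by (simp add: braid_action_eq)
next
  fix g fs ss
  assume g: "g \<in> arrows" "set fs \<subseteq> arrows" "map out fs = ins g"
    and ss: "list_all2 (\<lambda>s f. s \<in> acting_braids (kind f) (arity f)) ss fs"
  have "\<exists>ws. list_all2 (\<lambda>w f. w \<in> acting_words (kind f) (arity f)) ws fs \<and>
      ss = map2 braid_class (map arity fs) ws"
    using ss
  proof (induction rule: list_all2_induct)
    case (Cons s ss f fs)
    then obtain ws where "list_all2 (\<lambda>w f. w \<in> acting_words (kind f) (arity f)) ws fs"
      "ss = map2 braid_class (map arity fs) ws" by blast
    moreover obtain w where "w \<in> acting_words (kind f) (arity f)" "s = braid_class (arity f) w"
      using Cons(1) by (rule acting_braidsE)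
    ultimately show ?case by (intro exI[of _ "w # ws"]) simp
  qed simp
  then obtain ws where ws: "list_all2 (\<lambda>w f. w \<in> acting_words (kind f) (arity f)) ws fs"
    "ss = map2 braid_class (map arity fs) ws" by blast
  have len: "length ws = length fs" using ws(1) by (rule list_all2_lengthD)
  have *: "carries w f (word_action w f) \<and> word_action w f = braid_action (braid_class (arity f) w) f"
    if "w \<in> acting_words (kind f) (arity f)" "f \<in> arrows" for w f
    using carries_braid_action[of f w "arity f"] that by (simp add: carries_def)
  have n: "ws ! i \<in> acting_words (kind (fs ! i)) (arity (fs ! i)) \<and> fs ! i \<in> arrows" if "i < length fs" for i
    using ws(1) that g(2) by (auto simp: list_all2_conv_all_nth)
  have c: "list_all2 (\<lambda>w f. carries w f (word_action w f)) ws fs"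
    using n len by (simp add: list_all2_conv_all_nth carries_def)
  have m: "map2 braid_action ss fs = map2 word_action ws fs"
    using * n len by (intro nth_equalityI) (simp_all add: ws(2))
  have n': "ws ! i \<in> braid_words (arity (fs ! i))" if "i < length fs" for i
    using n[OF that] acting_words_braid_words by blast
  have j: "braid_juxtapose (map arity fs) ss =
      braid_class (sum_list (map arity fs)) (juxtapose_words (map arity fs) ws)"
    unfolding ws(2) using n' len by (intro braid_juxtapose_class) auto
  have "carries (juxtapose_words (map arity fs) ws) (multisubst C g fs) (multisubst C g (map2 word_action ws fs))"
    using carries_subst_from_inner[OF g(1) plugs_all[OF g] c] by (simp add: multisubst_def)
  then show "multisubst C g (map2 braid_action ss fs) =
      braid_action (braid_juxtapose (map arity fs) ss) (multisubst C g fs)"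
    unfolding m j using multisubst_arity[OF g] by (simp add: braid_action_eq)
next
  fix g fs r
  assume g: "g \<in> arrows" "set fs \<subseteq> arrows" "map out fs = ins g" "r \<in> acting_braids (kind g) (arity g)"
  obtain w where w: "w \<in> acting_words (kind g) (arity g)" "r = braid_class (arity g) w"
    using g(4) by (rule acting_braidsE)
  have len: "length (map arity fs) = arity g" using arg_cong[OF g(3), of length] by simp
  have b: "braid_block (map arity fs) r = braid_class (sum_list (map arity fs)) (block_word (map arity fs) w)"
    using braid_block_class[of w "map arity fs"] w len by (simp add: acting_words_braid_words)
  have p: "braid_perm r = word_perm w" using w by (simp add: braid_perm_class acting_words_braid_words)
  have "carries (block_word (map arity fs) w) (multisubst C g fs)
      (multisubst C (braid_action r g) (permute_list (word_perm w) fs))"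
    using w g by (intro carries_multisubst) (simp_all add: carries_braid_action)
  then show "multisubst C (braid_action r g) (permute_list (braid_perm r) fs) =
      braid_action (braid_block (map arity fs) r) (multisubst C g fs)"
    unfolding b p using multisubst_arity[OF g(1-3)] by (simp add: braid_action_eq)
qed

end

section \<open>From short braidings to braidings\<close>

lemma underlying_short_sel [simp]:
  "sobjs (underlying_short C) = objs C" "sident (underlying_short C) = ident C"
  "scomp (underlying_short C) = subst C 0" "sloosen (underlying_short C) = loosen C"
  "saction (underlying_short C) q ps f = subst C 0 q (multisubst C f ps)"
  "ssubst (underlying_short C) = subst C"
  by (simp_all add: underlying_short_def)

lemma all_mmaps_underlying_short:
  "f \<in> all_mmaps (shoms (underlying_short C)) \<longleftrightarrow> f \<in> all_mmaps (homs C) \<and> shape f \<in> short_shapes"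
  by (cases f) (auto simp: all_mmaps_def mmaps_def underlying_short_def shape_def split: if_splits)

lemma tight_mmaps_underlying_short:
  "n \<in> {1, 2, 3, 4} \<Longrightarrow> tight_mmaps (shoms (underlying_short C)) n = tight_mmaps (homs C) n"
  by (auto simp: tight_mmaps_def all_mmaps_underlying_short short_shapes_def)

lemma tight_mmaps_underlying_short_simps [simp]:
  "tight_mmaps (shoms (underlying_short C)) 2 = tight_mmaps (homs C) 2"
  "tight_mmaps (shoms (underlying_short C)) 3 = tight_mmaps (homs C) 3"
  "tight_mmaps (shoms (underlying_short C)) 4 = tight_mmaps (homs C) 4"
  by (simp_all add: tight_mmaps_underlying_short)

lemma mmaps_underlying_short:
  "length as \<in> {1, 2, 3, 4} \<Longrightarrow> mmaps (shoms (underlying_short C)) Tight as b = mmaps (homs C) Tight as b"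
  by (auto simp: mmaps_iff all_mmaps_underlying_short short_shapes_def shape_def)

lemma unary_morphisms_underlying_short [simp]:
  "unary_morphisms (shoms (underlying_short C)) = unary_morphisms (homs C)"
  by (auto simp: unary_morphisms_def all_mmaps_underlying_short short_shapes_def)

lemma acts_on_underlying_short:
  "acts_on (shoms (underlying_short C)) q ps f \<longleftrightarrow> q \<in> unary_morphisms (homs C) \<and> ins q = [out f] \<and>
    set ps \<subseteq> unary_morphisms (homs C) \<and> map out ps = ins f"
  by (simp add: acts_on_def)

lemma list_of_length_3: "length xs = 3 \<Longrightarrow> xs = [xs ! 0, xs ! 1, xs ! 2]"
  by (auto simp: list_eq_iff_nth_eq less_Suc_eq numeral_3_eq_3 numeral_2_eq_2)

lemma permute_list_12: "permute_list (transpose 1 2) [a, b, c] = [a, c, b]"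
  by (simp add: permute_list_def upt_rec numeral_2_eq_2 transpose_def)

locale short_braided = left_representable_multicategory C +
  short_braiding "underlying_short C" \<beta>32 \<beta>42 \<beta>43
  for C :: "('o, 'm) skew_multicat" and \<beta>32 \<beta>42 \<beta>43
begin

lemma \<beta>32_hom:
  assumes "h \<in> arrows" "tight h" "arity h = 3"
  shows "\<beta>32 h \<in> mmaps (homs C) Tight [ins h ! 0, ins h ! 2, ins h ! 1] (out h)"
proof -
  have "ins h = [ins h ! 0, ins h ! 1, ins h ! 2]" using assms(3) by (rule list_of_length_3)
  then have "h \<in> mmaps (homs C) Tight [ins h ! 0, ins h ! 1, ins h ! 2] (out h)"
    unfolding mmaps_iff using assms by blast
  then show ?thesis
    using bij_betwE[OF \<beta>32_bij[of "ins h ! 0" "ins h ! 1" "ins h ! 2" "out h"]]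
    by (simp add: mmaps_underlying_short)
qed

lemma \<beta>32_mmap:
  assumes "h \<in> arrows" "tight h" "arity h = 3"
  shows "\<beta>32 h \<in> mmaps (homs C) Tight (permute_list (transpose 1 2) (ins h)) (out h)"
  using \<beta>32_hom[OF assms] permute_list_12[of "ins h ! 0" "ins h ! 1" "ins h ! 2"]
  unfolding list_of_length_3[OF assms(3), symmetric] by metis

lemma \<beta>32_nat:
  assumes "h \<in> arrows" "tight h" "arity h = 3" "q \<in> unaries" "ins q = [out h]"
    "set [p1, p2, p3] \<subseteq> unaries" "map out [p1, p2, p3] = ins h"
  shows "\<beta>32 (q \<circ>[0] multisubst C h [p1, p2, p3]) = q \<circ>[0] multisubst C (\<beta>32 h) [p1, p3, p2]"
  using \<beta>32_natural[of h q p1 p2 p3] assms by (simp add: acts_on_underlying_short tight_mmaps_iff)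

lemma \<beta>32_pre:
  assumes "h \<in> arrows" "tight h" "arity h = 3" "p \<in> arrows" "tight p" "arity p = 1"
    and "pluggable j h p" "(j, i) \<in> {(0, 0), (1, 2), (2, 1)}"
  shows "\<beta>32 (h \<circ>[j] p) = \<beta>32 h \<circ>[i] p"
proof -
  let ?a = "ins h ! 0" and ?b = "ins h ! 1" and ?c = "ins h ! 2"
  have h: "ins h = [?a, ?b, ?c]" using assms(3) by (rule list_of_length_3)
  have b: "\<beta>32 h \<in> arrows" "out (\<beta>32 h) = out h" "ins (\<beta>32 h) = [?a, ?c, ?b]"
    using \<beta>32_hom[OF assms(1-3)] unfolding mmaps_iff by blast+
  have o: "?a \<in> objs C" "?b \<in> objs C" "?c \<in> objs C" "out h \<in> objs C"
    using assms(1,3) by (simp_all add: ins_objs out_objs)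
  note I = ident_simps[OF o(1)] ident_simps[OF o(2), unfolded One_nat_def] ident_simps[OF o(3)]
    ident_simps[OF o(4)]
  have p: "p \<in> unaries" using assms by (simp add: unaries_iff)
  have c: "composable j h p" "composable i (\<beta>32 h) p" "out p = ins h ! j"
    using assms(3,7,8) pluggableD(4)[OF assms(7)] b(3) by (auto simp: pluggable_def composable_def)
  have U: "ident C (out h) \<circ>[0] multisubst C x ((map (ident C) (ins x))[l := p]) = x \<circ>[l] p"
    if "x \<in> arrows" "composable l x p" "out x = out h" for x l
    using that assms(4) multisubst_ident_update[of x p l] subst_simps[of x p l] ident_subst[of "x \<circ>[l] p"] by simp
  define ps where "ps = (map (ident C) [?a, ?b, ?c])[j := p]"
  have ps: "ps = [ps ! 0, ps ! 1, ps ! 2]" "[ps ! 0, ps ! 2, ps ! 1] = (map (ident C) [?a, ?c, ?b])[i := p]"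
    using assms(8) by (auto simp: ps_def)
  have "set ps \<subseteq> unaries" "map out ps = [?a, ?b, ?c]"
    using assms(8) p c(3) by (auto simp: ps_def I)
  then have "set [ps ! 0, ps ! 1, ps ! 2] \<subseteq> unaries" "map out [ps ! 0, ps ! 1, ps ! 2] = ins h"
    unfolding ps(1)[symmetric] h[symmetric] .
  from \<beta>32_nat[OF assms(1-3) I(13,15) this]
  have "\<beta>32 (ident C (out h) \<circ>[0] multisubst C h ps) =
      ident C (out h) \<circ>[0] multisubst C (\<beta>32 h) ((map (ident C) (ins (\<beta>32 h)))[i := p])"
    unfolding ps(1)[symmetric] ps(2) b(3) .
  moreover have "ps = (map (ident C) (ins h))[j := p]" unfolding ps_def h[symmetric] ..
  ultimately show ?thesis using U[OF assms(1) c(1)] U[OF b(1) c(2) b(2)] by simp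
qed

lemma \<beta>32_post:
  assumes "pluggable 0 p h" "tight p" "arity p = 1" "tight h" "arity h = 3"
  shows "\<beta>32 (p \<circ>[0] h) = p \<circ>[0] \<beta>32 h"
proof -
  let ?a = "ins h ! 0" and ?b = "ins h ! 1" and ?c = "ins h ! 2"
  note D = pluggableD[OF assms(1)]
  have i: "ins h = [?a, ?b, ?c]" using assms(5) by (rule list_of_length_3)
  have b: "\<beta>32 h \<in> arrows" "ins (\<beta>32 h) = [?a, ?c, ?b]"
    using \<beta>32_hom[OF D(2) assms(4,5)] unfolding mmaps_iff by blast+
  have o: "?a \<in> objs C" "?b \<in> objs C" "?c \<in> objs C"
    using D(2) assms(5) by (simp_all add: ins_objs)
  have p: "p \<in> unaries" "ins p = [out h]"
    using D assms(2,3) by (auto simp: unaries_iff length_Suc_conv)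
  have "\<beta>32 (p \<circ>[0] multisubst C h [ident C ?a, ident C ?b, ident C ?c]) =
      p \<circ>[0] multisubst C (\<beta>32 h) [ident C ?a, ident C ?c, ident C ?b]"
    using p o ident_simps D(2) assms(4,5) by (intro \<beta>32_nat) (auto simp: i[symmetric, unfolded One_nat_def])
  moreover have "[ident C ?a, ident C ?b, ident C ?c] = map (ident C) (ins h)"
    "[ident C ?a, ident C ?c, ident C ?b] = map (ident C) (ins (\<beta>32 h))"
    by (subst i, simp) (subst b(2), simp)
  ultimately show ?thesis using multisubst_ident[OF D(2)] multisubst_ident[OF b(1)] by simp
qed

sublocale swap: natural_swap C \<beta>32
  using \<beta>32_mmap \<beta>32_post \<beta>32_pre[of _ _ 0 0] pluggableD by unfold_locales (blast, blast, simp)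

lemma \<beta>32_bij_betw: "bij_betw \<beta>32 (tights 3) (tights 3)"
proof (rule bij_betwI')
  have hom: "h \<in> mmaps (homs C) Tight [ins h ! 0, ins h ! 1, ins h ! 2] (out h)"
    if "h \<in> tights 3" for h
    using that list_of_length_3[of "ins h"] unfolding mmaps_iff tight_mmaps_iff by blast
  fix h h' assume h: "h \<in> tights 3" "h' \<in> tights 3"
  note s = swap.swap_simps[of h] swap.swap_simps[of h']
  have bij: "bij_betw \<beta>32 (mmaps (homs C) Tight [a, b, c] y) (mmaps (homs C) Tight [a, c, b] y)" for a b c y
    using \<beta>32_bij[of a b c y] by (simp add: mmaps_underlying_short)
  show "\<beta>32 h = \<beta>32 h' \<longleftrightarrow> h = h'"
  proof
    assume e: "\<beta>32 h = \<beta>32 h'"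
    then have "out h = out h'" "ins h ! 0 = ins h' ! 0" "ins h ! 1 = ins h' ! 1" "ins h ! 2 = ins h' ! 2"
      using s h by (simp_all add: tight_mmaps_iff)
    then show "h = h'"
      using hom[OF h(1)] hom[OF h(2)] e inj_onD[OF bij_betw_imp_inj_on[OF bij]] by metis
  qed simp
  show "\<beta>32 h \<in> tights 3" using s h by (simp add: tight_mmaps_iff)
  show "\<exists>x\<in>tights 3. h = \<beta>32 x"
  proof -
    have "h \<in> \<beta>32 ` mmaps (homs C) Tight [ins h ! 0, ins h ! 2, ins h ! 1] (out h)"
      using hom[OF h(1)] bij_betw_imp_surj_on[OF bij] by metis
    then show ?thesis by (auto simp: mmaps_iff tight_mmaps_iff)
  qed
qed

text \<open>The operations \<open>\<beta>42\<close> and \<open>\<beta>43\<close> are determined by \<open>\<beta>32\<close>, through the axioms on substitution into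
  the first input.\<close>

lemma cross_1_4:
  assumes "h \<in> tights 4"
  shows "swap.cross 1 h = \<beta>42 h"
proof -
  have h: "h \<in> arrows" "3 \<le> arity h" "arity h = 4" "tight h" using assms by (auto simp: tight_mmaps_iff)
  have pos: "0 < (3 :: nat)" by simp
  obtain g f where d: "pluggable 0 g f" "tight g" "kind f = kind h" "arity f = 3"
    "h = g \<circ>[0] f" "arity h = arity g + 3 - 1"
    by (rule left_factor[OF h(1,2) pos])
  note D = pluggableD[OF d(1)]
  have f: "tight f" using d(3) h(4) by simp
  have g: "arity g = 2" using d(6) h(3) by simp
  have "swap.cross 1 h = g \<circ>[0] \<beta>32 f"
    unfolding d(5) using swap.cross_post[OF d(1,2), of 1] swap.cross_ternary[OF D(2) f d(4)] D(2) d(4)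
    by (simp add: swap.crossable_def)
  also have "\<dots> = \<beta>42 h"
    unfolding d(5) using ssubst_0_\<beta>32[of g f] D f d(1,2,4) g by (simp add: tight_mmaps_iff pluggable_def)
  finally show ?thesis .
qed

lemma cross_2_4:
  assumes "h \<in> tights 4"
  shows "swap.cross 2 h = \<beta>43 h"
proof -
  have h: "h \<in> arrows" "2 \<le> arity h" "arity h = 4" "tight h" using assms by (auto simp: tight_mmaps_iff)
  have pos: "0 < (2 :: nat)" by simp
  obtain g f where d: "pluggable 0 g f" "tight g" "kind f = kind h" "arity f = 2"
    "h = g \<circ>[0] f" "arity h = arity g + 2 - 1"
    by (rule left_factor[OF h(1,2) pos])
  note D = pluggableD[OF d(1)]
  have f: "tight f" using d(3) h(4) by simp
  have g: "arity g = 3" using d(6) h(3) by simp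
  have c: "swap.crossable 1 g" using D(1) g by (simp add: swap.crossable_def)
  have "2 = 1 + arity f - 1" using d(4) by simp
  then have "swap.cross 2 h = swap.cross 1 g \<circ>[0] f"
    unfolding d(5) by (rule swap.cross_pre[OF d(1,2) c])
  also have "swap.cross 1 g = \<beta>32 g" by (rule swap.cross_ternary[OF D(1) d(2) g])
  also have "\<beta>32 g \<circ>[0] f = \<beta>43 h"
    unfolding d(5) using \<beta>43_ssubst_0[of g f] D f d(1,2,4) g by (simp add: tight_mmaps_iff pluggable_def)
  finally show ?thesis .
qed

sublocale swap: braided_swap C \<beta>32
proof
  show "bij_betw \<beta>32 (tights 3) (tights 3)" by (rule \<beta>32_bij_betw)
  fix h h'
  assume "\<beta>32 h = \<beta>32 h'" "h \<in> arrows" "tight h" "arity h = 3" "h' \<in> arrows" "tight h'" "arity h' = 3"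
  then show "h = h'"
    using inj_onD[OF bij_betw_imp_inj_on[OF \<beta>32_bij_betw], of h h'] by (simp add: tight_mmaps_iff)
next
  fix h p assume "pluggable 1 h p" "tight p" "arity p = 1" "tight h" "arity h = 3"
  then show "\<beta>32 (h \<circ>[1] p) = \<beta>32 h \<circ>[2] p" using \<beta>32_pre[of h p 1 2] pluggableD[of 1 h p] by simp
next
  fix h p assume "pluggable 2 h p" "tight p" "arity p = 1" "tight h" "arity h = 3"
  then show "\<beta>32 (h \<circ>[2] p) = \<beta>32 h \<circ>[1] p" using \<beta>32_pre[of h p 2 1] pluggableD[of 2 h p] by simp
next
  fix g h assume a: "pluggable 1 g h" "tight g" "arity g = 2" "tight h" "arity h = 3"
  have "g \<circ>[1] h \<in> tights 4" using a by (simp add: tight_mmaps_iff)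
  then show "swap.cross 2 (g \<circ>[1] h) = g \<circ>[1] \<beta>32 h"
    using cross_2_4 ssubst_1_\<beta>32[of g h] a pluggableD[OF a(1)] by (simp add: tight_mmaps_iff pluggable_def)
next
  fix g f assume a: "pluggable 1 g f" "tight g" "arity g = 3" "tight f" "arity f = 2"
  have x: "g \<circ>[1] f \<in> tights 4" using a by (simp add: tight_mmaps_iff)
  then have "swap.cross 2 (g \<circ>[1] f) \<in> tights 4"
    using swap.cross_simps[of 2 "g \<circ>[1] f"] by (simp add: tight_mmaps_iff swap.crossable_def)
  then have "swap.cross 1 (swap.cross 2 (g \<circ>[1] f)) = \<beta>42 (\<beta>43 (g \<circ>[1] f))"
    using cross_1_4 cross_2_4[OF x] by simp
  then show "swap.cross 1 (swap.cross 2 (g \<circ>[1] f)) = \<beta>32 g \<circ>[2] f"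
    using \<beta>42_\<beta>43_ssubst_1[of g f] a pluggableD[OF a(1)] by (simp add: tight_mmaps_iff pluggable_def)
next
  fix g f assume a: "pluggable 2 g f" "tight g" "arity g = 3" "tight f" "arity f = 2"
  have x: "g \<circ>[2] f \<in> tights 4" using a by (simp add: tight_mmaps_iff)
  then have "swap.cross 1 (g \<circ>[2] f) \<in> tights 4"
    using swap.cross_simps[of 1 "g \<circ>[2] f"] by (simp add: tight_mmaps_iff swap.crossable_def)
  then have "swap.cross 2 (swap.cross 1 (g \<circ>[2] f)) = \<beta>43 (\<beta>42 (g \<circ>[2] f))"
    using cross_2_4 cross_1_4[OF x] by simp
  then show "swap.cross 2 (swap.cross 1 (g \<circ>[2] f)) = \<beta>32 g \<circ>[1] f"
    using \<beta>43_\<beta>42_ssubst_2[of g f] a pluggableD[OF a(1)] by (simp add: tight_mmaps_iff pluggable_def)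
next
  fix h assume h: "h \<in> arrows" "tight h" "arity h = 4"
  let ?T = "tights 4"
  have c: "swap.cross 1 x = \<beta>42 x \<and> \<beta>42 x \<in> ?T \<and> swap.cross 2 x = \<beta>43 x \<and> \<beta>43 x \<in> ?T" if "x \<in> ?T" for x
    using cross_1_4[OF that] cross_2_4[OF that] swap.cross_simps[of 1 x] swap.cross_simps[of 2 x] that
    by (auto simp: tight_mmaps_iff swap.crossable_def)
  have "h \<in> ?T" using h by (simp add: tight_mmaps_iff)
  then show "swap.cross 1 (swap.cross 2 (swap.cross 1 h)) = swap.cross 2 (swap.cross 1 (swap.cross 2 h))"
    using c \<beta>4_braid[of h] by simp
qed

lemma underlying_short_braiding_braid_action:
  "underlying_short_braiding C swap.braid_action = (\<beta>32, \<beta>42, \<beta>43)"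
proof -
  have gen: "swap.braid_action (braid_gen n i) f = swap.cross i f"
    if "f \<in> tights n" "0 < i" "Suc i < n" for n i f
    unfolding braid_gen_def using that
    by (intro swap.braid_action_eq) (simp_all add: swap.carries_Cons swap.crossable_def tight_mmaps_iff swap.cross_simps)
  have "restrict (swap.braid_action (braid_gen 3 1)) (tights 3) = \<beta>32"
    using \<beta>_extensional(1) swap.cross_ternary
    by (intro extensionalityI[of _ "tights 3"]) (simp_all add: gen tight_mmaps_iff)
  moreover have "restrict (swap.braid_action (braid_gen 4 1)) (tights 4) = \<beta>42"
    using \<beta>_extensional(2) cross_1_4
    by (intro extensionalityI[of _ "tights 4"]) (simp_all add: gen)
  moreover have "restrict (swap.braid_action (braid_gen 4 2)) (tights 4) = \<beta>43"
    using \<beta>_extensional(3) cross_2_4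
    by (intro extensionalityI[of _ "tights 4"]) (simp_all add: gen)
  ultimately show ?thesis by (simp add: underlying_short_braiding_def)
qed

end

section \<open>From braidings to short braidings\<close>

lemma block_word_ones:
  assumes "w \<in> braid_words n"
  shows "block_word (replicate n 1) w = w"
  using assms
proof (induction w)
  case (Cons l w)
  let ?ks = "replicate n 1 :: nat list"
  have l: "Suc (fst l) < n" using Cons.prems by simp
  have "permute_list (transpose (fst l) (Suc (fst l))) ?ks = ?ks"
    using l by (intro nth_equalityI) (auto simp: permute_list_transpose_nth)
  moreover have "block_letter ?ks l = [l]"
    using l by (cases l) (simp add: block_letter_def Let_def cross_one_def sum_list_replicate min_def)
  ultimately show ?case using Cons by simp
qed simp

lemma cross_blocks_1_1 [simp]: "cross_blocks k (Suc 0) (Suc 0) = [(k, True)]"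
  by (simp add: cross_one_def)

lemma juxtapose_words_Nil: "juxtapose_words ks (replicate n []) = []"
proof (induction ks arbitrary: n)
  case (Cons k ks)
  then show ?case by (cases n) simp_all
qed simp

lemma juxtapose_words_single:
  assumes "j < length ks" "\<And>i. i < j \<Longrightarrow> ks ! i = 1"
  shows "juxtapose_words ks ((replicate (length ks) [])[j := w]) = braid_shift j w"
  using assms
proof (induction ks arbitrary: j)
  case (Cons k ks)
  show ?case
  proof (cases j)
    case 0
    then show ?thesis by (simp add: juxtapose_words_Nil)
  next
    case (Suc i)
    have "k = 1" using Cons.prems(2)[of 0] Suc by simp
    moreover have "juxtapose_words ks ((replicate (length ks) [])[i := w]) = braid_shift i w"
      using Cons.prems(1) Cons.prems(2)[of "Suc _"] Suc by (intro Cons.IH) auto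
    ultimately show ?thesis using Suc by (simp add: braid_shift_braid_shift)
  qed
qed simp

context braiding
begin

abbreviation act_word :: "braid_word \<Rightarrow> ('o, 'm) mmap \<Rightarrow> ('o, 'm) mmap" where
  "act_word w f \<equiv> act (braid_class (arity f) w) f"

lemma act_word_facts:
  assumes "f \<in> arrows" "w \<in> acting_words (kind f) (arity f)"
  shows "act_word w f \<in> arrows" "kind (act_word w f) = kind f" "out (act_word w f) = out f"
    "ins (act_word w f) = permute_list (word_perm w) (ins f)" "arity (act_word w f) = arity f"
  using act_mmap[OF assms(1), of "braid_class (arity f) w"] assms
  by (auto simp: acting_braids_eq mmaps_iff braid_perm_class acting_words_braid_words)

lemma act_word_Nil: "f \<in> arrows \<Longrightarrow> act_word [] f = f"
  using act_one[of f] by (simp add: braid_group_def)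

lemma act_word_append:
  assumes "f \<in> arrows" "u \<in> acting_words (kind f) (arity f)" "v \<in> acting_words (kind f) (arity f)"
  shows "act_word (u @ v) f = act_word v (act_word u f)"
proof -
  have "act (braid_class (arity f) u \<otimes>\<^bsub>braid_group (arity f)\<^esub> braid_class (arity f) v) f =
      act (braid_class (arity f) v) (act_word u f)"
    using assms by (intro act_mult) (auto simp: acting_braids_eq)
  then show ?thesis
    using assms by (simp add: braid_mult_class acting_words_braid_words act_word_facts)
qed

text \<open>The law for simultaneous substitution, with identities in all inputs but one.\<close>

lemma act_word_subst:
  assumes "pluggable j g f" "w \<in> acting_words (kind f) (arity f)"
  shows "g \<circ>[j] act_word w f = act_word (braid_shift j w) (g \<circ>[j] f)"
proof -
  note D = pluggableD[OF assms(1)]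
  let ?I = "map (ident C) (ins g)"
  define fs ws where "fs = ?I[j := f]" and "ws = (replicate (arity g) [])[j := w]"
  have I: "ins (?I ! i) = [ins g ! i]" "out (?I ! i) = ins g ! i" "?I ! i \<in> arrows" "kind (?I ! i) = Tight"
    if "i < arity g" for i
    using ident_simps[OF ins_objs[OF D(1) that]] that by (auto simp: unaries_iff)
  have len: "length fs = arity g" "length ws = arity g" by (simp_all add: fs_def ws_def)
  have fs: "fs ! i = (if i = j then f else ?I ! i)" "ws ! i = (if i = j then w else [])" if "i < arity g" for i
    using that by (auto simp: fs_def ws_def nth_list_update)
  have out: "map out fs = ins g" using len fs(1) D I by (intro nth_equalityI) auto
  have "fs ! i \<in> arrows" if "i < arity g" for i using fs(1)[OF that] D(2) I(3)[OF that] by simp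
  then have arr: "set fs \<subseteq> arrows" using len by (auto simp: set_conv_nth)
  have ar: "arity (fs ! i) = 1" if "i < j" for i using fs(1)[of i] I(1)[of i] that D(3) by simp
  let ?ss = "map2 braid_class (map arity fs) ws"
  have w: "ws ! i \<in> acting_words (kind (fs ! i)) (arity (fs ! i))" if "i < arity g" for i
    using fs[OF that] assms(2) by simp
  then have ss: "list_all2 (\<lambda>s f. s \<in> acting_braids (kind f) (arity f)) ?ss fs"
    using len by (auto simp: list_all2_conv_all_nth acting_braids_eq)
  have m: "map2 act ?ss fs = ?I[j := act_word w f]"
  proof (rule nth_equalityI)
    fix i assume "i < length (map2 act ?ss fs)"
    then have i: "i < arity g" using len by simp
    then have "map2 act ?ss fs ! i = act_word (ws ! i) (fs ! i)" using len by simp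
    also have "\<dots> = ?I[j := act_word w f] ! i"
      using fs[OF i] i I(3)[OF i] act_word_Nil[of "?I ! i"] by (auto simp: nth_list_update)
    finally show "map2 act ?ss fs ! i = ?I[j := act_word w f] ! i" .
  qed (simp add: len)
  have "ws ! i \<in> braid_words (arity (fs ! i))" if "i < arity g" for i
    using w[OF that] acting_words_braid_words by blast
  then have "braid_juxtapose (map arity fs) ?ss = braid_class (sum_list (map arity fs)) (juxtapose_words (map arity fs) ws)"
    using len by (intro braid_juxtapose_class) auto
  moreover have "juxtapose_words (map arity fs) ws = braid_shift j w"
    using juxtapose_words_single[of j "map arity fs" w] ar D(3) len by (simp add: ws_def)
  moreover have "multisubst C g fs = g \<circ>[j] f"
    using multisubst_ident_update[of g f j] assms(1) by (simp add: fs_def pluggable_def)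
  moreover have "sum_list (map arity fs) = arity (g \<circ>[j] f)"
    using multisubst_arity(2)[OF D(1) arr out] \<open>multisubst C g fs = g \<circ>[j] f\<close> by simp
  moreover have "multisubst C g (?I[j := act_word w f]) = g \<circ>[j] act_word w f"
    using act_word_facts[OF D(2) assms(2)] D assms(1)
    by (intro multisubst_ident_update) (auto simp: composable_def)
  ultimately show ?thesis
    using multisubst_act[OF D(1) arr out ss] m by simp
qed

lemma act_word_multisubst_unary:
  assumes "f \<in> arrows" "set ps \<subseteq> unaries" "map out ps = ins f" "w \<in> acting_words (kind f) (arity f)"
  shows "act_word w (multisubst C f ps) = multisubst C (act_word w f) (permute_list (word_perm w) ps)"
proof -
  have arr: "set ps \<subseteq> arrows" using assms(2) by (auto simp: unaries_iff)
  have len: "length ps = arity f" using arg_cong[OF assms(3), of length] by simp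
  have "ps ! i \<in> unaries" if "i < arity f" for i
    using assms(2) len that nth_mem[of i ps] by auto
  then have ar: "map arity ps = replicate (arity f) 1"
    using len by (intro nth_equalityI) (auto simp: unaries_iff)
  have w: "w \<in> braid_words (arity f)" using assms(4) by (rule acting_words_braid_words)
  have "braid_block (map arity ps) (braid_class (arity f) w) = braid_class (arity f) w"
    using braid_block_class[of w "replicate (arity f) 1"] w block_word_ones[OF w]
    by (simp add: ar sum_list_replicate)
  moreover have "arity (multisubst C f ps) = arity f"
    using multisubst_arity(2)[OF assms(1) arr assms(3)] ar by (simp add: sum_list_replicate)
  moreover have "braid_class (arity f) w \<in> acting_braids (kind f) (arity f)"
    using assms(4) by (simp add: acting_braids_eq)
  ultimately show ?thesis
    using act_multisubst[OF assms(1) arr assms(3), of "braid_class (arity f) w"] w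
    by (simp add: braid_perm_class)
qed

lemma act_word_ternary:
  assumes "h \<in> arrows" "tight h" "arity h = 3" "{f1, f2, f3} \<subseteq> arrows" "[out f1, out f2, out f3] = ins h"
  shows "multisubst C (act_word [(1, True)] h) [f1, f3, f2] =
    act_word (cross_blocks (arity f1) (arity f2) (arity f3)) (multisubst C h [f1, f2, f3])"
proof -
  let ?w = "[(1, True)] :: braid_word" and ?fs = "[f1, f2, f3]"
  have w: "?w \<in> acting_words (kind h) (arity h)" using assms by simp
  have fs: "set ?fs \<subseteq> arrows" "map out ?fs = ins h" using assms(4,5) by simp_all
  have "braid_block (map arity ?fs) (braid_class 3 ?w) = braid_class (sum_list (map arity ?fs)) (block_word (map arity ?fs) ?w)"
    using braid_block_class[of ?w "map arity ?fs"] by (simp add: numeral_3_eq_3)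
  also have "block_word (map arity ?fs) ?w = cross_blocks (arity f1) (arity f2) (arity f3)"
    by (simp add: block_letter_def)
  finally have b: "braid_block (map arity ?fs) (braid_class 3 ?w) =
      braid_class (sum_list (map arity ?fs)) (cross_blocks (arity f1) (arity f2) (arity f3))" .
  have p: "permute_list (braid_perm (braid_class 3 ?w)) ?fs = [f1, f3, f2]"
    using permute_list_12[of f1 f2 f3] by (simp add: braid_perm_class numeral_2_eq_2)
  have "braid_class 3 ?w \<in> acting_braids (kind h) (arity h)"
    using w assms(3) by (auto simp: acting_braids_eq)
  from act_multisubst[OF assms(1) fs this] show ?thesis
    unfolding b p multisubst_arity(2)[OF assms(1) fs] assms(3) .
qed

lemma act_word_ternary_subst:
  assumes "h \<in> arrows" "tight h" "arity h = 3" "pluggable j h f"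
    and "(j, i) \<in> {(0, 0), (1, 2), (2, 1)}" "[n1, n2, n3] = [1, 1, 1][j := arity f]"
  shows "act_word [(1, True)] h \<circ>[i] f = act_word (cross_blocks n1 n2 n3) (h \<circ>[j] f)"
proof -
  let ?a = "ins h ! 0" and ?b = "ins h ! 1" and ?c = "ins h ! 2" and ?h = "act_word [(1, True)] h"
  have h: "ins h = [?a, ?b, ?c]" using assms(3) by (rule list_of_length_3)
  have w: "[(1, True)] \<in> acting_words (kind h) (arity h)" using assms by simp
  have "ins ?h = permute_list (transpose 1 2) (ins h)"
    using act_word_facts(4)[OF assms(1) w] by (simp add: numeral_2_eq_2)
  also have "\<dots> = permute_list (transpose 1 2) [?a, ?b, ?c]" using h by (rule arg_cong)
  finally have h': "?h \<in> arrows" "ins ?h = [?a, ?c, ?b]"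
    using act_word_facts(1)[OF assms(1) w] unfolding permute_list_12 by blast+
  have o: "?a \<in> objs C" "?b \<in> objs C" "?c \<in> objs C" using assms(1,3) by (simp_all add: ins_objs)
  note I = ident_simps[OF o(1)] ident_simps[OF o(2), unfolded One_nat_def] ident_simps[OF o(3)]
  note D = pluggableD[OF assms(4)]
  have U: "x \<circ>[l] f = multisubst C x ((map (ident C) as)[l := f])"
    if "x \<in> arrows" "ins x = as" "l < length as" "out f = as ! l" for x as l
    using multisubst_ident_update[of x f l] that D(2) by (simp add: composable_def)
  define fs where "fs = (map (ident C) [?a, ?b, ?c])[j := f]"
  have fs: "fs = [fs ! 0, fs ! 1, fs ! 2]" "[fs ! 0, fs ! 2, fs ! 1] = (map (ident C) [?a, ?c, ?b])[i := f]"
    using assms(5) by (auto simp: fs_def)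
  have arr: "{fs ! 0, fs ! 1, fs ! 2} \<subseteq> arrows"
    and out: "[out (fs ! 0), out (fs ! 1), out (fs ! 2)] = [?a, ?b, ?c]"
    and ar: "[arity (fs ! 0), arity (fs ! 1), arity (fs ! 2)] = [n1, n2, n3]"
    using assms(5,6) D(2,4) by (auto simp: fs_def I)
  have "h \<circ>[j] f = multisubst C h fs"
    unfolding fs_def using assms(5) D(4) by (intro U[OF D(1) h]) auto
  then have "h \<circ>[j] f = multisubst C h [fs ! 0, fs ! 1, fs ! 2]" unfolding fs(1)[symmetric] .
  moreover have "?h \<circ>[i] f = multisubst C ?h [fs ! 0, fs ! 2, fs ! 1]"
    unfolding fs(2) using assms(5) D(4) by (intro U[OF h']) auto
  ultimately show ?thesis
    using act_word_ternary[OF assms(1-3) arr out[folded h]] ar by simp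
qed

lemma act_word_bij:
  assumes "w \<in> acting_words k (length as)"
  shows "bij_betw (act (braid_class (length as) w)) (mmaps (homs C) k as b)
    (mmaps (homs C) k (permute_list (word_perm w) as) b)"
proof (rule bij_betw_byWitness[where f' = "act (braid_class (length as) (inverse_word w))"])
  have w: "inverse_word w \<in> acting_words k (length as)" "w \<in> braid_words (length as)"
    using assms acting_words_braid_words by auto
  have c: "braid_class (length as) (w @ inverse_word w) = braid_class (length as) []"
    "braid_class (length as) (inverse_word w @ w) = braid_class (length as) []"
    by (rule braid_class_eqI[OF inverse_word_cancel'[OF w(2)]])
      (rule braid_class_eqI[OF inverse_word_cancel[OF w(2)]])
  have p: "permute_list (word_perm w) as = bs \<Longrightarrow> permute_list (word_perm (inverse_word w)) bs = as" for bs
  proof -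
    have "word_perm (w @ inverse_word w) = word_perm []"
      using inverse_word_cancel'[OF w(2)] by (rule word_perm_cong)
    moreover have "word_perm (inverse_word w) permutes {..<length as}"
      using w(2) by (intro word_perm_permutes) simp
    ultimately show "permute_list (word_perm w) as = bs \<Longrightarrow> permute_list (word_perm (inverse_word w)) bs = as"
      using permute_list_compose[of "word_perm (inverse_word w)" as "word_perm w"] by auto
  qed
  have act: "act (braid_class (length as) v) f \<in> mmaps (homs C) k (permute_list (word_perm v) cs) b \<and>
      act (braid_class (length as) (v @ v')) f = act (braid_class (length as) v') (act (braid_class (length as) v) f)"
    if "v \<in> acting_words k (length as)" "v' \<in> acting_words k (length as)" "length cs = length as"
      "f \<in> mmaps (homs C) k cs b" for v v' cs f
    using act_word_facts[of f v] act_word_append[of f v v'] that by (auto simp: mmaps_iff)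
  have nil: "act (braid_class (length as) []) f = f" if "f \<in> mmaps (homs C) k cs b" "length cs = length as" for f cs
    using act_word_Nil[of f] that by (auto simp: mmaps_iff)
  let ?bs = "permute_list (word_perm w) as"
  show "\<forall>f\<in>mmaps (homs C) k as b. act (braid_class (length as) (inverse_word w)) (act (braid_class (length as) w) f) = f"
    using act[OF assms w(1)] nil c(1) by (metis (no_types, lifting))
  show "\<forall>f\<in>mmaps (homs C) k ?bs b. act (braid_class (length as) w) (act (braid_class (length as) (inverse_word w)) f) = f"
    using act[OF w(1) assms, of ?bs] nil[of _ ?bs] c(2) by (metis (no_types, lifting) length_permute_list)
  show "act (braid_class (length as) w) ` mmaps (homs C) k as b \<subseteq> mmaps (homs C) k ?bs b"
    using act[OF assms w(1)] by blast
  show "act (braid_class (length as) (inverse_word w)) ` mmaps (homs C) k ?bs b \<subseteq> mmaps (homs C) k as b"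
    using act[OF w(1) assms, of ?bs] p[OF HOL.refl] by auto
qed

lemma short_braiding_underlying:
  "case underlying_short_braiding C act of (b32, b42, b43) \<Rightarrow> short_braiding (underlying_short C) b32 b42 b43"
proof -
  define b32 b42 b43 where "b32 = restrict (act (braid_gen 3 1)) (tights 3)"
    and "b42 = restrict (act (braid_gen 4 1)) (tights 4)"
    and "b43 = restrict (act (braid_gen 4 2)) (tights 4)"
  let ?S = "underlying_short C"
  have b32: "b32 f = act_word [(1, True)] f" if "f \<in> tights 3" for f
    using that by (simp add: b32_def braid_gen_def tight_mmaps_iff)
  have b42: "b42 f = act_word [(1, True)] f" if "f \<in> tights 4" for f
    using that by (simp add: b42_def braid_gen_def tight_mmaps_iff)
  have b43: "b43 f = act_word [(2, True)] f" if "f \<in> tights 4" for f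
    using that by (simp add: b43_def braid_gen_def tight_mmaps_iff)
  have 4: "act_word w f \<in> tights 4" if "f \<in> tights 4" "w \<in> acting_words Tight 4" for w f
    using that act_word_facts[of f w] by (simp add: tight_mmaps_iff)
  have app: "act_word (u @ v) f = act_word v (act_word u f)"
    if "f \<in> tights 4" "u \<in> acting_words Tight 4" "v \<in> acting_words Tight 4" for u v f
    using that by (intro act_word_append) (auto simp: tight_mmaps_iff)
  have w: "[(1, True)] \<in> acting_words Tight 3" "[(1, True)] \<in> acting_words Tight 4" "[(2, True)] \<in> acting_words Tight 4"
    by simp_all
  have bij: "bij_betw b (mmaps (shoms ?S) Tight as y) (mmaps (shoms ?S) Tight (permute_list (word_perm w) as) y)"
    if "\<And>f. f \<in> tights n \<Longrightarrow> b f = act_word w f" "length as = n" "w \<in> acting_words Tight n" "n = 3 \<or> n = 4"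
    for b as y w n
  proof -
    have "bij_betw (act (braid_class (length as) w)) (mmaps (homs C) Tight as y)
        (mmaps (homs C) Tight (permute_list (word_perm w) as) y)"
      using that(2,3) by (intro act_word_bij) simp
    moreover have "b f = act (braid_class (length as) w) f" if "f \<in> mmaps (homs C) Tight as y" for f
      using \<open>\<And>f. f \<in> tights n \<Longrightarrow> b f = act_word w f\<close>[of f] that \<open>length as = n\<close>
      by (simp add: mmaps_iff tight_mmaps_iff)
    ultimately have "bij_betw b (mmaps (homs C) Tight as y) (mmaps (homs C) Tight (permute_list (word_perm w) as) y)"
      by (simp cong: bij_betw_cong)
    then show ?thesis
      using that(2,4) mmaps_underlying_short[of as C y]
        mmaps_underlying_short[of "permute_list (word_perm w) as" C y] by auto
  qed
  have nat: "act_word w (q \<circ>[0] multisubst C f ps) = q \<circ>[0] multisubst C (act_word w f) (permute_list (word_perm w) ps)"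
    if "f \<in> tights n" "acts_on (shoms ?S) q ps f" "w \<in> acting_words Tight n" for f n q ps w
  proof -
    have a: "q \<in> unaries" "ins q = [out f]" "set ps \<subseteq> unaries" "map out ps = ins f"
      using that(2) by (auto simp: acts_on_underlying_short)
    have f: "f \<in> arrows" "w \<in> acting_words (kind f) (arity f)" "arity f = n" using that by (auto simp: tight_mmaps_iff)
    have fit: "fits 0 f ps" using a fits_iff_acts by blast
    let ?m = "multisubst C f ps"
    have m: "?m \<in> arrows" "kind ?m = kind f" "out ?m = out f" "arity ?m = arity f"
      using Defs.skew_multicategory.subst_from_simps[OF skew_multicategory_axioms f(1) fit] by (simp_all add: multisubst_def)
    have s: "pluggable 0 q ?m" using a m by (auto simp: pluggable_def composable_def unaries_iff)
    have "q \<circ>[0] act_word w ?m = act_word w (q \<circ>[0] ?m)"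
      using act_word_subst[OF s, of w] m f by simp
    then show ?thesis using act_word_multisubst_unary[OF f(1) a(3,4) f(2)] m by simp
  qed
  have tight_mult: "q \<circ>[0] multisubst C f ps \<in> tights n"
    if "f \<in> tights n" "acts_on (shoms ?S) q ps f" for f n q ps
  proof -
    have a: "q \<in> unaries" "ins q = [out f]" "set ps \<subseteq> unaries" "map out ps = ins f"
      using that(2) by (auto simp: acts_on_underlying_short)
    have f: "f \<in> arrows" "tight f" "arity f = n" using that by (auto simp: tight_mmaps_iff)
    have fit: "fits 0 f ps" using a fits_iff_acts by blast
    let ?m = "multisubst C f ps"
    have m: "?m \<in> arrows" "kind ?m = kind f" "out ?m = out f" "arity ?m = arity f"
      using Defs.skew_multicategory.subst_from_simps[OF skew_multicategory_axioms f(1) fit] by (simp_all add: multisubst_def)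
    have "pluggable 0 q ?m" using a m by (auto simp: pluggable_def composable_def unaries_iff)
    then show ?thesis using a(1) m f by (simp add: tight_mmaps_iff unaries_iff)
  qed
  have p4: "permute_list (transpose 1 2) [a, b, c, d] = [a, c, b, d]"
    "permute_list (transpose 2 3) [a, b, c, d] = [a, b, d, c]" for a b c d :: 'x
    by (simp_all add: permute_list_def upt_rec numeral_2_eq_2 numeral_3_eq_3 transpose_def)
  have wp: "word_perm [(1, True)] = transpose 1 2" "word_perm [(2, True)] = transpose 2 3"
    by (simp_all add: numeral_2_eq_2 numeral_3_eq_3)
  have sub: "pluggable i g f" if "composable i g f" "g \<in> tights n" "f \<in> tights m"
    for i g f n m using that by (auto simp: pluggable_def tight_mmaps_iff)
  have t: "g \<in> arrows \<and> tight g \<and> arity g = n" if "g \<in> tights n" for g n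
    using that by (simp add: tight_mmaps_iff)
  have T4: "g \<circ>[i] f \<in> tights 4" if "pluggable i g f"
    "g \<in> tights n" "f \<in> tights m" "n + m = 5" for i g f n m
  proof -
    have "kind (g \<circ>[i] f) = Tight" using that t[OF that(2)] t[OF that(3)] by (cases "i = 0") auto
    then show ?thesis using that t[OF that(2)] t[OF that(3)] by (simp add: tight_mmaps_iff)
  qed
  have "short_braiding ?S b32 b42 b43"
  proof (intro short_braiding.intro short_skew_multicategory_underlying short_braiding_axioms.intro)
    show "b32 \<in> extensional (tight_mmaps (shoms ?S) 3)" "b42 \<in> extensional (tight_mmaps (shoms ?S) 4)"
      "b43 \<in> extensional (tight_mmaps (shoms ?S) 4)"
      by (simp_all add: b32_def b42_def b43_def)
    show "bij_betw b32 (mmaps (shoms ?S) Tight [a, b, c] y) (mmaps (shoms ?S) Tight [a, c, b] y)" for a b c y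
      using bij[of 3 b32 "[(1, True)]" "[a, b, c]" y] b32 unfolding wp permute_list_12 by simp
    show "bij_betw b42 (mmaps (shoms ?S) Tight [a, b, c, d] y) (mmaps (shoms ?S) Tight [a, c, b, d] y)" for a b c d y
      using bij[of 4 b42 "[(1, True)]" "[a, b, c, d]" y] b42 unfolding wp p4 by simp
    show "bij_betw b43 (mmaps (shoms ?S) Tight [a, b, c, d] y) (mmaps (shoms ?S) Tight [a, b, d, c] y)" for a b c d y
      using bij[of 4 b43 "[(2, True)]" "[a, b, c, d]" y] b43 unfolding wp p4 by simp
  next
    fix f q p1 p2 p3 assume a: "f \<in> tight_mmaps (shoms ?S) 3" "acts_on (shoms ?S) q [p1, p2, p3] f"
    then have f: "f \<in> tights 3" by simp
    show "b32 (saction ?S q [p1, p2, p3] f) = saction ?S q [p1, p3, p2] (b32 f)"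
      using nat[OF f a(2) w(1)] b32[OF tight_mult[OF f a(2)]] b32[OF f] unfolding wp permute_list_12 by simp
  next
    fix f q p1 p2 p3 p4 assume a: "f \<in> tight_mmaps (shoms ?S) 4" "acts_on (shoms ?S) q [p1, p2, p3, p4] f"
    then have f: "f \<in> tights 4" by simp
    show "b42 (saction ?S q [p1, p2, p3, p4] f) = saction ?S q [p1, p3, p2, p4] (b42 f)"
      using nat[OF f a(2) w(2)] b42[OF tight_mult[OF f a(2)]] b42[OF f] unfolding wp p4 by simp
    show "b43 (saction ?S q [p1, p2, p3, p4] f) = saction ?S q [p1, p2, p4, p3] (b43 f)"
      using nat[OF f a(2) w(3)] b43[OF tight_mult[OF f a(2)]] b43[OF f] unfolding wp p4 by simp
  next
    fix h assume "h \<in> tight_mmaps (shoms ?S) 4"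
    then have h: "h \<in> tights 4" by simp
    have "braid_eq 4 [(1, True), (2, True), (1, True)] [(2, True), (1, True), (2, True)]"
      using braid_eq.braid[of 1 4] by (simp add: numeral_2_eq_2)
    then have "braid_class 4 [(1, True), (2, True), (1, True)] = braid_class 4 [(2, True), (1, True), (2, True)]"
      by (rule braid_class_eqI)
    moreover have "b42 (b43 (b42 h)) = act_word [(1, True), (2, True), (1, True)] h"
      using app[OF h, of "[(1, True)]" "[(2, True), (1, True)]"] app[OF 4[OF h w(2)], of "[(2, True)]" "[(1, True)]"]
        4 h w b42 b43 by simp
    moreover have "b43 (b42 (b43 h)) = act_word [(2, True), (1, True), (2, True)] h"
      using app[OF h, of "[(2, True)]" "[(1, True), (2, True)]"] app[OF 4[OF h w(3)], of "[(1, True)]" "[(2, True)]"]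
        4 h w b42 b43 by simp
    ultimately show "b42 (b43 (b42 h)) = b43 (b42 (b43 h))" using t[OF h] by simp
  next
    fix g f assume a: "g \<in> tight_mmaps (shoms ?S) 2" "f \<in> tight_mmaps (shoms ?S) 3"
    then have gf: "g \<in> tights 2" "f \<in> tights 3" by simp_all
    { assume "composable 0 g f"
      then have s: "pluggable 0 g f" using gf by (rule sub)
      have "g \<circ>[0] f \<in> tights 4" using s gf by (rule T4) simp
      then show "ssubst ?S 0 g (b32 f) = b42 (ssubst ?S 0 g f)"
        using act_word_subst[OF s, of "[(1, True)]"] b42 b32 gf t[OF gf(2)] by simp }
    { assume "composable 1 g f"
      then have s: "pluggable 1 g f" using gf by (rule sub)
      have "g \<circ>[1] f \<in> tights 4" using s gf by (rule T4) simp
      then show "ssubst ?S 1 g (b32 f) = b43 (ssubst ?S 1 g f)"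
        using act_word_subst[OF s, of "[(1, True)]"] b43 b32 gf t[OF gf(2)] by (simp add: numeral_2_eq_2) }
  next
    fix g f assume a: "g \<in> tight_mmaps (shoms ?S) 3" "f \<in> tight_mmaps (shoms ?S) 2"
    then have gf: "g \<in> tights 3" "f \<in> tights 2" by simp_all
    have g: "g \<in> arrows" "tight g" "arity g = 3" "arity f = 2" using t gf by blast+
    { assume "composable 0 g f"
      then have s: "pluggable 0 g f" using gf by (rule sub)
      have "g \<circ>[0] f \<in> tights 4" using s gf by (rule T4) simp
      then show "b43 (ssubst ?S 0 g f) = ssubst ?S 0 (b32 g) f"
        using act_word_ternary_subst[OF g(1-3) s, of 0 2 1 1] b43 b32[OF gf(1)] g(4)
        by (simp add: cross_one_def numeral_2_eq_2) }
    { assume "composable 1 g f"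
      then have s: "pluggable 1 g f" using gf by (rule sub)
      have x: "g \<circ>[1] f \<in> tights 4" using s gf by (rule T4) simp
      have "cross_blocks 1 2 1 = [(2, True), (1, True)]"
        by (simp add: cross_one_def numeral_2_eq_2)
      then have "b32 g \<circ>[2] f = act_word ([(2, True)] @ [(1, True)]) (g \<circ>[1] f)"
        using act_word_ternary_subst[OF g(1-3) s, of 2 1 2 1] b32[OF gf(1)] g(4) by simp
      also have "\<dots> = b42 (b43 (g \<circ>[1] f))"
        unfolding app[OF x w(3,2)] b43[OF x] b42[OF 4[OF x w(3)]] ..
      finally show "b42 (b43 (ssubst ?S 1 g f)) = ssubst ?S 2 (b32 g) f" by simp }
    { assume "composable 2 g f"
      then have s: "pluggable 2 g f" using gf by (rule sub)
      have x: "g \<circ>[2] f \<in> tights 4" using s gf by (rule T4) simp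
      have "cross_blocks 1 1 2 = [(1, True), (2, True)]"
        by (simp add: cross_one_def upt_rec numeral_2_eq_2)
      then have "b32 g \<circ>[1] f = act_word ([(1, True)] @ [(2, True)]) (g \<circ>[2] f)"
        using act_word_ternary_subst[OF g(1-3) s, of 1 1 1 2] b32[OF gf(1)] g(4) by simp
      also have "\<dots> = b43 (b42 (g \<circ>[2] f))"
        unfolding app[OF x w(2,3)] b42[OF x] b43[OF 4[OF x w(2)]] ..
      finally show "b43 (b42 (ssubst ?S 2 g f)) = ssubst ?S 1 (b32 g) f" by simp }
  qed
  then show ?thesis by (simp add: underlying_short_braiding_def b32_def b42_def b43_def)
qed

end

section \<open>Uniqueness of the braiding\<close>

locale left_representable_braiding = left_representable_multicategory C + braiding C act
  for C :: "('o, 'm) skew_multicat" and act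
begin

definition "b32 = restrict (act (braid_gen 3 1)) (tights 3)"
definition "b42 = restrict (act (braid_gen 4 1)) (tights 4)"
definition "b43 = restrict (act (braid_gen 4 2)) (tights 4)"

lemma underlying_short_braiding_eq: "underlying_short_braiding C act = (b32, b42, b43)"
  by (simp add: underlying_short_braiding_def b32_def b42_def b43_def)

sublocale short_braided C b32 b42 b43
proof (intro short_braided.intro left_representable_multicategory_axioms)
  show "short_braiding (underlying_short C) b32 b42 b43"
    using short_braiding_underlying by (simp add: underlying_short_braiding_eq)
qed

text \<open>In a splitting \<open>g \<circ>[0] (h \<circ>[0] q)\<close> of \<open>f\<close>, the block braid for \<open>q\<close> in the first input of \<open>h\<close> turns
  the generator acting on \<open>h\<close> into the one crossing the inputs \<open>k\<close> and \<open>k + 1\<close>.\<close>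

lemma cross_eq_act_word:
  assumes "swap.crossable k f"
  shows "swap.cross k f = act_word [(k, True)] f"
proof -
  obtain g h q where "swap.crossing k f g h q"
    by (rule swap.crossable_decomposition[OF assms])
  note d = swap.crossingD[OF this]
  have h: "h \<in> arrows" using pluggableD(1)[OF d(2)] .
  have k: "kind q = Tight \<longrightarrow> 0 < k" using assms d(5) by (simp add: swap.crossable_def)
  have "b32 h = act_word [(1, True)] h"
    using h d(4,6) by (simp add: b32_def braid_gen_def tight_mmaps_iff)
  then have "b32 h \<circ>[0] q = act_word [(k, True)] (h \<circ>[0] q)"
    using act_word_ternary_subst[OF h d(4,6,2), of 0 k 1 1] d(7) by (simp add: cross_one_def)
  moreover have "[(k, True)] \<in> acting_words (kind (h \<circ>[0] q)) (arity (h \<circ>[0] q))"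
    using d(2,4,6,7) k by simp
  moreover have "pluggable 0 g (h \<circ>[0] q)" using d(1,2) by simp
  ultimately show ?thesis
    unfolding d(9) using act_word_subst[of 0 g "h \<circ>[0] q" "[(k, True)]"] d(8) by simp
qed

lemma cross_letter_eq_act_word:
  assumes "swap.crossable (fst l) f"
  shows "swap.cross_letter l f = act_word [l] f"
proof (cases "snd l")
  case True
  then show ?thesis using cross_eq_act_word[OF assms] by (cases l) (simp add: swap.cross_letter_def)
next
  case False
  let ?i = "fst l" and ?f = "swap.cross_letter l f"
  have l: "l = (?i, False)" using False by (cases l) simp
  note s = swap.cross_letter_simps[OF assms]
  have c: "swap.crossable ?i ?f" using s assms by (simp add: swap.crossable_def)
  have i: "Suc ?i < arity f" using assms by (simp add: swap.crossable_def)
  have w: "[(?i, True)] \<in> acting_words (kind ?f) (arity ?f)" "[l] \<in> acting_words (kind ?f) (arity ?f)"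
    using c by (auto simp: swap.crossable_def)
  have "swap.cross ?i ?f = f" using swap.cross_inverse(2)[OF assms] False by (simp add: swap.cross_letter_def)
  then have f: "act_word [(?i, True)] ?f = f" using cross_eq_act_word[OF c] by simp
  have "braid_eq (arity f) [(?i, True), (?i, \<not> True)] []" using i by (rule braid_eq.cancel)
  then have "braid_class (arity f) [(?i, True), l] = braid_class (arity f) []"
    using l by (intro braid_class_eqI) simp
  then have "?f = act_word ([(?i, True)] @ [l]) ?f" using act_word_Nil[OF s(1)] s(5) by simp
  also have "\<dots> = act_word [l] (act_word [(?i, True)] ?f)" by (rule act_word_append[OF s(1) w])
  also have "\<dots> = act_word [l] f" using f s(5) by simp
  finally show ?thesis .
qed

lemma carries_act_word: "swap.carries w f f' \<Longrightarrow> act_word w f = f'"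
proof (induction w arbitrary: f)
  case Nil
  then show ?case by (simp add: act_word_Nil)
next
  case (Cons l w)
  let ?f = "swap.cross_letter l f"
  have c: "swap.crossable (fst l) f" "swap.carries w ?f f'" using Cons.prems by (auto simp: swap.carries_Cons)
  have f: "f \<in> arrows" "[l] \<in> acting_words (kind f) (arity f)" using c(1) by (auto simp: swap.crossable_def)
  note s = swap.cross_letter_simps[OF c(1)]
  have w: "w \<in> acting_words (kind f) (arity f)" using swap.carries_facts(7)[OF c(2)] s by simp
  have "act_word (l # w) f = act_word w (act_word [l] f)" using act_word_append[OF f w] by simp
  also have "\<dots> = f'" using Cons.IH[OF c(2)] cross_letter_eq_act_word[OF c(1)] s(5) by simp
  finally show ?case .
qed

lemma act_eq_braid_action: "act = swap.braid_action"
proof (intro ext)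
  fix r f
  show "act r f = swap.braid_action r f"
  proof (cases "f \<in> arrows \<and> r \<in> acting_braids (kind f) (arity f)")
    case False
    then show ?thesis using act_undefined[of f r] by (auto simp: swap.braid_action_def)
  next
    case True
    then obtain w where w: "w \<in> acting_words (kind f) (arity f)" "r = braid_class (arity f) w"
      by (auto simp: acting_braids_eq)
    then show ?thesis
      using carries_act_word[OF swap.carries_braid_action[of f w "arity f"]] True by simp
  qed
qed

end

section \<open>Symmetries\<close>

text \<open>The Coxeter presentation of the symmetric group, as a quotient of the braid group.\<close>

inductive sym_eq :: "nat \<Rightarrow> braid_word \<Rightarrow> braid_word \<Rightarrow> bool" for n where
  braid: "braid_eq n u v \<Longrightarrow> sym_eq n u v"
| square: "Suc i < n \<Longrightarrow> sym_eq n [(i, True), (i, True)] []"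
| sym: "sym_eq n u v \<Longrightarrow> sym_eq n v u"
| trans [trans]: "sym_eq n u v \<Longrightarrow> sym_eq n v w \<Longrightarrow> sym_eq n u w"
| append: "sym_eq n u u' \<Longrightarrow> sym_eq n v v' \<Longrightarrow> sym_eq n (u @ v) (u' @ v')"

lemma sym_eq_refl: "w \<in> braid_words n \<Longrightarrow> sym_eq n w w"
  by (intro sym_eq.braid braid_eq.refl)

lemma sym_eq_perm: "sym_eq n u v \<Longrightarrow> word_perm u = word_perm v"
  by (induction rule: sym_eq.induct) (auto dest: word_perm_cong)

lemma sym_eq_shift: "sym_eq n u v \<Longrightarrow> sym_eq (Suc n) (braid_shift 1 u) (braid_shift 1 v)"
proof (induction rule: sym_eq.induct)
  case (braid u v)
  then show ?case by (intro sym_eq.braid braid_eq_shift) auto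
next
  case (square i)
  then show ?case by (auto intro: sym_eq.square)
next
  case (trans u v w)
  then show ?case by (meson sym_eq.trans)
next
  case (append u u' v v')
  then show ?case by (simp add: sym_eq.append)
qed (rule sym_eq.sym)

lemma sym_eq_letter:
  assumes "Suc i < n"
  shows "sym_eq n [(i, e)] [(i, True)]"
proof (cases e)
  case True
  then show ?thesis using assms by (simp add: sym_eq_refl)
next
  case False
  have 1: "sym_eq n [(i, False)] [(i, False)]" "sym_eq n [(i, True)] [(i, True)]"
    using assms by (simp_all add: sym_eq_refl)
  have 2: "sym_eq n [(i, False), (i, True)] []"
    using braid_eq.cancel[OF assms, of False] by (simp add: sym_eq.braid)
  have "sym_eq n ([(i, False)] @ []) ([(i, False)] @ [(i, True), (i, True)])"
    using 1 sym_eq.square[OF assms] by (blast intro: sym_eq.append sym_eq.sym)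
  also have "sym_eq n ([(i, False)] @ [(i, True), (i, True)]) ([] @ [(i, True)])"
    using sym_eq.append[OF 2 1(2)] by simp
  finally show ?thesis using False by simp
qed

text \<open>The words \<open>cross_one 0 p\<close> represent the cosets of the subgroup fixing the first strand: this set of
  cosets is closed under multiplication by generators, and so contains every word.\<close>

lemma coset_normal_form:
  assumes "w \<in> braid_words (Suc n)"
  shows "\<exists>u p. u \<in> braid_words n \<and> p \<le> n \<and> sym_eq (Suc n) w (braid_shift 1 u @ cross_one 0 p)"
  using assms
proof (induction w rule: rev_induct)
  case Nil
  show ?case by (intro exI[of _ "[]"] exI[of _ 0]) (simp add: cross_one_def sym_eq_refl)
next
  case (snoc l w)
  let ?n = "Suc n" and ?i = "fst l"
  obtain u p where up: "u \<in> braid_words n" "p \<le> n" "sym_eq ?n w (braid_shift 1 u @ cross_one 0 p)"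
    using snoc by auto
  have i: "?i < n" using snoc.prems by simp
  have "sym_eq ?n [(?i, snd l)] [(?i, True)]" using i by (intro sym_eq_letter) simp
  then have w: "sym_eq ?n (w @ [l]) (braid_shift 1 u @ cross_one 0 p @ [(?i, True)])"
    using sym_eq.append[OF up(3)] by fastforce
  have u: "sym_eq ?n (braid_shift 1 u) (braid_shift 1 u)"
    using up(1) by (intro sym_eq_refl braid_shift_words) auto
  have words: "cross_one 0 m \<in> braid_words ?n" if "m \<le> n" for m
    using that by (intro cross_one_words) auto
  consider "Suc ?i < p" | "p = Suc ?i" | "p = ?i" | "p < ?i" by linarith
  then show ?case
  proof cases
    case 1
    have "braid_eq ?n ([(Suc ?i, True)] @ cross_one 0 p) (cross_one 0 p @ [(?i, True)])"
      using cross_one_slide[of ?i p 0 ?n] 1 up(2) by simp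
    then have "sym_eq ?n (cross_one 0 p @ [(?i, True)]) ([(Suc ?i, True)] @ cross_one 0 p)"
      by (intro sym_eq.sym[OF sym_eq.braid])
    from sym_eq.trans[OF w sym_eq.append[OF u this]]
    have "sym_eq ?n (w @ [l]) (braid_shift 1 (u @ [(?i, True)]) @ cross_one 0 p)" by simp
    moreover have "u @ [(?i, True)] \<in> braid_words n" using up(1,2) 1 by simp
    ultimately show ?thesis using up(2) by blast
  next
    case 2
    have "sym_eq ?n (cross_one 0 ?i @ [(?i, True), (?i, True)]) (cross_one 0 ?i @ [])"
      using i by (intro sym_eq.append sym_eq_refl sym_eq.square words) auto
    then have "sym_eq ?n (cross_one 0 p @ [(?i, True)]) (cross_one 0 ?i)"
      by (simp add: 2 cross_one_def)
    from sym_eq.trans[OF w sym_eq.append[OF u this]] show ?thesis using up(1) i by (meson less_imp_le)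
  next
    case 3
    then have "cross_one 0 p @ [(?i, True)] = cross_one 0 (Suc p)" by (simp add: cross_one_def)
    then have "sym_eq ?n (w @ [l]) (braid_shift 1 u @ cross_one 0 (Suc p))" using w by simp
    then show ?thesis using up(1) i 3 by (meson Suc_leI)
  next
    case 4
    have "braid_eq ?n (cross_one 0 p @ [(?i, True)]) ([(?i, True)] @ cross_one 0 p)"
      using 4 i by (intro far_commutes words) (auto simp: far_apart_def cross_one_def)
    from sym_eq.trans[OF w sym_eq.append[OF u sym_eq.braid[OF this]]]
    have "sym_eq ?n (w @ [l]) (braid_shift 1 (u @ [(?i - 1, True)]) @ cross_one 0 p)" using 4 by simp
    moreover have "u @ [(?i - 1, True)] \<in> braid_words n" using up(1) i 4 by simp
    ultimately show ?thesis using up(2) by blast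
  qed
qed

lemma word_perm_cross_one: "word_perm (cross_one 0 p) p = 0"
proof (induction p)
  case (Suc p)
  have "cross_one 0 (Suc p) = cross_one 0 p @ [(p, True)]" by (simp add: cross_one_def)
  then show ?case using Suc by simp
qed (simp add: cross_one_def)

lemma word_perm_shift:
  "word_perm (braid_shift 1 w) 0 = 0" "word_perm (braid_shift 1 w) (Suc x) = Suc (word_perm w x)"
  by (induction w) (auto simp: transpose_def)

text \<open>In the normal form, \<open>p\<close> is the position that the permutation sends to 0.  So two words with the
  same permutation have the same \<open>p\<close>, and the remaining factors are compared by induction.\<close>

lemma word_perm_eq_imp_sym_eq:
  assumes "v \<in> braid_words n" "w \<in> braid_words n" "word_perm v = word_perm w"
  shows "sym_eq n v w"
  using assms
proof (induction n arbitrary: v w)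
  case 0
  then have "v = []" "w = []" by (auto simp: braid_words_def lists.simps)
  then show ?case by (simp add: sym_eq_refl)
next
  case (Suc n)
  obtain u p where u: "u \<in> braid_words n" "p \<le> n" "sym_eq (Suc n) v (braid_shift 1 u @ cross_one 0 p)"
    using coset_normal_form[OF Suc.prems(1)] by blast
  obtain x q where x: "x \<in> braid_words n" "q \<le> n" "sym_eq (Suc n) w (braid_shift 1 x @ cross_one 0 q)"
    using coset_normal_form[OF Suc.prems(2)] by blast
  have "word_perm (braid_shift 1 u @ cross_one 0 p) = word_perm (braid_shift 1 x @ cross_one 0 q)"
    using sym_eq_perm[OF u(3)] sym_eq_perm[OF x(3)] Suc.prems(3) by metis
  then have e: "word_perm (braid_shift 1 u) \<circ> word_perm (cross_one 0 p) =
      word_perm (braid_shift 1 x) \<circ> word_perm (cross_one 0 q)"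
    unfolding word_perm_simps(3) .
  have cw: "cross_one 0 m \<in> braid_words (Suc n)" if "m \<le> n" for m
    using that by (intro cross_one_words) auto
  have bij: "bij (word_perm (braid_shift 1 x) \<circ> word_perm (cross_one 0 q))" "bij (word_perm (cross_one 0 p))"
  proof -
    have "braid_shift 1 x \<in> braid_words (Suc n)" using x(1) by (intro braid_shift_words) auto
    then show "bij (word_perm (braid_shift 1 x) \<circ> word_perm (cross_one 0 q))" "bij (word_perm (cross_one 0 p))"
      using cw[OF x(2)] cw[OF u(2)] permutes_bij[OF word_perm_permutes] bij_comp by blast+
  qed
  have "(word_perm (braid_shift 1 x) \<circ> word_perm (cross_one 0 q)) p =
      (word_perm (braid_shift 1 x) \<circ> word_perm (cross_one 0 q)) q"
    using fun_cong[OF e, of p] by (simp add: word_perm_cross_one word_perm_shift[unfolded One_nat_def])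
  then have pq: "p = q" using bij(1) by (simp only: bij_is_inj[THEN inj_eq])
  have "word_perm (braid_shift 1 u) = word_perm (braid_shift 1 x)"
  proof
    fix y
    obtain z where "y = word_perm (cross_one 0 p) z" using bij(2) by (metis bij_pointE)
    then show "word_perm (braid_shift 1 u) y = word_perm (braid_shift 1 x) y"
      using fun_cong[OF e, of z] pq by simp
  qed
  then have "word_perm u y = word_perm x y" for y
    using word_perm_shift(2)[of u y] word_perm_shift(2)[of x y] by simp
  then have "word_perm u = word_perm x" by blast
  then have "sym_eq n u x" using u(1) x(1) by (intro Suc.IH)
  then have "sym_eq (Suc n) (braid_shift 1 u @ cross_one 0 p) (braid_shift 1 x @ cross_one 0 p)"
    using cw[OF u(2)] by (intro sym_eq.append sym_eq_shift sym_eq_refl)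
  then show ?case using u(3) x(3) pq by (meson sym_eq.trans sym_eq.sym)
qed

context braided_swap
begin

context
  assumes involutive: "\<And>h. h \<in> tights 3 \<Longrightarrow> \<beta> (\<beta> h) = h"
begin

lemma cross_involutive:
  assumes "crossable k f"
  shows "cross k (cross k f) = f"
proof -
  obtain g h q where "crossing k f g h q"
    by (rule crossable_decomposition[OF assms])
  note d = crossingD[OF this]
  note h = pluggableD(1)[OF d(2)] d(4,6)
  have s: "pluggable 0 g (\<beta> h)" "pluggable 0 (\<beta> h) q"
    using d(1,2) by (simp_all add: pluggable_swap[OF h])
  have "cross k (cross k f) = g \<circ>[0] (\<beta> (\<beta> h) \<circ>[0] q)"
    unfolding d(9) using cross_sandwich[OF s d(3) swap_simps(2,3)[OF h]] d(7) by simp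
  moreover have "\<beta> (\<beta> h) = h" using involutive h by (simp add: tight_mmaps_iff)
  ultimately show ?thesis using d(8) by simp
qed

lemma carries_sym_eq:
  assumes "sym_eq n u v" "d = (if k = Tight then 1 else 0)"
  shows "\<lbrakk>f \<in> arrows; arity f = n + d; kind f = k\<rbrakk> \<Longrightarrow>
    carries (braid_shift d u) f f' \<longleftrightarrow> carries (braid_shift d v) f f'"
  using assms(1)
proof (induction arbitrary: f f' rule: sym_eq.induct)
  case (braid u v)
  then show ?case using carries_shift_cong[OF braid.hyps assms(2)] by blast
next
  case (square i)
  have c: "crossable (i + d) f" using square assms(2) by (auto simp: crossable_def split: if_splits)
  show ?case using c cross_involutive[OF c] square.prems(1) by (auto simp: carries_Cons)
next
  case (append u u' v v')
  have "carries (braid_shift d v) x f' \<longleftrightarrow> carries (braid_shift d v') x f'" if "carries (braid_shift d u) f x" for x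
    using carries_facts(1,2,4)[OF that] append by auto
  moreover have "carries (braid_shift d u) f x \<longleftrightarrow> carries (braid_shift d u') f x" for x
    using append by blast
  ultimately show ?case by (auto simp: carries_append)
qed blast+

lemma symmetry_braid_action: "symmetry C braid_action"
proof (intro symmetry.intro symmetry_axioms.intro braiding_braid_action)
  fix f r s
  assume f: "f \<in> arrows" and r: "r \<in> acting_braids (kind f) (arity f)"
    and s: "s \<in> acting_braids (kind f) (arity f)" and p: "braid_perm r = braid_perm s"
  obtain u where u: "u \<in> acting_words (kind f) (arity f)" "r = braid_class (arity f) u"
    using r by (rule acting_braidsE)
  obtain v where v: "v \<in> acting_words (kind f) (arity f)" "s = braid_class (arity f) v"
    using s by (rule acting_braidsE)
  have uv: "word_perm u = word_perm v" using p u v by (simp add: braid_perm_class acting_words_braid_words)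
  define d where "d = (if kind f = Tight then 1 else 0 :: nat)"
  have "\<exists>n x y. arity f = n + d \<and> u = braid_shift d x \<and> v = braid_shift d y \<and> x \<in> braid_words n \<and>
      y \<in> braid_words n \<and> word_perm x = word_perm y"
  proof (cases "tight f")
    case False
    then show ?thesis using u v uv
      by (intro exI[of _ "arity f"] exI[of _ u] exI[of _ v]) (auto simp: d_def acting_words_braid_words)
  next
    case True
    obtain n where n: "arity f = Suc n" using tight_arity[OF f True] by (cases "arity f") auto
    obtain x where x: "u = braid_shift 1 x" "x \<in> braid_words n"
      using acting_words_Tight[of u "Suc n"] u(1) True n by auto
    obtain y where y: "v = braid_shift 1 y" "y \<in> braid_words n"
      using acting_words_Tight[of v "Suc n"] v(1) True n by auto
    have "word_perm x z = word_perm y z" for z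
      using word_perm_shift(2)[of x z] word_perm_shift(2)[of y z] uv x(1) y(1) by simp
    then have "word_perm x = word_perm y" by blast
    then show ?thesis using x y n True by (intro exI[of _ n] exI[of _ x] exI[of _ y]) (simp add: d_def)
  qed
  then obtain n x y where xy: "arity f = n + d" "u = braid_shift d x" "v = braid_shift d y"
    "x \<in> braid_words n" "y \<in> braid_words n" "word_perm x = word_perm y" by blast
  have "carries u f (braid_action r f)" using u f by (simp add: carries_braid_action)
  then have "carries v f (braid_action r f)"
    using carries_sym_eq[OF word_perm_eq_imp_sym_eq[OF xy(4-6)] d_def f xy(1) HOL.refl] xy(2,3) by simp
  then show "braid_action r f = braid_action s f" using braid_action_eq v(2) by metis
qed

end

end

lemma (in symmetry) act_gen_involutive:
  assumes "f \<in> tights 3"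
  shows "act (braid_gen 3 1) (act (braid_gen 3 1) f) = f"
proof -
  have f: "f \<in> arrows" "tight f" "arity f = 3" using assms by (auto simp: tight_mmaps_iff)
  let ?w = "[(1, True)] :: braid_word"
  have w: "?w \<in> acting_words (kind f) (arity f)" "?w @ ?w \<in> acting_words (kind f) (arity f)" using f by simp_all
  have "act_word (?w @ ?w) f = act_word [] f"
    using w f by (intro act_cong) (auto simp: acting_braids_eq braid_perm_class fun_eq_iff)
  then show ?thesis
    using act_word_append[OF f(1) w(1,1)] act_word_Nil[OF f(1)] act_word_facts(5)[OF f(1) w(1)] f(3)
    by (simp add: braid_gen_def)
qed

section \<open>The correspondence\<close>

theorem corollary5p23:
  fixes C :: "('o, 'm) skew_multicat"
  assumes "skew_multicategory C" and "left_representable C"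
  shows "bij_betw (underlying_short_braiding C)
      {act. braiding C act}
      {(\<beta>32, \<beta>42, \<beta>43). short_braiding (underlying_short C) \<beta>32 \<beta>42 \<beta>43}
    \<and> bij_betw (underlying_short_braiding C)
      {act. symmetry C act}
      {(\<beta>32, \<beta>42, \<beta>43). short_symmetry (underlying_short C) \<beta>32 \<beta>42 \<beta>43}"
proof -
  let ?U = "underlying_short_braiding C"
  let ?V = "\<lambda>(\<beta>32, \<beta>42, \<beta>43). braided_swap.braid_action C \<beta>32"
  interpret left_representable_multicategory C
    using assms by (simp add: left_representable_multicategory_def left_representable_multicategory_axioms_def)
  have braiding: "?V (?U act) = act \<and> (case ?U act of (\<beta>32, \<beta>42, \<beta>43) \<Rightarrow>
      short_braiding (underlying_short C) \<beta>32 \<beta>42 \<beta>43)" if "braiding C act" for act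
  proof -
    interpret left_representable_braiding C act
      using that left_representable_multicategory_axioms by (rule_tac left_representable_braiding.intro)
    show ?thesis
      using act_eq_braid_action short_braiding_axioms short_braiding_underlying
      by (simp add: underlying_short_braiding_eq)
  qed
  have short: "?U (?V b) = b \<and> braiding C (?V b)"
    if "case b of (\<beta>32, \<beta>42, \<beta>43) \<Rightarrow> short_braiding (underlying_short C) \<beta>32 \<beta>42 \<beta>43" for b
  proof -
    obtain \<beta>32 \<beta>42 \<beta>43 where b: "b = (\<beta>32, \<beta>42, \<beta>43)" by (cases b) auto
    interpret short_braided C \<beta>32 \<beta>42 \<beta>43
      using that b left_representable_multicategory_axioms by (simp add: short_braided.intro)
    show ?thesis
      using underlying_short_braiding_braid_action swap.braiding_braid_action by (simp add: b)
  qed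
  have symmetry: "case ?U act of (\<beta>32, \<beta>42, \<beta>43) \<Rightarrow> short_symmetry (underlying_short C) \<beta>32 \<beta>42 \<beta>43"
    if "symmetry C act" for act
  proof -
    interpret symmetry C act by (rule that)
    have "short_symmetry_axioms (underlying_short C) (restrict (act (braid_gen 3 1)) (tights 3))"
    proof
      fix f assume "f \<in> tight_mmaps (shoms (underlying_short C)) 3"
      then have f: "f \<in> tights 3" by simp
      have "act (braid_gen 3 1) f \<in> tights 3"
        using f act_word_facts[of f "[(1, True)]"] by (simp add: tight_mmaps_iff braid_gen_def)
      then show "restrict (act (braid_gen 3 1)) (tights 3)
          (restrict (act (braid_gen 3 1)) (tights 3) f) = f"
        using act_gen_involutive[OF f] f by simp
    qed
    moreover have "braiding C act" by (rule braiding_axioms)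
    ultimately show ?thesis
      using short_braiding_underlying by (simp add: underlying_short_braiding_def short_symmetry_def)
  qed
  have short_symmetry: "symmetry C (?V b)"
    if "case b of (\<beta>32, \<beta>42, \<beta>43) \<Rightarrow> short_symmetry (underlying_short C) \<beta>32 \<beta>42 \<beta>43" for b
  proof -
    obtain \<beta>32 \<beta>42 \<beta>43 where b: "b = (\<beta>32, \<beta>42, \<beta>43)" by (cases b) auto
    interpret s: short_symmetry "underlying_short C" \<beta>32 \<beta>42 \<beta>43 using that b by simp
    interpret short_braided C \<beta>32 \<beta>42 \<beta>43
      using left_representable_multicategory_axioms s.short_braiding_axioms by (rule short_braided.intro)
    show ?thesis using swap.symmetry_braid_action s.\<beta>32_involutive by (simp add: b)
  qed
  have short_braiding: "case b of (\<beta>32, \<beta>42, \<beta>43) \<Rightarrow> short_braiding (underlying_short C) \<beta>32 \<beta>42 \<beta>43"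
    if "case b of (\<beta>32, \<beta>42, \<beta>43) \<Rightarrow> short_symmetry (underlying_short C) \<beta>32 \<beta>42 \<beta>43" for b
    using that by (cases b) (simp add: short_symmetry_def)
  show ?thesis
  proof (intro conjI; rule bij_betw_byWitness[where f' = ?V])
    show "\<forall>act\<in>{act. braiding C act}. ?V (?U act) = act" using braiding by simp
    show "\<forall>act\<in>{act. symmetry C act}. ?V (?U act) = act" using braiding by (simp add: symmetry_def)
    show "\<forall>b\<in>{(\<beta>32, \<beta>42, \<beta>43). short_braiding (underlying_short C) \<beta>32 \<beta>42 \<beta>43}. ?U (?V b) = b"
      by (rule ballI, drule CollectD, drule short, erule conjunct1)
    show "\<forall>b\<in>{(\<beta>32, \<beta>42, \<beta>43). short_symmetry (underlying_short C) \<beta>32 \<beta>42 \<beta>43}. ?U (?V b) = b"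
      by (rule ballI, drule CollectD, drule short_braiding, drule short, erule conjunct1)
    show "?U ` {act. braiding C act} \<subseteq> {(\<beta>32, \<beta>42, \<beta>43). short_braiding (underlying_short C) \<beta>32 \<beta>42 \<beta>43}"
      by (rule image_subsetI, rule CollectI, drule CollectD, drule braiding, erule conjunct2)
    show "?U ` {act. symmetry C act} \<subseteq> {(\<beta>32, \<beta>42, \<beta>43). short_symmetry (underlying_short C) \<beta>32 \<beta>42 \<beta>43}"
      by (rule image_subsetI, rule CollectI, drule CollectD, erule symmetry)
    show "?V ` {(\<beta>32, \<beta>42, \<beta>43). short_braiding (underlying_short C) \<beta>32 \<beta>42 \<beta>43} \<subseteq> {act. braiding C act}"
      by (rule image_subsetI, rule CollectI, drule CollectD, drule short, erule conjunct2)
    show "?V ` {(\<beta>32, \<beta>42, \<beta>43). short_symmetry (underlying_short C) \<beta>32 \<beta>42 \<beta>43} \<subseteq> {act. symmetry C act}"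
      by (rule image_subsetI, rule CollectI, drule CollectD, erule short_symmetry)
  qed
qed

end
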